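(* Let $Y$ be a $\mathbb Z^d$-subshift. Assume that $Y$ contains a configuration that is not strongly periodic, but is strongly periodic outside of a finite region (i.e. it coincides with a strongly periodic configuration except on a finite set). Then the problem "$Y\hookrightarrow X$ for SFT inputs" is $\Sigma^0_1$-hard.
   Context: The integer $d\ge 1$ denotes the dimension. For a finite alphabet $\mathcal A$, the elements of $\mathcal A^{\mathbb Z^d}$ are called configurations, and $\mathbb Z^d$ acts on $\mathcal A^{\mathbb Z^d}$ (with the product topology) by $\sigma^u(x)(v)=x(v+u)$. A configuration $x$ is strongly periodic if its orbit $\{\sigma^u(x):u\in\mathbb Z^d\}$ is finite. A pattern is a function $p\colon S\to\mathcal A$ with $S\subset\mathbb Z^d$ finite; it appears in $x$ if $\sigma^u(x)|_S=p$ for some $u\in\mathbb Z^d$. A subshift is a (possibly empty) topologically closed, shift-invariant subset of $\mathcal A^{\mathbb Z^d}$; it is an SFT (subshift of finite type) if it is the set of configurations in which no pattern from some finite set $\mathcal F$ appears. $Y\hookrightarrow X$ means there is an embedding, i.e. a continuous, shift-commuting, injective map $Y\to X$. The subshift $Y$ is a fixed parameter. "The problem $Y\hookrightarrow X$ for SFT inputs" is: given a $\mathbb Z^d$-SFT $X$, specified by an alphabet and a finite set of forbidden patterns, determine whether $Y\hookrightarrow X$. Hardness is with respect to many-one reductions.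
   Formalization: Proved for dimension d ≥ 2 rather than d ≥ 1; for d = 1 the claim fails: if Y is the set of 0-1 sequences with at most one symbol 1, then Y ↪ X is decidable for ℤ-SFT inputs X. *)

theory Defs
  imports "HOL-Analysis.Analysis" "HOL-Library.Nat_Bijection"
begin

section \<open>Computability, many-one reductions and $\Sigma^0_1$-hardness\<close>

text \<open>Programs for the partial recursive functions on the natural numbers. Arguments are passed
  as a list; a program applied to a list of unsuitable length simply has no value.\<close>

datatype recf =
    Zero
  | Succ
  | Proj nat
  | Comp recf "recf list"
  | Prec recf recf
  | Mu recf

inductive rec_eval :: "recf \<Rightarrow> nat list \<Rightarrow> nat \<Rightarrow> bool" where
  zero: "rec_eval Zero xs 0"
| succ: "rec_eval Succ [x] (Suc x)"
| proj: "i < length xs \<Longrightarrow> rec_eval (Proj i) xs (xs ! i)"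
| comp: "list_all2 (\<lambda>g y. rec_eval g xs y) gs ys \<Longrightarrow> rec_eval f ys z \<Longrightarrow> rec_eval (Comp f gs) xs z"
| prec_0: "rec_eval f xs y \<Longrightarrow> rec_eval (Prec f g) (0 # xs) y"
| prec_Suc: "rec_eval (Prec f g) (n # xs) r \<Longrightarrow> rec_eval g (n # r # xs) y \<Longrightarrow>
    rec_eval (Prec f g) (Suc n # xs) y"
| mu: "rec_eval f (n # xs) 0 \<Longrightarrow> (\<forall>m<n. \<exists>y. rec_eval f (m # xs) (Suc y)) \<Longrightarrow>
    rec_eval (Mu f) xs n"

inductive_cases rec_eval_elims:
  "rec_eval Zero xs y"
  "rec_eval Succ xs y"
  "rec_eval (Proj i) xs y"
  "rec_eval (Comp f gs) xs y"
  "rec_eval (Prec f g) (0 # xs) y"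
  "rec_eval (Prec f g) (Suc n # xs) y"
  "rec_eval (Mu f) xs y"

lemma rec_eval_deterministic: "rec_eval f xs y \<Longrightarrow> rec_eval f xs z \<Longrightarrow> y = z"
proof (induction arbitrary: z rule: rec_eval.induct)
  case (zero xs)
  then show ?case by (rule rec_eval_elims(1)) simp
next
  case (succ x)
  then show ?case by (rule rec_eval_elims(2)) simp
next
  case (proj i xs)
  from proj(2) show ?case by (rule rec_eval_elims(3)) simp
next
  case (comp xs gs ys f y)
  from comp.prems obtain ys' where
    1: "list_all2 (\<lambda>g y. rec_eval g xs y) gs ys'" and 2: "rec_eval f ys' z"
    by (rule rec_eval_elims(4))
  have "ys = ys'"
  proof (rule nth_equalityI)
    show "length ys = length ys'"
      using list_all2_lengthD[OF comp.IH(1)] list_all2_lengthD[OF 1] by simp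
    fix i assume "i < length ys"
    then have i: "i < length gs"
      using list_all2_lengthD[OF comp.IH(1)] by simp
    show "ys ! i = ys' ! i"
      using list_all2_nthD[OF comp.IH(1) i] list_all2_nthD[OF 1 i] by blast
  qed
  with 2 have "rec_eval f ys z" by simp
  then show ?case by (rule comp.IH(2))
next
  case (prec_0 f xs y g)
  from prec_0.prems have "rec_eval f xs z" by (rule rec_eval_elims(5))
  then show ?case by (rule prec_0.IH)
next
  case (prec_Suc f g n xs r y)
  from prec_Suc.prems obtain r' where
    1: "rec_eval (Prec f g) (n # xs) r'" and 2: "rec_eval g (n # r' # xs) z"
    by (rule rec_eval_elims(6))
  from prec_Suc.IH(1)[OF 1] 2 have "rec_eval g (n # r # xs) z" by simp
  then show ?case by (rule prec_Suc.IH(2))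
next
  case (mu f n xs)
  from mu.prems obtain 1: "rec_eval f (z # xs) 0"
    and 2: "\<forall>m<z. \<exists>y. rec_eval f (m # xs) (Suc y)"
    by (rule rec_eval_elims(7))
  have "\<not> z < n"
  proof
    assume "z < n"
    with mu.IH(2) obtain y where "\<forall>w. rec_eval f (z # xs) w \<longrightarrow> Suc y = w" by blast
    with 1 show False by blast
  qed
  moreover have "\<not> n < z"
  proof
    assume "n < z"
    with 2 obtain y where "rec_eval f (n # xs) (Suc y)" by blast
    from mu.IH(1)[OF this] show False by simp
  qed
  ultimately show ?case by simp
qed

definition computable :: "(nat \<Rightarrow> nat) \<Rightarrow> bool" where
  "computable f \<longleftrightarrow> (\<exists>r. \<forall>n. rec_eval r [n] (f n))"

definition decidable2 :: "(nat \<Rightarrow> nat \<Rightarrow> bool) \<Rightarrow> bool" where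
  "decidable2 R \<longleftrightarrow> (\<exists>r. \<forall>n m. rec_eval r [n, m] (if R n m then 1 else 0))"

definition sigma01 :: "nat set \<Rightarrow> bool" where
  "sigma01 S \<longleftrightarrow> (\<exists>R. decidable2 R \<and> S = {n. \<exists>m. R n m})"

definition many_one_reducible :: "nat set \<Rightarrow> nat set \<Rightarrow> bool" where
  "many_one_reducible S T \<longleftrightarrow> (\<exists>f. computable f \<and> (\<forall>n. n \<in> S \<longleftrightarrow> f n \<in> T))"

definition sigma01_hard :: "nat set \<Rightarrow> bool" where
  "sigma01_hard T \<longleftrightarrow> (\<forall>S. sigma01 S \<longrightarrow> many_one_reducible S T)"


section \<open>Configurations and subshifts over $\mathbb{Z}^d$\<close>

text \<open>A vector of $\mathbb{Z}^d$ is the list of its $d$ coordinates. Configurations are the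
  functions on \<open>lattice d\<close>, extended by \<^const>\<open>undefined\<close> outside of it, so that they
  are exactly the points of the product topology.\<close>

type_synonym vec = "int list"

definition lattice :: "nat \<Rightarrow> vec set" where
  "lattice d = {v. length v = d}"

definition vadd :: "vec \<Rightarrow> vec \<Rightarrow> vec" where
  "vadd v u = map2 (+) v u"

definition configs :: "nat \<Rightarrow> 'a set \<Rightarrow> (vec \<Rightarrow> 'a) set" where
  "configs d A = lattice d \<rightarrow>\<^sub>E A"

definition config_top :: "nat \<Rightarrow> 'a set \<Rightarrow> (vec \<Rightarrow> 'a) topology" where
  "config_top d A = product_topology (\<lambda>_. discrete_topology A) (lattice d)"

lemma topspace_config_top: "topspace (config_top d A) = configs d A"
  by (simp add: config_top_def configs_def)

definition shift :: "nat \<Rightarrow> vec \<Rightarrow> (vec \<Rightarrow> 'a) \<Rightarrow> (vec \<Rightarrow> 'a)" where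
  "shift d u x = (\<lambda>v\<in>lattice d. x (vadd v u))"

definition strongly_periodic :: "nat \<Rightarrow> (vec \<Rightarrow> 'a) \<Rightarrow> bool" where
  "strongly_periodic d x \<longleftrightarrow> finite {shift d u x |u. u \<in> lattice d}"

definition strongly_periodic_outside_finite :: "nat \<Rightarrow> 'a set \<Rightarrow> (vec \<Rightarrow> 'a) \<Rightarrow> bool" where
  "strongly_periodic_outside_finite d A x \<longleftrightarrow>
    (\<exists>p\<in>configs d A. strongly_periodic d p \<and> finite {v \<in> lattice d. x v \<noteq> p v})"

definition subshift :: "nat \<Rightarrow> 'a set \<Rightarrow> (vec \<Rightarrow> 'a) set \<Rightarrow> bool" where
  "subshift d A Y \<longleftrightarrow> finite A \<and> closedin (config_top d A) Y \<and>
    (\<forall>u\<in>lattice d. \<forall>x\<in>Y. shift d u x \<in> Y)"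

definition embeds ::
  "nat \<Rightarrow> 'a set \<Rightarrow> (vec \<Rightarrow> 'a) set \<Rightarrow> 'b set \<Rightarrow> (vec \<Rightarrow> 'b) set \<Rightarrow> bool" where
  "embeds d A Y B X \<longleftrightarrow>
    (\<exists>f. continuous_map (subtopology (config_top d A) Y) (subtopology (config_top d B) X) f \<and>
         (\<forall>u\<in>lattice d. \<forall>y\<in>Y. f (shift d u y) = shift d u (f y)) \<and>
         inj_on f Y)"


section \<open>SFTs and their presentations\<close>

text \<open>A pattern is a partial map on vectors; its domain plays the role of the finite set $S$.\<close>

definition appears :: "nat \<Rightarrow> (vec \<rightharpoonup> 'a) \<Rightarrow> (vec \<Rightarrow> 'a) \<Rightarrow> bool" where
  "appears d p x \<longleftrightarrow> (\<exists>u\<in>lattice d. \<forall>v\<in>dom p. p v = Some (shift d u x v))"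

definition sft :: "nat \<Rightarrow> 'a set \<Rightarrow> (vec \<rightharpoonup> 'a) set \<Rightarrow> (vec \<Rightarrow> 'a) set" where
  "sft d A F = {x \<in> configs d A. \<forall>p\<in>F. \<not> appears d p x}"

text \<open>An input \<open>(k, ps)\<close> describes the SFT over the alphabet \<open>{..<k}\<close> whose forbidden
  patterns are listed in \<open>ps\<close>, each pattern being given by its graph.\<close>

type_synonym presentation = "nat \<times> (vec \<times> nat) list list"

definition valid_presentation :: "nat \<Rightarrow> presentation \<Rightarrow> bool" where
  "valid_presentation d P \<longleftrightarrow>
    (\<forall>p\<in>set (snd P). distinct (map fst p) \<and> (\<forall>(v, a)\<in>set p. v \<in> lattice d \<and> a < fst P))"

definition presented_alphabet :: "presentation \<Rightarrow> nat set" where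
  "presented_alphabet P = {..<fst P}"

definition presented_sft :: "nat \<Rightarrow> presentation \<Rightarrow> (vec \<Rightarrow> nat) set" where
  "presented_sft d P = sft d (presented_alphabet P) (map_of ` set (snd P))"

definition encode_cell :: "vec \<times> nat \<Rightarrow> nat" where
  "encode_cell c = prod_encode (list_encode (map int_encode (fst c)), snd c)"

definition encode_pattern :: "(vec \<times> nat) list \<Rightarrow> nat" where
  "encode_pattern p = list_encode (map encode_cell p)"

definition encode_presentation :: "presentation \<Rightarrow> nat" where
  "encode_presentation P = prod_encode (fst P, list_encode (map encode_pattern (snd P)))"

lemma inj_encode_presentation: "inj encode_presentation"
proof -
  have inj_map: "inj (\<lambda>xs. list_encode (map f xs))" if "inj f" for f :: "'c \<Rightarrow> nat"
    by (rule injI) (use that in \<open>simp add: list_encode_eq\<close>)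
  have inj_vec: "inj (\<lambda>v. list_encode (map int_encode v))"
    by (rule inj_map) (rule inj_int_encode)
  have "inj encode_cell"
    by (rule injI) (simp add: encode_cell_def prod_eq_iff inj_eq[OF inj_vec])
  then have inj_pattern: "inj encode_pattern"
    unfolding encode_pattern_def by (rule inj_map)
  show ?thesis
    by (rule injI)
      (simp add: encode_presentation_def prod_eq_iff inj_eq[OF inj_map[OF inj_pattern]])
qed

text \<open>The set of codes of yes-instances, for a fixed subshift \<open>Y\<close>. Dimension $1$ is special: if
  \<open>Y\<close> consists of the $0$-$1$-configurations with at most one symbol $1$, then \<open>Y\<close> embeds into
  \<open>X\<close> iff \<open>X\<close> contains a constant configuration and a nonconstant one that differs from it
  in finitely many places; for SFTs over $\mathbb{Z}$ this is decidable by inspecting a finite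
  graph. Hardness results of the kind considered here thus need $d \ge 2$.\<close>

definition embedding_problem :: "nat \<Rightarrow> 'a set \<Rightarrow> (vec \<Rightarrow> 'a) set \<Rightarrow> nat set" where
  "embedding_problem d A Y = {encode_presentation P |P.
    valid_presentation d P \<and> embeds d A Y (presented_alphabet P) (presented_sft d P)}"

end

theory Submission
  imports Defs
begin

text \<open>Let \<open>y\<close> agree with a strongly periodic \<open>q\<close> outside of a finite set, and let \<open>P\<close> be a common
  period of \<open>q\<close> along all axes. An embedding \<open>f\<close> maps \<open>y\<close> to a configuration that violates the period
  \<open>P\<close> at finitely many cells, but at least at one. For an instance \<open>n\<close> of a $\Sigma^0_1$ problem the
  target carries an unrestricted layer over the alphabet of \<open>Y\<close>, whose violations of \<open>P\<close> are
  marked as defects. Every defect either points, along rays, to a defect that comes later in the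
  lexicographic order of a plane, or it is the corner of a rectangle that displays a halting
  computation on input \<open>n\<close>. Rays and rectangles carry counters modulo \<open>P + 1\<close>, so they have to end
  when there are finitely many violations; the last defect then yields a halting computation.
  Conversely, if the computation halts within a rectangle of known size, a block map draws it at
  those defects that have no later defect nearby, and rays at all others; keeping the original
  configuration as a layer makes this map injective.

  The computations are nondeterministic programs on counters, built like regular expressions. A
  row of the rectangle holds the registers in unary. Only two vectors of the forbidden patterns
  depend on \<open>n\<close>, which makes the reduction computable.\<close>

section \<open>Recursive functions\<close>

text \<open>An arbitrary embedding guarantees only that \<open>f y\<close> violates \<open>P\<close>
  somewhere, but finitely often: somewhere, since otherwise the orbit of \<open>f y\<close> would be
  finite and by injectivity also that of \<open>y\<close>; finitely often, since \<open>f\<close> is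
  locally determined. The target has to turn this into a halting computation, yet its symbols cannot
  bound the size of that computation, because the forbidden patterns are fixed before it is known
  whether there is one. So lengths are tracked only modulo \<open>P + 1\<close>: a shift by
  \<open>P\<close> acts on such a counter as a shift by minus one, and an endless ray would violate
  \<open>P\<close> infinitely often. Conversely all of \<open>Y\<close> has to be mapped, including
  configurations with densely packed defects, where not every defect can own a rectangle. Passing
  the burden on to later defects solves this: defects that see no later one within a window are far
  apart, so their rectangles are disjoint. The window may grow with the halting time, because only
  the map depends on it and the target does not.\<close>

lemma rec_eval_Zero_iff: "rec_eval Zero xs y \<longleftrightarrow> y = 0"
  by (auto elim: rec_eval_elims intro: rec_eval.intros)

lemma rec_eval_Succ_iff: "rec_eval Succ xs y \<longleftrightarrow> (\<exists>x. xs = [x] \<and> y = Suc x)"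
  by (auto elim: rec_eval_elims intro: rec_eval.intros)

lemma rec_eval_Proj_iff: "rec_eval (Proj i) xs y \<longleftrightarrow> i < length xs \<and> y = xs ! i"
  by (auto elim: rec_eval_elims intro: rec_eval.intros)

lemma rec_eval_Comp_iff:
  "rec_eval (Comp f gs) xs z \<longleftrightarrow>
    (\<exists>ys. list_all2 (\<lambda>g y. rec_eval g xs y) gs ys \<and> rec_eval f ys z)"
  by (auto elim: rec_eval_elims intro: rec_eval.intros)

lemma rec_eval_Prec_0_iff: "rec_eval (Prec f g) (0 # xs) y \<longleftrightarrow> rec_eval f xs y"
  by (auto elim: rec_eval_elims intro: rec_eval.intros)

lemma rec_eval_Prec_Suc_iff:
  "rec_eval (Prec f g) (Suc n # xs) y \<longleftrightarrow>
    (\<exists>r. rec_eval (Prec f g) (n # xs) r \<and> rec_eval g (n # r # xs) y)"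
  by (auto elim: rec_eval_elims intro: rec_eval.intros)

lemma rec_eval_Prec_Nil: "\<not> rec_eval (Prec f g) [] y"
  by (auto elim: rec_eval.cases)

lemma rec_eval_Mu_iff:
  "rec_eval (Mu f) xs n \<longleftrightarrow>
    rec_eval f (n # xs) 0 \<and> (\<forall>m<n. \<exists>y. rec_eval f (m # xs) (Suc y))"
  by (auto elim: rec_eval_elims intro: rec_eval.intros)

lemmas rec_eval_iffs = rec_eval_Zero_iff rec_eval_Succ_iff rec_eval_Proj_iff rec_eval_Comp_iff
  rec_eval_Prec_0_iff rec_eval_Prec_Suc_iff rec_eval_Prec_Nil rec_eval_Mu_iff

lemma rec_eval_Comp1: "rec_eval g xs y \<Longrightarrow> rec_eval f [y] z \<Longrightarrow> rec_eval (Comp f [g]) xs z"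
  by (auto simp: rec_eval_Comp_iff)

lemma rec_eval_Comp2:
  "rec_eval g xs y \<Longrightarrow> rec_eval h xs y' \<Longrightarrow> rec_eval f [y, y'] z \<Longrightarrow>
    rec_eval (Comp f [g, h]) xs z"
  unfolding rec_eval_Comp_iff by (rule exI[of _ "[y, y']"]) simp

text \<open>\<open>prod_encode (m, n)\<close> is \<open>triangle (m + n) + m\<close>. Together with
  the successor, addition and triangular numbers are all the arithmetic that the codes of
  presentations require.\<close>

definition "rec_add = Prec (Proj 0) (Comp Succ [Proj 1])"
definition "rec_triangle = Prec Zero (Comp rec_add [Proj 1, Comp Succ [Proj 0]])"
definition "rec_prod_encode = Comp rec_add [Comp rec_triangle [rec_add], Proj 0]"

lemma rec_eval_add: "rec_eval rec_add [x, y] (x + y)"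
proof (induction x)
  case 0
  then show ?case by (simp add: rec_add_def rec_eval_iffs)
next
  case (Suc x)
  then show ?case unfolding rec_add_def rec_eval_Prec_Suc_iff
    by (intro exI conjI, assumption) (auto intro!: rec_eval_Comp1 simp: rec_eval_iffs)
qed

lemma rec_eval_triangle: "rec_eval rec_triangle [x] (triangle x)"
proof (induction x)
  case 0
  then show ?case by (simp add: rec_triangle_def rec_eval_iffs)
next
  case (Suc x)
  have "rec_eval (Comp rec_add [Proj 1, Comp Succ [Proj 0]]) [x, triangle x] (triangle (Suc x))"
    unfolding triangle_Suc
    by (rule rec_eval_Comp2[OF _ _ rec_eval_add]) (auto simp: rec_eval_iffs)
  with Suc show ?case unfolding rec_triangle_def rec_eval_Prec_Suc_iff by blast
qed

lemma rec_eval_prod_encode: "rec_eval rec_prod_encode [x, y] (prod_encode (x, y))"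
  unfolding rec_prod_encode_def prod_encode_def prod.case
  by (rule rec_eval_Comp2[OF rec_eval_Comp1[OF rec_eval_add rec_eval_triangle] _ rec_eval_add])
    (simp add: rec_eval_iffs)

lemma computable_id: "computable (\<lambda>n. n)"
  unfolding computable_def by (rule exI[of _ "Proj 0"]) (simp add: rec_eval_iffs)

lemma computable_Suc: "computable f \<Longrightarrow> computable (\<lambda>n. Suc (f n))"
  unfolding computable_def by (metis rec_eval_Comp1 rec_eval.succ)

lemma computable_const: "computable (\<lambda>n. c)"
proof (induction c)
  case 0
  show ?case unfolding computable_def by (rule exI[of _ Zero]) (simp add: rec_eval_iffs)
qed (rule computable_Suc)

lemma computable_comp2:
  assumes "\<And>x y. rec_eval r [x, y] (h x y)" and "computable f" and "computable g"
  shows "computable (\<lambda>n. h (f n) (g n))"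
proof -
  obtain p q where "\<And>n. rec_eval p [n] (f n)" "\<And>n. rec_eval q [n] (g n)"
    using assms(2,3) unfolding computable_def by blast
  then have "rec_eval (Comp r [p, q]) [n] (h (f n) (g n))" for n
    by (intro rec_eval_Comp2[OF _ _ assms(1)])
  then show ?thesis unfolding computable_def by blast
qed

lemmas computable_add = computable_comp2[OF rec_eval_add]
lemmas computable_prod_encode = computable_comp2[OF rec_eval_prod_encode]

text \<open>The length of \<open>xs\<close> does not depend on \<open>n\<close>, so the code is a
  fixed composition of pairings and no recursion over lists has to be programmed.\<close>

lemma computable_list_encode_append:
  assumes "\<And>x. x \<in> set xs \<Longrightarrow> computable (f x)" and "computable (\<lambda>n. list_encode (ys n))"
  shows "computable (\<lambda>n. list_encode (map (\<lambda>x. f x n) xs @ ys n))"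
  using assms(1)
  by (induction xs) (auto simp: assms(2) intro!: computable_Suc computable_prod_encode)


section \<open>Nondeterministic counter programs\<close>

text \<open>A failed \<open>Dec\<close> or \<open>Ztest\<close> has no successor. There is no
  conditional: \<open>Star\<close> guesses the number of rounds, and tests discard the wrong
  guesses.\<close>

datatype prog =
    Skip
  | Inc nat
  | Dec nat
  | Ztest nat
  | Seq prog prog
  | Star prog

primrec run :: "prog \<Rightarrow> (nat \<Rightarrow> nat) \<Rightarrow> (nat \<Rightarrow> nat) set" where
  "run Skip s = {s}"
| "run (Inc r) s = {s(r := Suc (s r))}"
| "run (Dec r) s = (if s r = 0 then {} else {s(r := s r - 1)})"
| "run (Ztest r) s = (if s r = 0 then {s} else {})"
| "run (Seq a b) s = (\<Union>s'\<in>run a s. run b s')"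
| "run (Star a) s = {s'. (\<lambda>s s'. s' \<in> run a s)\<^sup>*\<^sup>* s s'}"

lemma run_Seq_collect:
  "run a s = {F y |y. Q y} \<Longrightarrow> run (Seq a b) s = (\<Union>y\<in>{y. Q y}. run b (F y))"
  by auto

lemma run_Star_unfold: "run (Star a) s = insert s (\<Union>s'\<in>run a s. run (Star a) s')"
  by (auto elim: converse_rtranclpE intro: converse_rtranclp_into_rtranclp)

text \<open>\<open>Star\<close> may be left at any time, but \<open>Ztest\<close> blocks unless
  \<open>r\<close> has been counted down to zero, so the number of rounds is forced.\<close>

definition Loop :: "nat \<Rightarrow> prog \<Rightarrow> prog" where
  "Loop r b = Seq (Star (Seq (Dec r) b)) (Ztest r)"

lemma run_Loop_0: "s r = 0 \<Longrightarrow> run (Loop r b) s = {s}"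
  unfolding Loop_def run.simps(5)[of "Star _"] run_Star_unfold[of _ s] by auto

lemma run_Loop_Suc:
  "s r = Suc k \<Longrightarrow> run (Loop r b) s = (\<Union>s'\<in>run b (s(r := k)). run (Loop r b) s')"
  unfolding Loop_def run.simps(5)[of "Star _"] by (subst run_Star_unfold[of _ s]) auto

definition Clear :: "nat \<Rightarrow> prog" where
  "Clear r = Loop r Skip"

definition Move :: "nat \<Rightarrow> nat \<Rightarrow> prog" where
  "Move i j = Loop i (Inc j)"

text \<open>Reading a counter destroys it: \<open>i\<close> is emptied into both \<open>j\<close>
  and \<open>t\<close>, and then restored from \<open>t\<close>.\<close>

definition Copy :: "nat \<Rightarrow> nat \<Rightarrow> nat \<Rightarrow> prog" where
  "Copy i j t = Seq (Loop i (Seq (Inc j) (Inc t))) (Move t i)"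

lemma run_Clear: "run (Clear r) s = {s(r := 0)}"
proof (induction "s r" arbitrary: s)
  case 0
  then show ?case unfolding Clear_def by (subst run_Loop_0) auto
next
  case (Suc k)
  show ?case using Suc(1)[of "s(r := k)"] unfolding Clear_def
    by (subst run_Loop_Suc[of s, OF Suc(2)[symmetric]]) auto
qed

lemma run_Move: "i \<noteq> j \<Longrightarrow> run (Move i j) s = {s(i := 0, j := s j + s i)}"
proof (induction "s i" arbitrary: s)
  case 0
  then show ?case unfolding Move_def by (subst run_Loop_0) auto
next
  case (Suc k)
  show ?case using Suc(1)[of "s(i := k, j := Suc (s j))"] Suc(2,3) unfolding Move_def
    by (subst run_Loop_Suc[of s, OF Suc(2)[symmetric]]) (auto simp: fun_upd_twist)
qed

lemma run_Copy_loop: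
  "distinct [i, j, t] \<Longrightarrow>
    run (Loop i (Seq (Inc j) (Inc t))) s = {s(i := 0, j := s j + s i, t := s t + s i)}"
proof (induction "s i" arbitrary: s)
  case 0
  then show ?case by (subst run_Loop_0) auto
next
  case (Suc k)
  show ?case using Suc(1)[of "s(i := k, j := Suc (s j), t := Suc (s t))"] Suc(2,3)
    by (subst run_Loop_Suc[of s, OF Suc(2)[symmetric]]) (auto simp: fun_eq_iff)
qed

lemma run_Copy:
  "distinct [i, j, t] \<Longrightarrow> s t = 0 \<Longrightarrow> run (Copy i j t) s = {s(j := s j + s i)}"
  unfolding Copy_def run.simps(5)
  by (subst run_Copy_loop) (auto simp: run_Move fun_eq_iff)


section \<open>Compiling recursive functions to counter programs\<close>

definition store :: "nat \<Rightarrow> nat list \<Rightarrow> (nat \<Rightarrow> nat) \<Rightarrow> nat \<Rightarrow> nat" where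
  "store t ys s = (\<lambda>r. if t \<le> r \<and> r < t + length ys then ys ! (r - t) else s r)"

lemma store_Nil [simp]: "store t [] s = s"
  by (auto simp: store_def)

lemma store_Cons: "store t (y # ys) s = store (Suc t) ys (s(t := y))"
proof
  fix r show "store t (y # ys) s r = store (Suc t) ys (s(t := y)) r"
    by (cases "r = t") (auto simp: store_def nth_Cons' Suc_diff_Suc)
qed

primrec Clears :: "nat \<Rightarrow> nat \<Rightarrow> prog" where
  "Clears 0 t = Skip"
| "Clears (Suc m) t = Seq (Clear t) (Clears m (Suc t))"

lemma run_Clears: "run (Clears m t) s = {store t (replicate m 0) s}"
  by (induction m arbitrary: t s) (auto simp: run_Clear store_Cons)

primrec run_args ::
  "(nat list \<Rightarrow> nat \<Rightarrow> nat \<Rightarrow> prog) list \<Rightarrow> nat list \<Rightarrow> nat \<Rightarrow> nat \<Rightarrow> prog" where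
  "run_args [] is u t = Skip"
| "run_args (c # cs) is u t = Seq (c is u t) (run_args cs is (Suc u) t)"

text \<open>The arguments are read from the registers \<open>is\<close>, the result is put into the empty register
  \<open>u\<close>, and the registers from \<open>t\<close> on are scratch space: empty at the start and at the end.\<close>

primrec compile :: "recf \<Rightarrow> nat list \<Rightarrow> nat \<Rightarrow> nat \<Rightarrow> prog" where
  "compile Zero = (\<lambda>is u t. Skip)"
| "compile Succ = (\<lambda>is u t. if length is = 1 then Seq (Copy (hd is) u t) (Inc u)
     else Seq (Inc t) (Ztest t))"
| "compile (Proj i) = (\<lambda>is u t. if i < length is then Copy (is ! i) u t
     else Seq (Inc t) (Ztest t))"
| "compile (Comp f gs) = (\<lambda>is u t. let m = length gs in
     Seq (run_args (map compile gs) is t (t + m))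
       (Seq (compile f [t..<t + m] u (t + m)) (Clears m t)))"
| "compile (Prec f g) = (\<lambda>is u t. if is = [] then Seq (Inc t) (Ztest t) else
     Seq (Copy (hd is) (t + 3) (t + 4))
    (Seq (compile f (tl is) (t + 1) (t + 4))
    (Seq (Loop (t + 3)
           (Seq (compile g (t # (t + 1) # tl is) (t + 2) (t + 4))
           (Seq (Clear (t + 1)) (Seq (Move (t + 2) (t + 1)) (Inc t)))))
    (Seq (Move (t + 1) u) (Clear t)))))"
| "compile (Mu f) = (\<lambda>is u t.
     Seq (Star (Seq (compile f (t # is) (t + 1) (t + 2))
           (Seq (Dec (t + 1)) (Seq (Clear (t + 1)) (Inc t)))))
    (Seq (compile f (t # is) (t + 1) (t + 2)) (Seq (Ztest (t + 1)) (Move t u))))"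

definition admissible :: "nat list \<Rightarrow> nat \<Rightarrow> nat \<Rightarrow> (nat \<Rightarrow> nat) \<Rightarrow> bool" where
  "admissible is u t s \<longleftrightarrow>
    u < t \<and> set is \<subseteq> {..<t} \<and> u \<notin> set is \<and> s u = 0 \<and> (\<forall>r\<ge>t. s r = 0)"

text \<open>An equation of sets, so it also says that without a value there is no complete run. For
  arguments of the wrong number this is achieved by \<open>Seq (Inc t) (Ztest t)\<close>, whose test
  always fails. All registers but \<open>u\<close> return to their old values, so compiled programs
  can be composed without tracking garbage.\<close>

definition realizes :: "(nat list \<Rightarrow> nat \<Rightarrow> nat \<Rightarrow> prog) \<Rightarrow> recf \<Rightarrow> bool" where
  "realizes c f \<longleftrightarrow> (\<forall>is u t s. admissible is u t s \<longrightarrow>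
    run (c is u t) s = {s(u := y) |y. rec_eval f (map s is) y})"

lemma realizesD:
  "realizes c f \<Longrightarrow> admissible is u t s \<Longrightarrow> map s is = xs \<Longrightarrow>
    run (c is u t) s = {s(u := y) |y. rec_eval f xs y}"
  unfolding realizes_def by blast

lemma run_run_args:
  assumes "\<And>g. g \<in> set gs \<Longrightarrow> realizes (compile g) g" and "set is \<subseteq> {..<u}"
    and "u + length gs \<le> t" and "\<forall>r\<ge>u. s r = 0"
  shows "run (run_args (map compile gs) is u t) s =
    {store u ys s |ys. list_all2 (\<lambda>g y. rec_eval g (map s is) y) gs ys}"
  using assms
proof (induction gs arbitrary: u s)
  case Nil
  then show ?case by auto
next
  case (Cons g gs)
  have 1: "run (compile g is u t) s = {s(u := y) |y. rec_eval g (map s is) y}"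
    by (rule realizesD) (use Cons.prems in \<open>auto simp: admissible_def\<close>)
  have 2: "map (s(u := y)) is = map s is" for y
    using Cons.prems(2) by auto
  have 3: "run (run_args (map compile gs) is (Suc u) t) (s(u := y)) =
      {store (Suc u) ys (s(u := y)) |ys.
        list_all2 (\<lambda>g y. rec_eval g (map s is) y) gs ys}" for y
    by (subst Cons.IH) (use Cons.prems in \<open>auto simp: 2\<close>)
  have "run (run_args (map compile (g # gs)) is u t) s =
      (\<Union>y\<in>{y. rec_eval g (map s is) y}. run (run_args (map compile gs) is (Suc u) t) (s(u := y)))"
    using run_Seq_collect[OF 1] by simp
  then show ?case
    unfolding 3 store_Cons[symmetric] list_all2_Cons1 by blast
qed

lemma realizes_Comp:
  assumes "realizes (compile f) f" and "\<And>g. g \<in> set gs \<Longrightarrow> realizes (compile g) g"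
  shows "realizes (compile (Comp f gs)) (Comp f gs)"
  unfolding realizes_def
proof (intro allI impI)
  fix "is" u t s assume adm: "admissible is u t s"
  define m where "m = length gs"
  have 1: "run (run_args (map compile gs) is t (t + m)) s =
      {store t ys s |ys. list_all2 (\<lambda>g y. rec_eval g (map s is) y) gs ys}"
    by (rule run_run_args) (use adm assms in \<open>auto simp: admissible_def m_def\<close>)
  have 2: "run (Seq (compile f [t..<t + m] u (t + m)) (Clears m t)) (store t ys s) =
      {s(u := z) |z. rec_eval f ys z}" if "length ys = m" for ys
  proof -
    have "run (compile f [t..<t + m] u (t + m)) (store t ys s) =
        {(store t ys s)(u := z) |z. rec_eval f ys z}"
    proof (rule realizesD[OF assms(1)])
      show "admissible [t..<t + m] u (t + m) (store t ys s)"
        using adm that by (auto simp: admissible_def store_def)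
      show "map (store t ys s) [t..<t + m] = ys"
        using that by (auto simp: store_def intro: nth_equalityI)
    qed
    \<comment> \<open>The argument registers are scratch space and were empty before, so clearing
      them restores \<open>s\<close>.\<close>
    moreover have "store t (replicate m 0) ((store t ys s)(u := z)) = s(u := z)" for z
      using adm that by (auto simp: admissible_def store_def fun_eq_iff)
    ultimately show ?thesis by (auto simp: run_Clears)
  qed
  have "run (compile (Comp f gs) is u t) s = (\<Union>s'\<in>run (run_args (map compile gs) is t (t + m)) s.
      run (Seq (compile f [t..<t + m] u (t + m)) (Clears m t)) s')"
    by (simp add: Let_def m_def)
  also have "\<dots> = (\<Union>ys\<in>{ys. list_all2 (\<lambda>g y. rec_eval g (map s is) y) gs ys}.
      run (Seq (compile f [t..<t + m] u (t + m)) (Clears m t)) (store t ys s))"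
    unfolding 1 by blast
  also have "\<dots> = (\<Union>ys\<in>{ys. list_all2 (\<lambda>g y. rec_eval g (map s is) y) gs ys}.
      {s(u := z) |z. rec_eval f ys z})"
    by (rule SUP_cong[OF refl], rule 2) (auto simp: m_def dest: list_all2_lengthD)
  finally show "run (compile (Comp f gs) is u t) s =
      {s(u := y) |y. rec_eval (Comp f gs) (map s is) y}"
    by (auto simp: rec_eval_Comp_iff)
qed

text \<open>A value at a later argument forces values at all earlier ones. Hence a loop that blocks
  midway loses no final state that \<open>Prec\<close> would have had.\<close>

lemma rec_eval_Prec_add:
  "rec_eval (Prec f g) ((n + k) # xs) y \<Longrightarrow> \<exists>z. rec_eval (Prec f g) (n # xs) z"
  by (induction k arbitrary: y) (auto simp: rec_eval_iffs)

lemma realizes_Prec: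
  assumes "realizes (compile f) f" and "realizes (compile g) g"
  shows "realizes (compile (Prec f g)) (Prec f g)"
  unfolding realizes_def
proof (intro allI impI)
  fix "is" u t s assume adm: "admissible is u t s"
  show "run (compile (Prec f g) is u t) s = {s(u := y) |y. rec_eval (Prec f g) (map s is) y}"
  proof (cases "is")
    case Nil
    then show ?thesis using adm by (simp add: rec_eval_iffs)
  next
    case (Cons i js)
    define xs where "xs = map s js"
    \<comment> \<open>Register \<open>t\<close> is the index passed to \<open>g\<close>,
      \<open>t + 1\<close> holds the current value and \<open>t + 3\<close> the number of rounds
      left. Register \<open>t + 2\<close> receives the next value within a round and is empty
      between rounds.\<close>
    define st where "st c a k = s(t := c, t + 1 := a, t + 3 := k)" for c a k
    have zero: "s r = 0" if "r \<ge> t" for r using adm that by (simp add: admissible_def)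
    have i: "i < t" "i \<noteq> u" and js: "set js \<subseteq> {..<t}" "u \<notin> set js" and u: "u < t" "s u = 0"
      using adm Cons by (auto simp: admissible_def)
    have stjs: "map (st c a k) js = xs" for c a k
      using js unfolding xs_def st_def by auto
    have 1: "run (Copy i (t + 3) (t + 4)) s = {st 0 0 (s i)}"
      by (subst run_Copy) (use i zero in \<open>auto simp: st_def fun_eq_iff\<close>)
    have 2: "run (compile f js (t + 1) (t + 4)) (st 0 0 k) = {st 0 a k |a. rec_eval f xs a}" for k
    proof -
      have "run (compile f js (t + 1) (t + 4)) (st 0 0 k) =
          {(st 0 0 k)(t + 1 := a) |a. rec_eval f xs a}"
        by (rule realizesD[OF assms(1)]) (use js zero stjs in \<open>auto simp: admissible_def st_def\<close>)
      moreover have "(st 0 0 k)(t + 1 := a) = st 0 a k" for a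
        by (auto simp: st_def fun_eq_iff)
      ultimately show ?thesis by simp
    qed
    define body where "body = Seq (compile g (t # (t + 1) # js) (t + 2) (t + 4))
      (Seq (Clear (t + 1)) (Seq (Move (t + 2) (t + 1)) (Inc t)))"
    have 3: "run body (st c a k) = {st (Suc c) a' k |a'. rec_eval g (c # a # xs) a'}" for c a k
    proof -
      have "run (compile g (t # (t + 1) # js) (t + 2) (t + 4)) (st c a k) =
          {(st c a k)(t + 2 := a') |a'. rec_eval g (c # a # xs) a'}"
        by (rule realizesD[OF assms(2)])
          (use js zero stjs in \<open>auto simp: admissible_def st_def\<close>)
      moreover have "run (Seq (Clear (t + 1)) (Seq (Move (t + 2) (t + 1)) (Inc t)))
          ((st c a k)(t + 2 := a')) = {st (Suc c) a' k}" for a'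
        using zero by (auto simp: run_Clear run_Move st_def fun_eq_iff)
      ultimately show ?thesis unfolding body_def by (simp only: run_Seq_collect UN_singleton) auto
    qed
    \<comment> \<open>Since \<open>a\<close> is the value at \<open>c\<close>, and values are
      unique, the results of \<open>g\<close> in the next round are exactly the values of
      \<open>Prec f g\<close> at \<open>Suc c\<close>.\<close>
    have 4: "run (Loop (t + 3) body) (st c a k) =
        {st (c + k) a' 0 |a'. rec_eval (Prec f g) ((c + k) # xs) a'}"
      if "rec_eval (Prec f g) (c # xs) a" for c a k
      using that
    proof (induction k arbitrary: c a)
      case 0
      have "run (Loop (t + 3) body) (st c a 0) = {st c a 0}"
        by (rule run_Loop_0) (simp add: st_def)
      moreover have "rec_eval (Prec f g) (c # xs) a' \<longleftrightarrow> a' = a" for a'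
        using 0 rec_eval_deterministic by blast
      ultimately show ?case by simp
    next
      case (Suc k)
      have "run (Loop (t + 3) body) (st c a (Suc k)) =
          (\<Union>s'\<in>run body ((st c a (Suc k))(t + 3 := k)). run (Loop (t + 3) body) s')"
        by (rule run_Loop_Suc) (simp add: st_def)
      also have "(st c a (Suc k))(t + 3 := k) = st c a k"
        by (simp add: st_def)
      also have "(\<Union>s'\<in>run body (st c a k). run (Loop (t + 3) body) s') =
          (\<Union>a'\<in>{a'. rec_eval g (c # a # xs) a'}. run (Loop (t + 3) body) (st (Suc c) a' k))"
        unfolding 3 by auto
      also have "{a'. rec_eval g (c # a # xs) a'} = {a'. rec_eval (Prec f g) (Suc c # xs) a'}"
        using Suc.prems by (auto simp: rec_eval_iffs dest: rec_eval_deterministic)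
      also have "(\<Union>a'\<in>{a'. rec_eval (Prec f g) (Suc c # xs) a'}.
          run (Loop (t + 3) body) (st (Suc c) a' k)) =
          (\<Union>a'\<in>{a'. rec_eval (Prec f g) (Suc c # xs) a'}.
            {st (Suc c + k) a'' 0 |a''. rec_eval (Prec f g) ((Suc c + k) # xs) a''})"
        by (intro SUP_cong refl) (use Suc.IH in simp)
      also have "\<dots> = {st (Suc c + k) a'' 0 |a''. rec_eval (Prec f g) ((Suc c + k) # xs) a''}"
        using rec_eval_Prec_add[of f g "Suc c" k xs] by blast
      finally show ?case by simp
    qed
    have 5: "run (Seq (Move (t + 1) u) (Clear t)) (st c a 0) = {s(u := a)}" for c a
      using u zero by (auto simp: run_Clear run_Move st_def fun_eq_iff)
    have "run (compile (Prec f g) is u t) s =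
        (\<Union>s1\<in>run (Copy i (t + 3) (t + 4)) s. \<Union>s2\<in>run (compile f js (t + 1) (t + 4)) s1.
          \<Union>s3\<in>run (Loop (t + 3) body) s2. run (Seq (Move (t + 1) u) (Clear t)) s3)"
      by (simp add: Cons body_def)
    also have "\<dots> = (\<Union>a\<in>{a. rec_eval f xs a}.
        \<Union>s3\<in>run (Loop (t + 3) body) (st 0 a (s i)). run (Seq (Move (t + 1) u) (Clear t)) s3)"
      unfolding 1 UN_insert UN_empty Un_empty_right 2 by blast
    also have "\<dots> = (\<Union>a\<in>{a. rec_eval f xs a}.
        {s(u := a') |a'. rec_eval (Prec f g) (s i # xs) a'})"
    proof (rule SUP_cong[OF refl])
      fix a assume "a \<in> {a. rec_eval f xs a}"
      then have "rec_eval (Prec f g) (0 # xs) a" by (simp add: rec_eval_iffs)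
      from 4[OF this, of "s i"] show "(\<Union>s3\<in>run (Loop (t + 3) body) (st 0 a (s i)).
          run (Seq (Move (t + 1) u) (Clear t)) s3) =
          {s(u := a') |a'. rec_eval (Prec f g) (s i # xs) a'}"
        unfolding run.simps(5)[of "Loop _ _", symmetric]
        by (subst run_Seq_collect) (auto simp only: 5 add_0)
    qed
    also have "\<dots> = {s(u := a') |a'. rec_eval (Prec f g) (s i # xs) a'}"
      using rec_eval_Prec_add[of f g 0 "s i" xs] by (auto simp: rec_eval_iffs)
    finally show ?thesis by (simp add: Cons xs_def)
  qed
qed

lemma UN_if_Suc:
  "(\<Union>y\<in>{y. Q y}. if y = (0::nat) then {} else {X}) = (if \<exists>y. Q (Suc y) then {X} else {})"
proof (cases "\<exists>y. Q (Suc y)")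
  case True
  then obtain k where k: "Q (Suc k)" by blast
  have "(\<Union>y\<in>{y. Q y}. if y = (0::nat) then {} else {X}) = {X}"
  proof (rule equalityI)
    have "{X} = (if Suc k = 0 then {} else {X})" by simp
    also have "\<dots> \<subseteq> (\<Union>y\<in>{y. Q y}. if y = (0::nat) then {} else {X})"
      by (rule UN_upper) (simp add: k)
    finally show "{X} \<subseteq> (\<Union>y\<in>{y. Q y}. if y = (0::nat) then {} else {X})" .
  qed (rule UN_least, simp)
  with True show ?thesis by simp
next
  case False
  then have "y = 0" if "Q y" for y using that by (cases y) auto
  with False show ?thesis by simp
qed

lemma UN_if_0:
  "(\<Union>y\<in>{y. Q y}. if y = (0::nat) then {X} else {}) = (if Q 0 then {X} else {})"
  by (auto split: if_splits)

text \<open>\<open>Star\<close> guesses the result. Every completed round certifies a positive value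
  at the index that it passes, and the test after the loop certifies a zero at the guess; these are
  the two conditions of \<open>rec_eval_Mu_iff\<close>.\<close>

lemma realizes_Mu:
  assumes "realizes (compile f) f"
  shows "realizes (compile (Mu f)) (Mu f)"
  unfolding realizes_def
proof (intro allI impI)
  fix "is" u t s assume adm: "admissible is u t s"
  define xs where "xs = map s is"
  have zero: "s r = 0" if "r \<ge> t" for r using adm that by (simp add: admissible_def)
  have "is": "set is \<subseteq> {..<t}" "u \<notin> set is" and u: "u < t" "s u = 0"
    using adm by (auto simp: admissible_def)
  have xs: "map (s(t := c)) is = xs" for c
    using "is" unfolding xs_def by auto
  define test where "test = compile f (t # is) (t + 1) (t + 2)"
  have 1: "run test (s(t := c)) = {s(t := c, t + 1 := y) |y. rec_eval f (c # xs) y}" for c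
    unfolding test_def
    by (rule realizesD[OF assms(1)]) (use "is" zero xs in \<open>auto simp: admissible_def\<close>)
  define body where "body = Seq test (Seq (Dec (t + 1)) (Seq (Clear (t + 1)) (Inc t)))"
  have 2: "run body (s(t := c)) =
      (if \<exists>y. rec_eval f (c # xs) (Suc y) then {s(t := Suc c)} else {})" for c
  proof -
    have "run (Seq (Dec (t + 1)) (Seq (Clear (t + 1)) (Inc t))) (s(t := c, t + 1 := y)) =
        (if y = 0 then {} else {s(t := Suc c)})" (is "?L y = ?R y") for y
    proof (cases y)
      case (Suc k)
      have "(s(t := c, t + 1 := k))(t + 1 := 0) = s(t := c)"
        using zero[of "t + 1"] by (auto simp: fun_eq_iff)
      then show ?thesis using Suc by (simp add: run_Clear)
    qed simp
    then have "(\<Union>y\<in>{y. rec_eval f (c # xs) y}. ?L y) =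
        (\<Union>y\<in>{y. rec_eval f (c # xs) y}. if y = 0 then {} else {s(t := Suc c)})"
      by (intro SUP_cong refl)
    then have "run body (s(t := c)) =
        (\<Union>y\<in>{y. rec_eval f (c # xs) y}. if y = 0 then {} else {s(t := Suc c)})"
      unfolding body_def run_Seq_collect[OF 1] .
    then show ?thesis unfolding UN_if_Suc .
  qed
  have 3: "run (Star body) s = {s(t := c) |c. \<forall>m<c. \<exists>y. rec_eval f (m # xs) (Suc y)}"
  proof (intro equalityI subsetI)
    fix s' assume "s' \<in> run (Star body) s"
    then have "(\<lambda>s s'. s' \<in> run body s)\<^sup>*\<^sup>* s s'" by simp
    then show "s' \<in> {s(t := c) |c. \<forall>m<c. \<exists>y. rec_eval f (m # xs) (Suc y)}"
    proof (induction rule: rtranclp_induct)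
      case base
      show ?case using zero[of t] by (auto intro!: exI[of _ 0])
    next
      case (step s1 s2)
      then obtain c where c: "s1 = s(t := c)" "\<forall>m<c. \<exists>y. rec_eval f (m # xs) (Suc y)" by blast
      from step(2) have "\<exists>y. rec_eval f (c # xs) (Suc y)" "s2 = s(t := Suc c)"
        unfolding c(1) 2 by (auto split: if_splits)
      with c have "\<forall>m<Suc c. \<exists>y. rec_eval f (m # xs) (Suc y)" by (simp add: less_Suc_eq)
      with \<open>s2 = s(t := Suc c)\<close> show ?case by blast
    qed
  next
    fix s' assume "s' \<in> {s(t := c) |c. \<forall>m<c. \<exists>y. rec_eval f (m # xs) (Suc y)}"
    then obtain c where s': "s' = s(t := c)" and c: "\<forall>m<c. \<exists>y. rec_eval f (m # xs) (Suc y)"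
      by blast
    from c have "(\<lambda>s s'. s' \<in> run body s)\<^sup>*\<^sup>* s (s(t := c))"
    proof (induction c)
      case 0
      have "s(t := 0) = s" using zero[of t] by auto
      then show ?case by simp
    next
      case (Suc c)
      then have "s(t := Suc c) \<in> run body (s(t := c))" by (simp add: 2)
      moreover have "(\<lambda>s s'. s' \<in> run body s)\<^sup>*\<^sup>* s (s(t := c))"
        using Suc by (simp only: less_Suc_eq) blast
      ultimately show ?case by (rule rtranclp.rtrancl_into_rtrancl[rotated])
    qed
    with s' show "s' \<in> run (Star body) s" by simp
  qed
  have 4: "run (Seq test (Seq (Ztest (t + 1)) (Move t u))) (s(t := c)) =
      (if rec_eval f (c # xs) 0 then {s(u := c)} else {})" for c
  proof -
    have "run (Seq (Ztest (t + 1)) (Move t u)) (s(t := c, t + 1 := y)) =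
        (if y = 0 then {s(u := c)} else {})" (is "?L y = ?R y") for y
      using u zero by (auto simp: run_Move fun_eq_iff)
    then have "(\<Union>y\<in>{y. rec_eval f (c # xs) y}. ?L y) =
        (\<Union>y\<in>{y. rec_eval f (c # xs) y}. if y = 0 then {s(u := c)} else {})"
      by (intro SUP_cong refl)
    then show ?thesis unfolding run_Seq_collect[OF 1] UN_if_0 .
  qed
  have "run (compile (Mu f) is u t) s = (\<Union>s'\<in>run (Star body) s.
      run (Seq test (Seq (Ztest (t + 1)) (Move t u))) s')"
    by (simp add: body_def test_def)
  also have "\<dots> = {s(u := y) |y. rec_eval (Mu f) xs y}"
    unfolding run.simps(5)[of "Star body", symmetric] run_Seq_collect[OF 3] 4 rec_eval_Mu_iff
    by (auto split: if_splits)
  finally show "run (compile (Mu f) is u t) s = {s(u := y) |y. rec_eval (Mu f) (map s is) y}"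
    by (simp add: xs_def)
qed

lemma realizes_compile: "realizes (compile f) f"
proof (induction f)
  case Zero
  show ?case by (auto simp: realizes_def admissible_def rec_eval_iffs)
next
  case Succ
  show ?case
    by (auto simp: realizes_def admissible_def rec_eval_iffs length_Suc_conv run_Copy)
next
  case (Proj i)
  show ?case
    unfolding realizes_def
  proof (intro allI impI)
    fix "is" u t s assume adm: "admissible is u t s"
    show "run (compile (Proj i) is u t) s = {s(u := y) |y. rec_eval (Proj i) (map s is) y}"
    proof (cases "i < length is")
      case True
      then have "is ! i \<in> set is" by simp
      with adm have "is ! i < t" "is ! i \<noteq> u" by (auto simp: admissible_def)
      with adm True show ?thesis
        by (simp add: admissible_def rec_eval_iffs run_Copy)
    qed (simp add: rec_eval_iffs)
  qed
next
  case (Comp f gs)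
  then show ?case by (intro realizes_Comp) auto
next
  case (Prec f g)
  then show ?case by (rule realizes_Prec)
next
  case (Mu f)
  then show ?case by (rule realizes_Mu)
qed


text \<open>This star without a test guesses the witness of the existential quantifier in
  \<open>sigma01\<close>.\<close>

lemma run_Star_Inc: "run (Star (Inc r)) s = {s(r := s r + m) |m. True}"
proof -
  have "(\<lambda>s s'. s' = s(r := Suc (s r)))\<^sup>*\<^sup>* s s' \<longleftrightarrow> (\<exists>m. s' = s(r := s r + m))" for s'
  proof
    assume "(\<lambda>s s'. s' = s(r := Suc (s r)))\<^sup>*\<^sup>* s s'"
    then show "\<exists>m. s' = s(r := s r + m)"
    proof (induction rule: rtranclp_induct)
      case base
      show ?case by (rule exI[of _ 0]) simp
    next
      case (step s1 s2)
      then obtain m where "s1 = s(r := s r + m)" by blast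
      with step(2) have "s2 = s(r := s r + Suc m)" by simp
      then show ?case by blast
    qed
  next
    assume "\<exists>m. s' = s(r := s r + m)"
    then obtain m where "s' = s(r := s r + m)" by blast
    moreover have "(\<lambda>s s'. s' = s(r := Suc (s r)))\<^sup>*\<^sup>* s (s(r := s r + m))"
    proof (induction m)
      case (Suc m)
      show ?case by (rule rtranclp.rtrancl_into_rtrancl[OF Suc]) (auto simp: fun_eq_iff)
    qed simp
    ultimately show "(\<lambda>s s'. s' = s(r := Suc (s r)))\<^sup>*\<^sup>* s s'" by simp
  qed
  then show ?thesis by simp
qed

text \<open>The initial value exceeds \<open>n\<close> so that, in the unary representation used below, the cells in
  positions \<open>n + 1\<close> and \<open>n + 2\<close> of the first row pin it down and differ from the first cell.\<close>

definition init :: "nat \<Rightarrow> nat \<Rightarrow> nat" where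
  "init n = (\<lambda>r. if r = 0 then n + 2 else 0)"

lemma sigma01_program:
  assumes "sigma01 S"
  obtains p where "\<And>n. n \<in> S \<longleftrightarrow> run p (init n) \<noteq> {}"
proof -
  obtain R f where S: "S = {n. \<exists>m. R n m}"
    and f: "\<And>n m. rec_eval f [n, m] (if R n m then 1 else 0)"
    using assms unfolding sigma01_def decidable2_def by blast
  \<comment> \<open>The two \<open>Dec 0\<close> remove the surplus in \<open>init n\<close>. The
    final \<open>Dec 2\<close> blocks unless the decision procedure has answered 1, so that
    acceptance is the existence of a complete run.\<close>
  define p where "p = Seq (Dec 0) (Seq (Dec 0) (Seq (Star (Inc 1))
    (Seq (compile f [0, 1] 2 3) (Dec 2))))"
  have "n \<in> S \<longleftrightarrow> run p (init n) \<noteq> {}" for n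
  proof -
    define s where "s m = ((\<lambda>r. 0)(0 := n, 1 := m) :: nat \<Rightarrow> nat)" for m
    have 1: "run (Star (Inc 1)) (s 0) = {s m |m. True}"
      unfolding run_Star_Inc by (simp add: s_def)
    have 2: "run (compile f [0, 1] 2 3) (s m) = {(s m)(2 := y) |y. rec_eval f [n, m] y}" for m
      by (rule realizesD[OF realizes_compile]) (auto simp: admissible_def s_def)
    have 3: "run (Dec 2) ((s m)(2 := y)) = (if y = 0 then {} else {(s m)(2 := y - 1)})" for m y
      by simp
    have 4: "run (Seq (compile f [0, 1] 2 3) (Dec 2)) (s m) \<noteq> {} \<longleftrightarrow> R n m" for m
    proof -
      have "rec_eval f [n, m] y \<longleftrightarrow> y = (if R n m then 1 else 0)" for y
        using f rec_eval_deterministic by blast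
      then have "{y. rec_eval f [n, m] y} = {if R n m then 1 else 0}" by blast
      then show ?thesis unfolding run_Seq_collect[OF 2] 3 by (simp only:) simp
    qed
    have "(init n)(0 := Suc n, 0 := n) = s 0"
      by (auto simp: init_def s_def fun_eq_iff)
    then have "run p (init n) = run (Seq (Star (Inc 1)) (Seq (compile f [0, 1] 2 3) (Dec 2))) (s 0)"
      unfolding p_def by (simp add: init_def)
    also have "\<dots> = (\<Union>m. run (Seq (compile f [0, 1] 2 3) (Dec 2)) (s m))"
      unfolding run_Seq_collect[OF 1] by simp
    finally have "run p (init n) \<noteq> {} \<longleftrightarrow> (\<exists>m. R n m)"
      using 4 by (metis (no_types, lifting) UN_iff all_not_in_conv UNIV_I)
    with S show ?thesis by simp
  qed
  then show thesis by (rule that)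
qed


section \<open>Small steps\<close>

text \<open>Control and the action on the registers are kept apart because tiles check them
  separately: labels have to follow \<open>lsucc\<close>, bits have to follow
  \<open>effect\<close>.\<close>

fun lsucc :: "prog list \<Rightarrow> prog list set" where
  "lsucc [] = {}"
| "lsucc (Seq a b # K) = {a # b # K}"
| "lsucc (Star a # K) = {K, a # Star a # K}"
| "lsucc (_ # K) = {K}"

fun effect :: "prog \<Rightarrow> (nat \<Rightarrow> nat) \<Rightarrow> (nat \<Rightarrow> nat) set" where
  "effect (Seq a b) s = {s}"
| "effect (Star a) s = {s}"
| "effect p s = run p s"

definition cstep :: "prog list \<times> (nat \<Rightarrow> nat) \<Rightarrow> prog list \<times> (nat \<Rightarrow> nat) \<Rightarrow> bool" where
  "cstep c c' \<longleftrightarrow> snd c' \<in> (case fst c of [] \<Rightarrow> {} | p # K \<Rightarrow> effect p (snd c)) \<and> fst c' \<in> lsucc (fst c)"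

lemma cstep_Cons: "cstep (p # K, s) (K', s') \<longleftrightarrow> s' \<in> effect p s \<and> K' \<in> lsucc (p # K)"
  by (simp add: cstep_def)

lemma run_imp_csteps: "s' \<in> run p s \<Longrightarrow> cstep\<^sup>*\<^sup>* (p # K, s) (K, s')"
proof (induction p arbitrary: s s' K)
  case (Seq a b)
  then obtain s1 where "s1 \<in> run a s" "s' \<in> run b s1" by auto
  with Seq have "cstep\<^sup>*\<^sup>* (a # b # K, s) (b # K, s1)" "cstep\<^sup>*\<^sup>* (b # K, s1) (K, s')" by auto
  moreover have "cstep (Seq a b # K, s) (a # b # K, s)" by (simp add: cstep_Cons)
  ultimately show ?case by (meson converse_rtranclp_into_rtranclp rtranclp_trans)
next
  case (Star a)
  from Star.prems have "(\<lambda>s s'. s' \<in> run a s)\<^sup>*\<^sup>* s s'" by simp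
  then show ?case
  proof (induction rule: converse_rtranclp_induct)
    case base
    show ?case by (rule r_into_rtranclp) (simp add: cstep_Cons)
  next
    case (step s s1)
    have "cstep (Star a # K, s) (a # Star a # K, s)" by (simp add: cstep_Cons)
    moreover have "cstep\<^sup>*\<^sup>* (a # Star a # K, s) (Star a # K, s1)" using Star.IH step(1) .
    ultimately show ?case using step(3) by (meson converse_rtranclp_into_rtranclp rtranclp_trans)
  qed
qed (auto simp: cstep_Cons intro!: r_into_rtranclp)

primrec runs :: "prog list \<Rightarrow> (nat \<Rightarrow> nat) \<Rightarrow> (nat \<Rightarrow> nat) set" where
  "runs [] s = {s}"
| "runs (p # K) s = (\<Union>s'\<in>run p s. runs K s')"

text \<open>The invariant for the passage from small steps to \<open>run\<close>: a step can only
  shrink the set of final states that are still possible, so whatever a complete run reaches was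
  possible at its start.\<close>

lemma cstep_runs: "cstep (K, s) (K', s') \<Longrightarrow> runs K' s' \<subseteq> runs K s"
proof (cases K)
  case (Cons p L)
  assume "cstep (K, s) (K', s')"
  with Cons show ?thesis
  proof (cases p)
    case (Star a)
    then consider "K' = L" "s' = s" | "K' = a # K" "s' = s"
      using Cons \<open>cstep (K, s) (K', s')\<close> by (auto simp: cstep_Cons)
    moreover have "s \<in> run (Star a) s"
      by (subst run_Star_unfold) simp
    moreover have "run (Star a) s1 \<subseteq> run (Star a) s" if "s1 \<in> run a s" for s1
      using that by (subst (2) run_Star_unfold) blast
    ultimately show ?thesis
      unfolding Cons Star runs.simps by cases (auto simp del: run.simps(6))
  qed (auto simp: cstep_Cons split: if_splits)
qed (simp add: cstep_def)

lemma run_iff_csteps: "s' \<in> run p s \<longleftrightarrow> cstep\<^sup>*\<^sup>* ([p], s) ([], s')"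
proof
  assume "cstep\<^sup>*\<^sup>* ([p], s) ([], s')"
  moreover have "runs (fst d) (snd d) \<subseteq> runs (fst c) (snd c)" if "cstep\<^sup>*\<^sup>* c d" for c d
    using that
  proof (induction rule: rtranclp_induct)
    case (step c d)
    then show ?case using cstep_runs[of "fst c" "snd c" "fst d" "snd d"] by auto
  qed simp
  ultimately show "s' \<in> run p s" by fastforce
qed (rule run_imp_csteps)

text \<open>Continuations do not pile up: after the body of \<open>Star a\<close> comes
  \<open>Star a # K\<close> again, so unfolding a star never nests. As with the partial derivatives
  of a regular expression, only finitely many continuations arise, and these can serve as labels of
  tiles.\<close>

primrec conts :: "prog \<Rightarrow> prog list \<Rightarrow> prog list set" where
  "conts Skip K = {Skip # K, K}"
| "conts (Inc r) K = {Inc r # K, K}"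
| "conts (Dec r) K = {Dec r # K, K}"
| "conts (Ztest r) K = {Ztest r # K, K}"
| "conts (Seq a b) K = insert (Seq a b # K) (conts a (b # K) \<union> conts b K)"
| "conts (Star a) K = insert (Star a # K) (insert K (conts a (Star a # K)))"

lemma finite_conts: "finite (conts p K)"
  by (induction p arbitrary: K) auto

lemma in_conts: "p # K \<in> conts p K" "K \<in> conts p K"
  by (induction p arbitrary: K) auto

lemma lsucc_conts: "L \<in> conts p K \<Longrightarrow> L \<noteq> K \<Longrightarrow> lsucc L \<subseteq> conts p K"
proof (induction p arbitrary: K)
  case (Seq a b)
  show ?case
  proof (cases "L = Seq a b # K")
    case False
    then consider "L \<in> conts a (b # K)" "L \<noteq> b # K" | "L \<in> conts b K"
      using Seq.prems in_conts(1) by auto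
    then show ?thesis using Seq by cases auto
  qed (simp add: in_conts)
next
  case (Star a)
  then show ?case
    using in_conts(1)[of a "Star a # K"] in_conts(2)[of "Star a # K" a] by (cases "L = Star a # K") auto
qed auto

primrec regs :: "prog \<Rightarrow> nat set" where
  "regs Skip = {}"
| "regs (Inc r) = {r}"
| "regs (Dec r) = {r}"
| "regs (Ztest r) = {r}"
| "regs (Seq a b) = regs a \<union> regs b"
| "regs (Star a) = regs a"

lemma finite_regs: "finite (regs p)"
  by (induction p) auto

lemma regs_lsucc: "K' \<in> lsucc K \<Longrightarrow> \<Union>(regs ` set K') \<subseteq> \<Union>(regs ` set K)"
  by (cases K rule: lsucc.cases) auto

lemma effect_regs: "s' \<in> effect p s \<Longrightarrow> r \<notin> regs p \<Longrightarrow> s' r = s r"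
  by (cases p) (auto split: if_splits)

lemma cstep_regs:
  assumes "cstep c d" and "\<Union>(regs ` set (fst c)) \<subseteq> R"
  shows "\<Union>(regs ` set (fst d)) \<subseteq> R" and "r \<notin> R \<Longrightarrow> snd d r = snd c r"
proof -
  show "\<Union>(regs ` set (fst d)) \<subseteq> R"
    using assms regs_lsucc[of "fst d" "fst c"] unfolding cstep_def by blast
  show "snd d r = snd c r" if "r \<notin> R"
    using assms that by (cases "fst c") (auto simp: cstep_def intro: effect_regs)
qed

section \<open>The lattice and its shifts\<close>

lemma vadd_in_lattice [simp]: "u \<in> lattice d \<Longrightarrow> v \<in> lattice d \<Longrightarrow> vadd u v \<in> lattice d"
  by (simp add: lattice_def vadd_def)

lemma vadd_commute: "vadd u v = vadd v u"
  unfolding vadd_def by (induction u v rule: list_induct2') auto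

lemma vadd_assoc: "vadd (vadd u v) w = vadd u (vadd v w)"
proof (induction u arbitrary: v w)
  case (Cons a u)
  then show ?case by (cases v; cases w) (auto simp: vadd_def)
qed (simp add: vadd_def)

lemma vadd_nth: "u \<in> lattice d \<Longrightarrow> v \<in> lattice d \<Longrightarrow> i < d \<Longrightarrow> vadd u v ! i = u ! i + v ! i"
  by (simp add: lattice_def vadd_def)

lemma lattice_eqI:
  "u \<in> lattice d \<Longrightarrow> v \<in> lattice d \<Longrightarrow> (\<And>i. i < d \<Longrightarrow> u ! i = v ! i) \<Longrightarrow> u = v"
  by (simp add: lattice_def list_eq_iff_nth_eq)

lemma vadd_right_cancel:
  "u \<in> lattice d \<Longrightarrow> v \<in> lattice d \<Longrightarrow> w \<in> lattice d \<Longrightarrow> vadd u w = vadd v w \<longleftrightarrow> u = v"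
  by (metis add_right_cancel lattice_eqI vadd_nth)

definition zerov :: "nat \<Rightarrow> vec" where
  "zerov d = replicate d 0"

definition axisv :: "nat \<Rightarrow> nat \<Rightarrow> int \<Rightarrow> vec" where
  "axisv d i k = (zerov d)[i := k]"

text \<open>Rays and rectangles use the first two axes only; the other directions enter through the
  notion of a defect alone.\<close>

definition plane :: "nat \<Rightarrow> int \<Rightarrow> int \<Rightarrow> vec" where
  "plane d i j = i # j # replicate (d - 2) 0"

lemma zerov_in_lattice [simp]: "zerov d \<in> lattice d"
  by (simp add: lattice_def zerov_def)

lemma zerov_nth: "i < d \<Longrightarrow> zerov d ! i = 0"
  by (simp add: zerov_def)

lemma axisv_in_lattice [simp]: "axisv d i k \<in> lattice d"
  by (simp add: lattice_def axisv_def zerov_def)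

lemma axisv_nth: "j < d \<Longrightarrow> axisv d i k ! j = (if j = i then k else 0)"
  by (simp add: axisv_def zerov_def nth_list_update)

lemma plane_in_lattice [simp]: "2 \<le> d \<Longrightarrow> plane d i j \<in> lattice d"
  by (simp add: lattice_def plane_def)

lemma vadd_zerov [simp]: "v \<in> lattice d \<Longrightarrow> vadd v (zerov d) = v" "v \<in> lattice d \<Longrightarrow> vadd (zerov d) v = v"
  by (auto intro!: lattice_eqI[of _ d] simp: vadd_nth[where d = d] zerov_nth)

lemma vadd_axisv: "vadd (axisv d i k) (axisv d i l) = axisv d i (k + l)"
  by (rule lattice_eqI[of _ d]) (auto simp: vadd_nth[where d = d] axisv_nth)

lemma axisv_0: "axisv d i 0 = zerov d"
  by (rule lattice_eqI[of _ d]) (auto simp: axisv_nth zerov_nth)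

lemma vadd_plane: "vadd (plane d i j) (plane d k l) = plane d (i + k) (j + l)"
  by (simp add: vadd_def plane_def)

lemma plane_0: "2 \<le> d \<Longrightarrow> plane d 0 0 = zerov d"
  by (simp add: plane_def zerov_def numeral_2_eq_2 Suc_diff_Suc flip: replicate_Suc)

lemma plane_eq_axis: "2 \<le> d \<Longrightarrow> plane d k 0 = axisv d 0 k" "2 \<le> d \<Longrightarrow> plane d 0 k = axisv d 1 k"
  by (auto intro!: lattice_eqI[of _ d] simp: axisv_nth) (auto simp: plane_def nth_Cons split: nat.splits)

lemma plane_nth: "plane d i j ! 0 = i" "plane d i j ! 1 = j"
  by (simp_all add: plane_def)

lemma shift_apply: "v \<in> lattice d \<Longrightarrow> shift d u x v = x (vadd v u)"
  by (simp add: shift_def)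

lemma shift_shift:
  "u \<in> lattice d \<Longrightarrow> shift d u (shift d v x) = shift d (vadd u v) x"
  by (auto simp: shift_def vadd_assoc)

lemma shift_zerov: "x \<in> configs d A \<Longrightarrow> shift d (zerov d) x = x"
  by (auto simp: shift_def configs_def PiE_def extensional_def fun_eq_iff)

lemma shift_in_configs: "x \<in> configs d A \<Longrightarrow> u \<in> lattice d \<Longrightarrow> shift d u x \<in> configs d A"
  by (auto simp: shift_def configs_def PiE_def)


section \<open>Finitary functions of configurations\<close>

text \<open>On a closed set of configurations over a finite alphabet this is continuity into a
  discrete space. The window \<open>W\<close> is what forbidden patterns and block maps work
  with.\<close>

definition finitary :: "nat \<Rightarrow> (vec \<Rightarrow> 'a) set \<Rightarrow> ((vec \<Rightarrow> 'a) \<Rightarrow> 'b) \<Rightarrow> bool" where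
  "finitary d S g \<longleftrightarrow> (\<exists>W. finite W \<and> W \<subseteq> lattice d \<and>
    (\<forall>x\<in>S. \<forall>y\<in>S. (\<forall>v\<in>W. x v = y v) \<longrightarrow> g x = g y))"

lemma finitaryI:
  assumes "finite W" and "W \<subseteq> lattice d"
    and "\<And>x y. x \<in> S \<Longrightarrow> y \<in> S \<Longrightarrow> \<forall>v\<in>W. x v = y v \<Longrightarrow> g x = g y"
  shows "finitary d S g"
  unfolding finitary_def
proof (intro exI[of _ W] conjI ballI impI)
  fix x y assume "x \<in> S" "y \<in> S" "\<forall>v\<in>W. x v = y v"
  then show "g x = g y" by (rule assms(3))
qed (fact assms)+

lemma finitaryE:
  assumes "finitary d S g"
  obtains W where "finite W" and "W \<subseteq> lattice d"
    and "\<forall>x\<in>S. \<forall>y\<in>S. (\<forall>v\<in>W. x v = y v) \<longrightarrow> g x = g y"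
  using assms unfolding finitary_def by blast

lemma finitary_apply: "v \<in> lattice d \<Longrightarrow> finitary d S (\<lambda>x. x v)"
  by (rule finitaryI[of "{v}"]) auto

lemma finitary_comp:
  assumes "finitary d S g"
  shows "finitary d S (\<lambda>x. F (g x))"
proof -
  obtain W where W: "finite W" "W \<subseteq> lattice d"
    and g0: "\<forall>x\<in>S. \<forall>y\<in>S. (\<forall>v\<in>W. x v = y v) \<longrightarrow> g x = g y"
    using assms by (rule finitaryE)
  note g = g0[THEN bspec, THEN bspec, THEN mp]
  show ?thesis by (rule finitaryI[OF W]) (rule arg_cong[of _ _ F], rule g)
qed

lemma finitary_comp2:
  assumes "finitary d S g" and "finitary d S h"
  shows "finitary d S (\<lambda>x. F (g x) (h x))"
proof -
  obtain V where V: "finite V" "V \<subseteq> lattice d"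
    and g0: "\<forall>x\<in>S. \<forall>y\<in>S. (\<forall>v\<in>V. x v = y v) \<longrightarrow> g x = g y"
    using assms(1) by (rule finitaryE)
  note g = g0[THEN bspec, THEN bspec, THEN mp]
  obtain W where W: "finite W" "W \<subseteq> lattice d"
    and h0: "\<forall>x\<in>S. \<forall>y\<in>S. (\<forall>v\<in>W. x v = y v) \<longrightarrow> h x = h y"
    using assms(2) by (rule finitaryE)
  note h = h0[THEN bspec, THEN bspec, THEN mp]
  show ?thesis
  proof (rule finitaryI[of "V \<union> W"])
    fix x y assume "x \<in> S" "y \<in> S" "\<forall>v\<in>V \<union> W. x v = y v"
    then have "g x = g y" "h x = h y" using g[of x y] h[of x y] by auto
    then show "F (g x) (h x) = F (g y) (h y)" by (simp only:)
  qed (use V W in auto)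
qed

lemma finitary_Collect:
  assumes "finite I" and "\<And>i. i \<in> I \<Longrightarrow> finitary d S (g i)"
  shows "finitary d S (\<lambda>x. {i \<in> I. g i x})"
proof -
  from assms(2) have "\<forall>i\<in>I. \<exists>W. finite W \<and> W \<subseteq> lattice d \<and>
      (\<forall>x\<in>S. \<forall>y\<in>S. (\<forall>v\<in>W. x v = y v) \<longrightarrow> g i x = g i y)"
    unfolding finitary_def by blast
  from bchoice[OF this] obtain W where W: "\<forall>i\<in>I. finite (W i) \<and> W i \<subseteq> lattice d \<and>
      (\<forall>x\<in>S. \<forall>y\<in>S. (\<forall>v\<in>W i. x v = y v) \<longrightarrow> g i x = g i y)" ..
  show ?thesis
  proof (rule finitaryI[of "\<Union>(W ` I)"])
    fix x y assume xy: "x \<in> S" "y \<in> S" "\<forall>v\<in>\<Union>(W ` I). x v = y v"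
    have "g i x = g i y" if "i \<in> I" for i
      using W xy that by blast
    then show "{i \<in> I. g i x} = {i \<in> I. g i y}" by blast
  qed (use W assms(1) in auto)
qed

lemma finitary_Bex:
  assumes "finite I" and "\<And>i. i \<in> I \<Longrightarrow> finitary d S (g i)"
  shows "finitary d S (\<lambda>x. \<exists>i\<in>I. g i x)"
proof -
  have "finitary d S (\<lambda>x. {i \<in> I. g i x} \<noteq> {})"
    by (rule finitary_comp[OF finitary_Collect]) (use assms in auto)
  then show ?thesis by (simp add: Bex_def)
qed

lemma finitary_shift:
  assumes "finitary d S g" and "u \<in> lattice d" and "\<And>x. x \<in> S \<Longrightarrow> shift d u x \<in> S"
  shows "finitary d S (\<lambda>x. g (shift d u x))"
proof -
  obtain W where W: "finite W" "W \<subseteq> lattice d"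
    and g0: "\<forall>x\<in>S. \<forall>y\<in>S. (\<forall>v\<in>W. x v = y v) \<longrightarrow> g x = g y"
    using assms(1) by (rule finitaryE)
  note g = g0[THEN bspec, THEN bspec, THEN mp]
  show ?thesis
  proof (rule finitaryI[of "(\<lambda>v. vadd v u) ` W"])
    fix x y assume x: "x \<in> S" "y \<in> S" and eq: "\<forall>v\<in>(\<lambda>v. vadd v u) ` W. x v = y v"
    have "\<forall>v\<in>W. shift d u x v = shift d u y v"
      using eq W(2) by (auto simp: shift_apply)
    then show "g (shift d u x) = g (shift d u y)"
      by (rule g[OF assms(3)[OF x(1)] assms(3)[OF x(2)]])
  next
    show "finite ((\<lambda>v. vadd v u) ` W)" using W(1) by (rule finite_imageI)
    show "(\<lambda>v. vadd v u) ` W \<subseteq> lattice d" using W(2) assms(2) by auto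
  qed
qed

section \<open>Continuity, block maps and the Curtis-Hedlund-Lyndon theorem\<close>

lemma cylinder_open:
  assumes "finite W" "W \<subseteq> lattice d" and "x \<in> configs d A"
  shows "openin (config_top d A) {y \<in> configs d A. \<forall>v\<in>W. y v = x v}"
proof -
  have "{y \<in> configs d A. \<forall>v\<in>W. y v = x v} =
      PiE (lattice d) (\<lambda>v. if v \<in> W then {x v} else A)"
  proof (rule set_eqI)
    fix y
    have "x v \<in> A" if "v \<in> W" for v using assms(2,3) that by (auto simp: configs_def)
    then have "(\<forall>i\<in>lattice d. y i \<in> (if i \<in> W then {x i} else A)) \<longleftrightarrow>
        (\<forall>i\<in>lattice d. y i \<in> A) \<and> (\<forall>v\<in>W. y v = x v)"
      using assms(2) by (smt (verit) insertE singletonI singletonD subsetD)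
    then show "y \<in> {y \<in> configs d A. \<forall>v\<in>W. y v = x v} \<longleftrightarrow>
        y \<in> PiE (lattice d) (\<lambda>v. if v \<in> W then {x v} else A)"
      unfolding configs_def PiE_iff mem_Collect_eq by (simp only:) blast
  qed
  moreover have "openin (config_top d A) (PiE (lattice d) (\<lambda>v. if v \<in> W then {x v} else A))"
    unfolding config_top_def
  proof (subst openin_PiE_gen, intro disjI2 conjI ballI)
    have "{i \<in> lattice d. (if i \<in> W then {x i} else A) \<noteq> topspace (discrete_topology A)} \<subseteq> W"
      by auto
    then show "finite {i \<in> lattice d. (if i \<in> W then {x i} else A) \<noteq> topspace (discrete_topology A)}"
      using assms(1) finite_subset by blast
  qed (use assms(3) in \<open>auto simp: configs_def PiE_iff\<close>)
  ultimately show ?thesis by simp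
qed

lemma finitary_continuous:
  assumes "finitary d (configs d A) g" and "\<And>x. x \<in> configs d A \<Longrightarrow> g x \<in> B"
  shows "continuous_map (config_top d A) (discrete_topology B) g"
proof -
  obtain W where W: "finite W" "W \<subseteq> lattice d"
    and g0: "\<forall>x\<in>configs d A. \<forall>y\<in>configs d A. (\<forall>v\<in>W. x v = y v) \<longrightarrow> g x = g y"
    using assms(1) by (rule finitaryE)
  note g = g0[THEN bspec, THEN bspec, THEN mp]
  have "openin (config_top d A) {x \<in> configs d A. g x \<in> U}" for U
  proof (subst openin_subopen, intro ballI)
    fix x assume x: "x \<in> {x \<in> configs d A. g x \<in> U}"
    let ?C = "{y \<in> configs d A. \<forall>v\<in>W. y v = x v}"
    have "openin (config_top d A) ?C" using W x by (intro cylinder_open) auto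
    moreover have "x \<in> ?C" using x by simp
    moreover have "?C \<subseteq> {x \<in> configs d A. g x \<in> U}"
    proof
      fix y assume "y \<in> ?C"
      then show "y \<in> {x \<in> configs d A. g x \<in> U}" using g[of y x] x by simp
    qed
    ultimately show "\<exists>T. openin (config_top d A) T \<and> x \<in> T \<and> T \<subseteq> {x \<in> configs d A. g x \<in> U}"
      by blast
  qed
  then show ?thesis
    using assms(2) by (auto simp: continuous_map_def topspace_config_top)
qed

definition block_map :: "nat \<Rightarrow> ((vec \<Rightarrow> 'a) \<Rightarrow> 'b) \<Rightarrow> (vec \<Rightarrow> 'a) \<Rightarrow> (vec \<Rightarrow> 'b)" where
  "block_map d g x = (\<lambda>v\<in>lattice d. g (shift d v x))"

lemma block_map_continuous:
  assumes "finitary d (configs d A) g" and "\<And>x. x \<in> configs d A \<Longrightarrow> g x \<in> B"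
  shows "continuous_map (config_top d A) (config_top d B) (block_map d g)"
  unfolding config_top_def[of d B] continuous_map_componentwise
proof (intro conjI ballI)
  fix v assume v: "v \<in> lattice d"
  have "continuous_map (config_top d A) (discrete_topology B) (\<lambda>x. g (shift d v x))"
    by (rule finitary_continuous[OF finitary_shift])
      (use assms v in \<open>auto intro: shift_in_configs\<close>)
  then show "continuous_map (config_top d A) (discrete_topology B) (\<lambda>x. block_map d g x v)"
    using v by (simp add: block_map_def)
qed (auto simp: block_map_def)

lemma shift_block_map:
  "u \<in> lattice d \<Longrightarrow> shift d u (block_map d g x) = block_map d g (shift d u x)"
  by (auto simp: block_map_def shift_def[of d u "restrict _ _"] shift_shift)

text \<open>By continuity every point of \<open>Y\<close> has a cylinder around it on which
  \<open>g\<close> is constant. By compactness finitely many of them cover \<open>Y\<close>, and the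
  union of their windows determines \<open>g\<close>.\<close>

lemma Curtis_Hedlund_Lyndon:
  assumes "finite A" and "closedin (config_top d A) Y"
    and "continuous_map (subtopology (config_top d A) Y) (discrete_topology B) g"
  shows "finitary d Y g"
proof -
  have "compact_space (config_top d A)"
    unfolding config_top_def compact_space_product_topology
    using assms(1) by (simp add: compact_space_discrete_topology)
  then have comp: "compactin (config_top d A) Y"
    using assms(2) closedin_compact_space by blast
  have Y: "Y \<subseteq> configs d A"
    using assms(2) closedin_subset topspace_config_top by metis
  define C where "C W y = {x \<in> configs d A. \<forall>v\<in>W. x v = y v}" for W y
  have "\<exists>W. finite W \<and> W \<subseteq> lattice d \<and> (\<forall>x\<in>C W y \<inter> Y. g x = g y)" if y: "y \<in> Y" for y
  proof -
    have "openin (subtopology (config_top d A) Y) {x \<in> Y. g x \<in> {g y}}"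
    proof -
      have "g y \<in> B" using assms(3) y Y
        by (auto simp: continuous_map_def topspace_config_top)
      then have "openin (subtopology (config_top d A) Y)
          {x \<in> topspace (subtopology (config_top d A) Y). g x \<in> {g y}}"
        by (intro openin_continuous_map_preimage[OF assms(3)]) simp
      then show ?thesis using Y by (simp add: topspace_config_top Int_absorb1)
    qed
    then obtain T where T: "openin (config_top d A) T" "{x \<in> Y. g x \<in> {g y}} = T \<inter> Y"
      unfolding openin_subtopology by blast
    then have "y \<in> T" using y by auto
    then obtain U where U: "finite {i \<in> lattice d. U i \<noteq> topspace (discrete_topology A)}"
      "y \<in> PiE (lattice d) U" "PiE (lattice d) U \<subseteq> T"
      using T(1) unfolding config_top_def openin_product_topology_alt by blast
    have "C {i \<in> lattice d. U i \<noteq> A} y \<subseteq> PiE (lattice d) U"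
    proof
      fix x assume x: "x \<in> C {i \<in> lattice d. U i \<noteq> A} y"
      show "x \<in> PiE (lattice d) U"
      proof (rule PiE_I)
        fix i assume i: "i \<in> lattice d"
        show "x i \<in> U i"
        proof (cases "U i = A")
          case True
          then show ?thesis using x i by (auto simp: C_def configs_def)
        next
          case False
          then have "x i = y i" using x i by (simp add: C_def)
          then show ?thesis using U(2) i by auto
        qed
      qed (use x in \<open>auto simp: C_def configs_def\<close>)
    qed
    then have "x \<in> {x \<in> Y. g x \<in> {g y}}" if "x \<in> C {i \<in> lattice d. U i \<noteq> A} y \<inter> Y" for x
      unfolding T(2) using U(3) that by blast
    then show ?thesis using U(1)
      by (intro exI[of _ "{i \<in> lattice d. U i \<noteq> A}"]) auto
  qed
  then obtain W where W: "\<And>y. y \<in> Y \<Longrightarrow>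
      finite (W y) \<and> W y \<subseteq> lattice d \<and> (\<forall>x\<in>C (W y) y \<inter> Y. g x = g y)"
    by metis
  have "\<forall>U\<in>(\<lambda>y. C (W y) y) ` Y. openin (config_top d A) U"
    unfolding C_def using W Y by (auto intro!: cylinder_open)
  moreover have "Y \<subseteq> \<Union>((\<lambda>y. C (W y) y) ` Y)"
    using Y by (auto simp: C_def)
  ultimately obtain F where F: "finite F" "F \<subseteq> (\<lambda>y. C (W y) y) ` Y" "Y \<subseteq> \<Union>F"
    using comp unfolding compactin_def by meson
  then obtain Z where Z: "Z \<subseteq> Y" "finite Z" "F = (\<lambda>y. C (W y) y) ` Z"
    using finite_subset_image[OF F(1,2)] by blast
  show ?thesis
  proof (rule finitaryI[of "\<Union>(W ` Z)"])
    show "finite (\<Union>(W ` Z))" "\<Union>(W ` Z) \<subseteq> lattice d"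
      using Z W by auto
    fix x x' assume x: "x \<in> Y" "x' \<in> Y" and eq: "\<forall>v\<in>\<Union>(W ` Z). x v = x' v"
    from x F(3) Z(3) obtain y where y: "y \<in> Z" "x \<in> C (W y) y" by auto
    then have "x' \<in> C (W y) y" using eq x Y by (auto simp: C_def)
    with y x show "g x = g x'" using W[of y] Z(1) by (metis IntI subsetD)
  qed
qed


section \<open>Periods\<close>

lemma vadd_inj_vimage:
  assumes "finite E" and "w \<in> lattice d"
  shows "finite {v \<in> lattice d. vadd v w \<in> E}"
proof (rule finite_imageD[of "\<lambda>v. vadd v w"])
  show "finite ((\<lambda>v. vadd v w) ` {v \<in> lattice d. vadd v w \<in> E})"
    by (rule finite_subset[OF _ assms(1)]) auto
qed (use assms(2) in \<open>auto simp: inj_on_def vadd_right_cancel\<close>)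

text \<open>Pigeonhole on the finite orbit: two multiples of the axis vector lead to the same
  configuration, and their difference is a period.\<close>

lemma strongly_periodic_axis_period:
  assumes "strongly_periodic d p" and "p \<in> configs d A"
  obtains k :: nat where "k > 0" and "shift d (axisv d i (int k)) p = p"
proof -
  define h where "h m = shift d (axisv d i (int m)) p" for m :: nat
  have "range h \<subseteq> {shift d u p |u. u \<in> lattice d}" by (auto simp: h_def)
  then have "finite (range h)"
    using assms(1) finite_subset unfolding strongly_periodic_def by blast
  then have "\<not> inj h" using range_inj_infinite by blast
  then obtain m n where "m < n" "h m = h n"
    unfolding inj_def by (metis linorder_neqE_nat)
  then have "shift d (axisv d i (- int m)) (h m) = shift d (axisv d i (- int m)) (h n)" by simp
  then have "shift d (zerov d) p = shift d (axisv d i (int (n - m))) p"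
    using \<open>m < n\<close> by (simp add: h_def shift_shift vadd_axisv axisv_0 of_nat_diff)
  with \<open>m < n\<close> show thesis using that[of "n - m"] assms(2) by (simp add: shift_zerov)
qed

lemma shift_axis_multiple:
  assumes "shift d (axisv d i k) p = p" and "p \<in> configs d A"
  shows "shift d (axisv d i (int m * k)) p = p"
proof (induction m)
  case 0
  then show ?case using assms(2) by (simp add: axisv_0 shift_zerov)
next
  case (Suc m)
  have "shift d (axisv d i (int (Suc m) * k)) p = shift d (axisv d i (int m * k)) (shift d (axisv d i k) p)"
    by (simp add: shift_shift vadd_axisv algebra_simps)
  with Suc assms(1) show ?case by simp
qed

lemma strongly_periodic_period:
  assumes "strongly_periodic d p" and "p \<in> configs d A"
  obtains P :: nat where "P > 0" and "\<And>i. i < d \<Longrightarrow> shift d (axisv d i (int P)) p = p"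
proof -
  have "\<forall>i. \<exists>k::nat. k > 0 \<and> shift d (axisv d i (int k)) p = p"
    using strongly_periodic_axis_period[OF assms] by metis
  then obtain k :: "nat \<Rightarrow> nat" where k: "\<And>i. k i > 0" "\<And>i. shift d (axisv d i (int (k i))) p = p"
    by metis
  \<comment> \<open>A common multiple of the periods along the axes, so that one number serves all
    directions.\<close>
  define P where "P = (\<Prod>i<d. k i)"
  have "shift d (axisv d i (int P)) p = p" if "i < d" for i
  proof -
    have "k i dvd P" unfolding P_def using that by (intro dvd_prodI) auto
    then obtain m where "P = k i * m" ..
    then have "int P = int m * int (k i)" by simp
    then show ?thesis using shift_axis_multiple[OF k(2) assms(2)] by metis
  qed
  moreover have "P > 0" using k(1) by (simp add: P_def)
  ultimately show thesis using that by blast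
qed

lemma shift_axis_multiple_int:
  assumes "shift d (axisv d i k) p = p" and "p \<in> configs d A"
  shows "shift d (axisv d i (m * k)) p = p"
proof (cases "m \<ge> 0")
  case True
  then show ?thesis using shift_axis_multiple[OF assms, of "nat m"] by simp
next
  case False
  then have "shift d (axisv d i (- m * k)) p = p"
    using shift_axis_multiple[OF assms, of "nat (- m)"] by simp
  then have "shift d (axisv d i (m * k)) (shift d (axisv d i (- m * k)) p) =
      shift d (axisv d i (m * k)) p" by simp
  then show ?thesis using assms(2) by (simp add: shift_shift vadd_axisv axisv_0 shift_zerov)
qed

text \<open>Division with remainder in every coordinate: each shift acts like a shift by a vector
  with entries between 0 and \<open>P - 1\<close>, and there are finitely many of those.\<close>

lemma period_strongly_periodic:
  assumes "P > 0" and z: "z \<in> configs d A" and "\<And>i. i < d \<Longrightarrow> shift d (axisv d i (int P)) z = z"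
  shows "strongly_periodic d z"
proof -
  \<comment> \<open>The multiple of \<open>P\<close> is applied one axis after the other;
    \<open>k\<close> is the number of axes done.\<close>
  have 1: "shift d (map (\<lambda>i. if i < k then int P * u ! i else 0) [0..<d]) z = z"
    if "k \<le> d" "u \<in> lattice d" for u k
    using that(1)
  proof (induction k)
    case 0
    have "map (\<lambda>i. if i < 0 then int P * u ! i else 0) [0..<d] = zerov d"
      by (rule lattice_eqI[of _ d]) (auto simp: lattice_def zerov_def)
    then show ?case using z by (simp add: shift_zerov)
  next
    case (Suc k)
    have "map (\<lambda>i. if i < Suc k then int P * u ! i else 0) [0..<d] =
        vadd (map (\<lambda>i. if i < k then int P * u ! i else 0) [0..<d]) (axisv d k (u ! k * int P))"
      by (rule nth_equalityI)
        (auto simp: vadd_def axisv_nth lattice_def axisv_def zerov_def less_Suc_eq nth_list_update)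
    moreover have "shift d (axisv d k (u ! k * int P)) z = z"
      using Suc.prems assms(3) z by (intro shift_axis_multiple_int) auto
    ultimately show ?case
      using Suc by (simp add: lattice_def shift_shift[symmetric])
  qed
  have 2: "shift d u z \<in> (\<lambda>u. shift d u z) ` {u. set u \<subseteq> {0..<int P} \<and> length u = d}"
    if u: "u \<in> lattice d" for u
  proof (rule image_eqI)
    let ?r = "map (\<lambda>a. a mod int P) u" and ?q = "map (\<lambda>i. if i < d then int P * (map (\<lambda>a. a div int P) u) ! i else 0) [0..<d]"
    have q: "?q \<in> lattice d" "?r \<in> lattice d" using u by (auto simp: lattice_def)
    have "u = vadd ?r ?q"
    proof (rule lattice_eqI[OF u])
      fix i assume "i < d"
      then have "vadd ?r ?q ! i = ?r ! i + ?q ! i" by (rule vadd_nth[OF q(2,1)])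
      also have "\<dots> = u ! i mod int P + int P * (u ! i div int P)"
        using \<open>i < d\<close> u by (simp add: lattice_def)
      finally show "u ! i = vadd ?r ?q ! i" by simp
    qed (use q in simp)
    moreover have "shift d ?q z = z" using 1[of d "map (\<lambda>a. a div int P) u"] u by (simp add: lattice_def)
    ultimately show "shift d u z = shift d ?r z" using shift_shift[OF q(2), of ?q z] by simp
    show "?r \<in> {u. set u \<subseteq> {0..<int P} \<and> length u = d}"
      using u assms(1) by (auto simp: lattice_def)
  qed
  have "finite {u. set u \<subseteq> {0..<int P} \<and> length u = d}"
    by (rule finite_lists_length_eq) simp
  then show ?thesis
    unfolding strongly_periodic_def
    by - (rule finite_subset[OF _ finite_imageI], use 2 in auto)
qed

text \<open>Agreement with a periodic configuration outside of a finite set is not a local property,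
  but a violation of a fixed \<open>P\<close> at a cell is. Therefore block maps can only spread
  violations by a bounded amount, and patterns can detect them.\<close>

definition defects :: "nat \<Rightarrow> nat \<Rightarrow> (vec \<Rightarrow> 'a) \<Rightarrow> vec set" where
  "defects d P x = {v \<in> lattice d. \<exists>i<d. x v \<noteq> x (vadd v (axisv d i (int P)))}"

lemma defects_subset: "defects d P x \<subseteq> (\<Union>i<d. {v \<in> lattice d. x v \<noteq> x (vadd v (axisv d i (int P)))})"
  by (auto simp: defects_def)

lemma finite_defects:
  assumes "\<And>i. i < d \<Longrightarrow> shift d (axisv d i (int P)) p = p"
    and "finite {v \<in> lattice d. x v \<noteq> p v}"
  shows "finite (defects d P x)"
proof (rule finite_subset[OF defects_subset], intro finite_UN_I)
  fix i assume "i \<in> {..<d}"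
  then have i: "p (vadd v (axisv d i (int P))) = p v" if "v \<in> lattice d" for v
    using assms(1)[of i] that by (metis lessThan_iff shift_apply)
  let ?E = "{v \<in> lattice d. x v \<noteq> p v}"
  have "{v \<in> lattice d. x v \<noteq> x (vadd v (axisv d i (int P)))} \<subseteq>
      ?E \<union> {v \<in> lattice d. vadd v (axisv d i (int P)) \<in> ?E}"
    using i by auto
  then show "finite {v \<in> lattice d. x v \<noteq> x (vadd v (axisv d i (int P)))}"
    by (rule finite_subset[OF _ finite_UnI[OF assms(2) vadd_inj_vimage[OF assms(2)]]]) simp
qed simp

lemma defects_empty_iff:
  assumes "x \<in> configs d A"
  shows "defects d P x = {} \<longleftrightarrow> (\<forall>i<d. shift d (axisv d i (int P)) x = x)"
proof
  assume *: "defects d P x = {}"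
  show "\<forall>i<d. shift d (axisv d i (int P)) x = x"
  proof (intro allI impI ext)
    fix i v assume "i < d"
    with * show "shift d (axisv d i (int P)) x v = x v"
      using assms by (cases "v \<in> lattice d")
        (auto simp: defects_def shift_def configs_def PiE_def extensional_def)
  qed
next
  assume "\<forall>i<d. shift d (axisv d i (int P)) x = x"
  then have "x (vadd v (axisv d i (int P))) = x v" if "i < d" "v \<in> lattice d" for i v
    using that shift_apply[of v d "axisv d i (int P)" x] by simp
  then show "defects d P x = {}"
    by (auto simp: defects_def)
qed

text \<open>\<open>P\<close> does not depend on the target, so the target can refer to it.\<close>

lemma embedding_defects:
  assumes A: "finite A" and Y: "closedin (config_top d A) Y"
    and inv: "\<And>u x. u \<in> lattice d \<Longrightarrow> x \<in> Y \<Longrightarrow> shift d u x \<in> Y"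
    and y: "y \<in> Y" "\<not> strongly_periodic d y" "finite (defects d P y)" and "P > 0"
    and f: "continuous_map (subtopology (config_top d A) Y) (subtopology (config_top d B) X) f"
      "\<And>u x. u \<in> lattice d \<Longrightarrow> x \<in> Y \<Longrightarrow> f (shift d u x) = shift d u (f x)" "inj_on f Y"
  shows "f y \<in> X" and "f y \<in> configs d B" and "defects d P (f y) \<noteq> {}"
    and "finite (defects d P (f y))"
proof -
  have YA: "Y \<subseteq> configs d A"
    using Y closedin_subset topspace_config_top by metis
  then have fY: "f x \<in> X \<inter> configs d B" if "x \<in> Y" for x
    using f(1) that by (auto simp: continuous_map_def topspace_config_top)
  with y show "f y \<in> X" and fy: "f y \<in> configs d B" by auto
  show "defects d P (f y) \<noteq> {}"
  proof
    assume "defects d P (f y) = {}"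
    then have "strongly_periodic d (f y)"
      using period_strongly_periodic[OF \<open>P > 0\<close> fy] defects_empty_iff[OF fy] by blast
    \<comment> \<open>The orbit of \<open>f y\<close> is the image of the orbit of \<open>y\<close>,
      and injectivity carries finiteness back to the latter.\<close>
    moreover have "{shift d u (f y) |u. u \<in> lattice d} = f ` {shift d u y |u. u \<in> lattice d}"
      using f(2) y(1) by (auto simp: image_iff) metis
    moreover have "inj_on f {shift d u y |u. u \<in> lattice d}"
      using f(3) by (rule inj_on_subset) (use inv y in auto)
    ultimately show False
      using y(2) unfolding strongly_periodic_def by (simp add: finite_image_iff)
  qed
  have "continuous_map (subtopology (config_top d A) Y) (config_top d B) f"
    using f(1) continuous_map_into_fulltopology by blast
  then have "continuous_map (subtopology (config_top d A) Y) (discrete_topology B) (\<lambda>x. f x (zerov d))"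
    unfolding config_top_def[of d B] continuous_map_componentwise by simp
  then have "finitary d Y (\<lambda>x. f x (zerov d))" by (rule Curtis_Hedlund_Lyndon[OF A Y])
  then obtain W where W: "finite W" "W \<subseteq> lattice d"
    and fW0: "\<forall>x\<in>Y. \<forall>x'\<in>Y. (\<forall>v\<in>W. x v = x' v) \<longrightarrow> f x (zerov d) = f x' (zerov d)"
    by (rule finitaryE)
  note fW = fW0[THEN bspec, THEN bspec, THEN mp]
  have f0: "f x v = f (shift d v x) (zerov d)" if "x \<in> Y" "v \<in> lattice d" for x v
    using that f(2) by (simp add: shift_apply)
  \<comment> \<open>If \<open>f y\<close> changes between \<open>v\<close> and its translate by
    \<open>P\<close>, then the contents of the window change as well, so \<open>y\<close> has a
    violation at some \<open>vadd v w\<close>. Every \<open>w\<close> contributes a translate of a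
    finite set.\<close>
  have "defects d P (f y) \<subseteq> (\<Union>w\<in>W. {v \<in> lattice d. vadd v w \<in> defects d P y})"
  proof
    fix v assume "v \<in> defects d P (f y)"
    then obtain i where v: "v \<in> lattice d" "i < d"
      and ne: "f y v \<noteq> f y (vadd v (axisv d i (int P)))" by (auto simp: defects_def)
    let ?a = "axisv d i (int P)"
    from ne have "f (shift d v y) (zerov d) \<noteq> f (shift d (vadd v ?a) y) (zerov d)"
      using f0[OF y(1)] v by simp
    then obtain w where w: "w \<in> W" "shift d v y w \<noteq> shift d (vadd v ?a) y w"
      using fW[of "shift d v y" "shift d (vadd v ?a) y"] inv y(1) v by auto
    moreover have "vadd w (vadd v ?a) = vadd (vadd v w) ?a" "vadd w v = vadd v w"
      by (metis vadd_assoc vadd_commute)+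
    ultimately have "y (vadd v w) \<noteq> y (vadd (vadd v w) ?a)"
      using W(2) by (simp add: shift_apply subset_iff)
    then have "vadd v w \<in> defects d P y"
      using v w W(2) by (auto simp: defects_def)
    with v w show "v \<in> (\<Union>w\<in>W. {v \<in> lattice d. vadd v w \<in> defects d P y})" by auto
  qed
  then show "finite (defects d P (f y))"
    by (rule finite_subset) (use W y(3) in \<open>auto intro!: vadd_inj_vimage\<close>)
qed


section \<open>Presenting subshifts of finite type\<close>

lemma appears_zip:
  assumes "distinct ws" and "length as = length ws"
  shows "appears d (map_of (zip ws as)) x \<longleftrightarrow> (\<exists>u\<in>lattice d. map (shift d u x) ws = as)"
proof -
  have "(\<forall>v\<in>dom (map_of (zip ws as)). map_of (zip ws as) v = Some (s v)) \<longleftrightarrow> map s ws = as"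
    for s :: "vec \<Rightarrow> 'a"
  proof -
    have "dom (map_of (zip ws as)) = set ws" using assms(2) by simp
    moreover have "map_of (zip ws as) (ws ! i) = Some (as ! i)" if "i < length ws" for i
      using that assms by (simp add: map_of_zip_nth)
    ultimately show ?thesis
      using assms(2) by (auto simp: list_eq_iff_nth_eq all_set_conv_all_nth)
  qed
  then show ?thesis unfolding appears_def by simp
qed

text \<open>All patterns on the window that occur in a configuration failing \<open>Q\<close> are
  forbidden; the finite alphabet leaves finitely many. The list is merely shown to exist, which
  suffices for rules that do not depend on the input.\<close>

lemma finitary_patterns:
  fixes k :: nat
  assumes "finitary d (configs d {..<k}) Q"
  obtains ps where "\<And>p. p \<in> set ps \<Longrightarrow> distinct (map fst p) \<and> (\<forall>(v, a)\<in>set p. v \<in> lattice d \<and> a < k)"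
    and "\<And>x. x \<in> configs d {..<k} \<Longrightarrow> (\<forall>p\<in>set ps. \<not> appears d (map_of p) x) \<longleftrightarrow>
      (\<forall>u\<in>lattice d. Q (shift d u x))"
proof -
  obtain W where W: "finite W" "W \<subseteq> lattice d"
    and Q0: "\<forall>x\<in>configs d {..<k}. \<forall>y\<in>configs d {..<k}. (\<forall>v\<in>W. x v = y v) \<longrightarrow> Q x = Q y"
    using assms by (rule finitaryE)
  note Q = Q0[THEN bspec, THEN bspec, THEN mp]
  obtain ws where ws: "set ws = W" "distinct ws"
    using finite_distinct_list[OF W(1)] by blast
  let ?Z = "{x \<in> configs d {..<k}. \<not> Q x}"
  let ?S = "(\<lambda>x. zip ws (map x ws)) ` ?Z"
  have "(\<lambda>x. map x ws) ` ?Z \<subseteq> {as. set as \<subseteq> {..<k} \<and> length as = length ws}"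
    using ws(1) W(2) by (force simp: configs_def PiE_iff)
  moreover have "finite {as. set as \<subseteq> {..<k} \<and> length as = length ws}"
    by (rule finite_lists_length_eq) simp
  ultimately have "finite (zip ws ` ((\<lambda>x. map x ws) ` ?Z))"
    using finite_subset by blast
  then have "finite ?S" by (simp add: image_image)
  then obtain ps where ps: "set ps = ?S" using finite_list by blast
  show thesis
  proof (rule that)
    fix p assume "p \<in> set ps"
    then obtain x where x: "x \<in> configs d {..<k}" "p = zip ws (map x ws)" unfolding ps by blast
    then have "x v < k" if "v \<in> W" for v
      using W(2) that by (auto simp: configs_def)
    with x(2) show "distinct (map fst p) \<and> (\<forall>(v, a)\<in>set p. v \<in> lattice d \<and> a < k)"
      using ws W(2) by (auto simp: zip_map2 zip_same_conv_map comp_def)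
  next
    fix x assume x: "x \<in> configs d {..<k}"
    have "(\<exists>p\<in>set ps. appears d (map_of p) x) \<longleftrightarrow>
        (\<exists>y\<in>?Z. \<exists>u\<in>lattice d. map (shift d u x) ws = map y ws)"
      unfolding ps using ws(2) by (simp add: appears_zip)
    also have "\<dots> \<longleftrightarrow> (\<exists>u\<in>lattice d. \<not> Q (shift d u x))"
    proof -
      have "(\<exists>y\<in>?Z. map (shift d u x) ws = map y ws) \<longleftrightarrow> \<not> Q (shift d u x)"
        if "u \<in> lattice d" for u
      proof
        assume "\<exists>y\<in>?Z. map (shift d u x) ws = map y ws"
        then obtain y where "y \<in> ?Z" "\<forall>v\<in>W. shift d u x v = y v" using ws(1) by auto
        then show "\<not> Q (shift d u x)" using Q[of "shift d u x" y] shift_in_configs[OF x that] by simp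
      next
        assume "\<not> Q (shift d u x)"
        then have "shift d u x \<in> ?Z" using shift_in_configs[OF x that] by simp
        then show "\<exists>y\<in>?Z. map (shift d u x) ws = map y ws" by (rule bexI[rotated]) simp
      qed
      then show ?thesis by blast
    qed
    finally show "(\<forall>p\<in>set ps. \<not> appears d (map_of p) x) \<longleftrightarrow> (\<forall>u\<in>lattice d. Q (shift d u x))"
      by blast
  qed
qed

section \<open>Tiles\<close>

text \<open>A tile belongs to a rectangle whose rows are the successive states of a run of a program.
  Its label is the continuation; register \<open>x\<close> has value \<open>m\<close> if \<open>x\<close> is among the bits of exactly the
  first \<open>m\<close> tiles of the row. The phase grows by one, modulo a number coprime to the period, in both
  directions, so that no infinite row or column of tiles is periodic.\<close>

datatype tile = Tile (phase: nat) (leftmost: bool) (rightmost: bool) (bottom: bool) (topmost: bool)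
  (label: "prog list") (bits: "nat set")

text \<open>The flags mark the ends of the row; the sets are the bits to the left, at the tile
  itself, to the right, and in the row above. In unary, adding one moves the bits of a register one
  tile to the right and fills the left end; subtracting one moves them to the left. A full row
  blocks \<open>Inc\<close>.\<close>

fun bits_ok :: "prog \<Rightarrow> bool \<Rightarrow> bool \<Rightarrow> nat set \<Rightarrow> nat set \<Rightarrow> nat set \<Rightarrow> nat set \<Rightarrow> bool" where
  "bits_ok (Inc x) L R bl b br b' \<longleftrightarrow>
    \<not> (R \<and> x \<in> b) \<and> b' - {x} = b - {x} \<and> (x \<in> b' \<longleftrightarrow> L \<or> x \<in> bl)"
| "bits_ok (Dec x) L R bl b br b' \<longleftrightarrow>
    (L \<longrightarrow> x \<in> b) \<and> b' - {x} = b - {x} \<and> (x \<in> b' \<longleftrightarrow> \<not> R \<and> x \<in> br)"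
| "bits_ok (Ztest x) L R bl b br b' \<longleftrightarrow> (L \<longrightarrow> x \<notin> b) \<and> b' = b"
| "bits_ok _ L R bl b br b' \<longleftrightarrow> b' = b"

text \<open>At the ends of the row, \<open>b (i - 1)\<close> for \<open>i = 0\<close> and
  \<open>b (Suc i)\<close> for \<open>i = w\<close> are dummies, which \<open>bits_ok\<close>
  ignores there. The row has \<open>Suc w\<close> tiles, and the test at its right end keeps an
  incremented value within this bound.\<close>

lemma bits_ok_sound:
  assumes "\<And>i x. i \<le> w \<Longrightarrow> x \<in> b i \<longleftrightarrow> i < s x" and "\<And>x. s x \<le> Suc w"
    and "\<And>i. i \<le> w \<Longrightarrow> bits_ok q (i = 0) (i = w) (b (i - 1)) (b i) (b (Suc i)) (b' i)"
  shows "\<exists>s'. s' \<in> effect q s \<and> (\<forall>x. s' x \<le> Suc w) \<and> (\<forall>i\<le>w. \<forall>x. x \<in> b' i \<longleftrightarrow> i < s' x)"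
proof (cases q)
  case (Inc y)
  have "y \<notin> b w" using assms(3)[of w] Inc by simp
  then have "s y \<le> w" using assms(1)[of w y] by simp
  moreover have "x \<in> b' i \<longleftrightarrow> i < (s(y := Suc (s y))) x" if "i \<le> w" for i x
  proof (cases "x = y")
    case True
    then have "x \<in> b' i \<longleftrightarrow> i = 0 \<or> y \<in> b (i - 1)" using assms(3)[OF that] Inc by simp
    also have "\<dots> \<longleftrightarrow> i < Suc (s y)" using assms(1)[of "i - 1" y] that by auto
    finally show ?thesis using True by simp
  next
    case False
    then have "x \<in> b' i \<longleftrightarrow> x \<in> b i" using assms(3)[OF that] Inc by auto
    then show ?thesis using False assms(1)[OF that] by simp
  qed
  ultimately show ?thesis using Inc assms(2) by (intro exI[of _ "s(y := Suc (s y))"]) auto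
next
  case (Dec y)
  have "y \<in> b 0" using assms(3)[of 0] Dec by simp
  then have "s y > 0" using assms(1)[of 0 y] by simp
  moreover have "x \<in> b' i \<longleftrightarrow> i < (s(y := s y - 1)) x" if "i \<le> w" for i x
  proof (cases "x = y")
    case True
    then have "x \<in> b' i \<longleftrightarrow> i \<noteq> w \<and> y \<in> b (Suc i)" using assms(3)[OF that] Dec by simp
    also have "\<dots> \<longleftrightarrow> i < s y - 1" using assms(1)[of "Suc i" y] assms(2)[of y] that by auto
    finally show ?thesis using True by simp
  next
    case False
    then have "x \<in> b' i \<longleftrightarrow> x \<in> b i" using assms(3)[OF that] Dec by auto
    then show ?thesis using False assms(1)[OF that] by simp
  qed
  moreover have "(s(y := s y - 1)) x \<le> Suc w" for x
    using assms(2)[of x] by auto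
  ultimately show ?thesis using Dec by (intro exI[of _ "s(y := s y - 1)"]) auto
next
  case (Ztest y)
  have "y \<notin> b 0" using assms(3)[of 0] Ztest by simp
  then have "s y = 0" using assms(1)[of 0 y] by simp
  then show ?thesis using Ztest assms by (intro exI[of _ s]) auto
qed (use assms in \<open>auto intro!: exI[of _ s]\<close>)

text \<open>The bound is \<open>w\<close> and not \<open>Suc w\<close>: one tile of the row stays
  free, so \<open>Inc\<close> is never blocked. Bits are restricted to \<open>R\<close> in order to
  keep the set of tiles finite.\<close>

lemma bits_ok_complete:
  assumes "s' \<in> effect q s" and "\<And>x. s x \<le> w" and "i \<le> w" and "regs q \<subseteq> R"
    and "i > 0 \<Longrightarrow> bl = {x \<in> R. i - 1 < s x}" and "i < w \<Longrightarrow> br = {x \<in> R. Suc i < s x}"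
  shows "bits_ok q (i = 0) (i = w) bl {x \<in> R. i < s x} br {x \<in> R. i < s' x}"
proof (cases q)
  case (Inc y)
  have "y \<in> R" using assms(4) Inc by simp
  with Inc show ?thesis
    using assms(1,3,5) assms(2)[of y] by (cases "i = 0") auto
next
  case (Dec y)
  have "y \<in> R" using assms(4) Dec by simp
  moreover have "s y > 0" "s' = s(y := s y - 1)" using assms(1) Dec by (auto split: if_splits)
  ultimately show ?thesis
    using Dec assms(3,6) assms(2)[of y] by (cases "i = w") auto
qed (use assms(1) in \<open>auto split: if_splits\<close>)

text \<open>In the bottom row, bit \<open>0\<close> can only be lost on the way to the right, so it
  marks an initial segment. In higher rows the unary shape is inherited through
  \<open>bits_ok\<close>.\<close>

definition right_ok :: "nat \<Rightarrow> tile \<Rightarrow> tile \<Rightarrow> bool" where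
  "right_ok k t t' \<longleftrightarrow> \<not> leftmost t' \<and> phase t' = Suc (phase t) mod k \<and> bottom t' = bottom t \<and>
    label t' = label t \<and> (bottom t \<and> 0 \<in> bits t' \<longrightarrow> 0 \<in> bits t)"

definition obits :: "tile option \<Rightarrow> nat set" where
  "obits c = (case c of None \<Rightarrow> {} | Some t \<Rightarrow> bits t)"

definition up_ok :: "nat \<Rightarrow> tile \<Rightarrow> tile option \<Rightarrow> tile option \<Rightarrow> tile \<Rightarrow> bool" where
  "up_ok k t r l t' \<longleftrightarrow> \<not> bottom t' \<and> phase t' = Suc (phase t) mod k \<and>
    leftmost t' = leftmost t \<and> rightmost t' = rightmost t \<and> label t' \<in> lsucc (label t) \<and>
    bits_ok (hd (label t)) (leftmost t) (rightmost t) (obits l) (bits t) (obits r) (bits t')"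

text \<open>The arguments are the tiles at a cell and at its right, left, upper and lower neighbour.\<close>

definition tile_ok ::
  "nat \<Rightarrow> prog \<Rightarrow> tile option \<Rightarrow> tile option \<Rightarrow> tile option \<Rightarrow> tile option \<Rightarrow> tile option \<Rightarrow> bool"
  where
  "tile_ok k p c r l u b \<longleftrightarrow> (\<forall>t. c = Some t \<longrightarrow>
    (\<not> rightmost t \<longrightarrow> (\<exists>t'. r = Some t' \<and> right_ok k t t')) \<and>
    (\<not> leftmost t \<longrightarrow> (\<exists>t'. l = Some t' \<and> \<not> rightmost t')) \<and>
    (\<not> topmost t \<longrightarrow> (\<exists>t'. u = Some t' \<and> up_ok k t r l t')) \<and>
    (\<not> bottom t \<longrightarrow> (\<exists>t'. b = Some t' \<and> \<not> topmost t')) \<and>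
    (bottom t \<longrightarrow> label t = [p] \<and> bits t \<subseteq> {0}) \<and>
    (topmost t \<longrightarrow> label t = []))"

lemma tile_okD:
  assumes "tile_ok k p (Some t) r l u b"
  shows "\<not> rightmost t \<Longrightarrow> \<exists>t'. r = Some t' \<and> right_ok k t t'"
    and "\<not> leftmost t \<Longrightarrow> \<exists>t'. l = Some t' \<and> \<not> rightmost t'"
    and "\<not> topmost t \<Longrightarrow> \<exists>t'. u = Some t' \<and> up_ok k t r l t'"
    and "\<not> bottom t \<Longrightarrow> \<exists>t'. b = Some t' \<and> \<not> topmost t'"
    and "bottom t \<Longrightarrow> label t = [p] \<and> bits t \<subseteq> {0}"
    and "topmost t \<Longrightarrow> label t = []"
  using assms by (simp_all add: tile_ok_def)

definition seed :: "tile option \<Rightarrow> bool" where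
  "seed c \<longleftrightarrow> (\<exists>t. c = Some t \<and> leftmost t \<and> bottom t)"

text \<open>The arguments are the tiles at a cell and at the cells \<open>n + 1\<close> and \<open>n + 2\<close> steps to the right.\<close>

definition input_ok :: "tile option \<Rightarrow> tile option \<Rightarrow> tile option \<Rightarrow> bool" where
  "input_ok c c1 c2 \<longleftrightarrow> (seed c \<longrightarrow>
    (\<exists>t1 t2. c1 = Some t1 \<and> 0 \<in> bits t1 \<and>
      c2 = Some t2 \<and> bottom t2 \<and> \<not> leftmost t2 \<and> 0 \<notin> bits t2))"

section \<open>Reading a rectangle of tiles as a computation\<close>

locale tiling =
  fixes k :: nat and p :: prog and g :: "int \<Rightarrow> int \<Rightarrow> tile option"
  assumes tile_ok: "tile_ok k p (g i j) (g (i + 1) j) (g (i - 1) j) (g i (j + 1)) (g i (j - 1))"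
begin

text \<open>That a row of tiles ends is expressed by a failure of this predicate, because what will
  be excluded later is a phase that keeps advancing forever.\<close>

definition hstep :: "int \<Rightarrow> int \<Rightarrow> bool" where
  "hstep i j \<longleftrightarrow> (\<exists>t t'. g i j = Some t \<and> g (i + 1) j = Some t' \<and> phase t' = Suc (phase t) mod k)"

definition vstep :: "int \<Rightarrow> int \<Rightarrow> bool" where
  "vstep i j \<longleftrightarrow> (\<exists>t t'. g i j = Some t \<and> g i (j + 1) = Some t' \<and> phase t' = Suc (phase t) mod k)"

lemma tile_ok_Some:
  "g i j = Some t \<Longrightarrow>
    tile_ok k p (Some t) (g (i + 1) j) (g (i - 1) j) (g i (j + 1)) (g i (j - 1))"
  using tile_ok[of i j] by simp

lemma right:
  assumes "g i j = Some t" and "\<not> rightmost t"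
  obtains t' where "g (i + 1) j = Some t'" and "right_ok k t t'"
  using tile_okD(1)[OF tile_ok_Some[OF assms(1)] assms(2)] by blast

lemma left:
  assumes "g i j = Some t" and "\<not> leftmost t"
  obtains t' where "g (i - 1) j = Some t'" and "\<not> rightmost t'" and "right_ok k t' t"
proof -
  obtain t' where t': "g (i - 1) j = Some t'" "\<not> rightmost t'"
    using tile_okD(2)[OF tile_ok_Some[OF assms(1)] assms(2)] by blast
  from right[OF this] obtain t1 where "g (i - 1 + 1) j = Some t1" "right_ok k t' t1" .
  then have "right_ok k t' t" using assms(1) by simp
  with t' show thesis by (rule that)
qed

lemma up:
  assumes "g i j = Some t" and "\<not> topmost t"
  obtains t' where "g i (j + 1) = Some t'" and "up_ok k t (g (i + 1) j) (g (i - 1) j) t'"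
  using tile_okD(3)[OF tile_ok_Some[OF assms(1)] assms(2)] by blast

lemma down:
  assumes "g i j = Some t" and "\<not> bottom t"
  obtains t' where "g i (j - 1) = Some t'" and "up_ok k t' (g (i + 1) (j - 1)) (g (i - 1) (j - 1)) t"
proof -
  obtain t' where t': "g i (j - 1) = Some t'" "\<not> topmost t'"
    using tile_okD(4)[OF tile_ok_Some[OF assms(1)] assms(2)] by blast
  from up[OF this] obtain t1 where "g i (j - 1 + 1) = Some t1"
    "up_ok k t' (g (i + 1) (j - 1)) (g (i - 1) (j - 1)) t1" .
  then have "up_ok k t' (g (i + 1) (j - 1)) (g (i - 1) (j - 1)) t"
    using assms(1) by simp
  with t'(1) show thesis by (rule that)
qed

text \<open>A tile that is not leftmost has a left neighbour, so a walk to the left stops at a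
  leftmost tile only, and one that never stopped would satisfy \<open>hstep\<close> all the way. The
  tiles passed are recorded because \<open>row_0\<close> uses them to find out where the walk
  ended.\<close>

lemma trace_left:
  assumes "g i j = Some t" and "\<exists>m::nat. \<not> hstep (i - int m - 1) j"
  obtains m :: nat and t' where "g (i - int m) j = Some t'" and "leftmost t'"
    and "bottom t' = bottom t" and "\<And>m'. m' < m \<Longrightarrow> \<exists>t. g (i - int m') j = Some t \<and> \<not> leftmost t"
proof -
  let ?Q = "\<lambda>m t'. g (i - int m) j = Some t' \<and> bottom t' = bottom t"
  have "\<exists>m t'. ?Q m t' \<and> leftmost t' \<and>
      (\<forall>m'<m. \<exists>t. g (i - int m') j = Some t \<and> \<not> leftmost t)"
  proof (rule ccontr)
    assume contr: "\<not> ?thesis"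
    have Q: "(\<exists>t'. ?Q m t' \<and> \<not> leftmost t') \<and>
        (\<forall>m'<m. \<exists>t. g (i - int m') j = Some t \<and> \<not> leftmost t)" for m
    proof (induction m)
      case 0
      have "\<not> leftmost t"
      proof
        assume "leftmost t"
        then have "?Q 0 t \<and> leftmost t \<and>
            (\<forall>m'<0. \<exists>t. g (i - int m') j = Some t \<and> \<not> leftmost t)"
          using assms(1) by simp
        with contr show False by blast
      qed
      then show ?case using assms(1) by simp
    next
      case (Suc m)
      then obtain t1 where t1: "?Q m t1" "\<not> leftmost t1" by blast
      from t1 obtain t2 where t2: "g (i - int m - 1) j = Some t2" "right_ok k t2 t1"
        by (auto elim: left)
      then have "?Q (Suc m) t2" using t1 by (simp add: right_ok_def algebra_simps)
      moreover have *: "\<forall>m'<Suc m. \<exists>t. g (i - int m') j = Some t \<and> \<not> leftmost t"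
        using Suc t1 by (auto simp: less_Suc_eq)
      moreover have "\<not> leftmost t2" using contr * \<open>?Q (Suc m) t2\<close> by blast
      ultimately show ?case by blast
    qed
    have "hstep (i - int m - 1) j" for m
    proof -
      obtain t1 where t1: "g (i - int m) j = Some t1" "\<not> leftmost t1" using Q[of m] by blast
      then obtain t2 where "g (i - int m - 1) j = Some t2" "right_ok k t2 t1"
        by (auto elim: left)
      with t1 show ?thesis by (auto simp: hstep_def right_ok_def)
    qed
    with assms(2) show False by blast
  qed
  then show thesis using that by blast
qed

lemma trace_down:
  assumes "g i j = Some t" and "\<exists>m::nat. \<not> vstep i (j - int m - 1)"
  obtains m :: nat and t' where "g i (j - int m) = Some t'" and "bottom t'"
    and "leftmost t' = leftmost t"
proof -
  let ?Q = "\<lambda>m t'. g i (j - int m) = Some t' \<and> leftmost t' = leftmost t"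
  have "\<exists>m t'. ?Q m t' \<and> bottom t'"
  proof (rule ccontr)
    assume contr: "\<not> ?thesis"
    have Q: "\<exists>t'. ?Q m t'" for m
    proof (induction m)
      case 0
      show ?case using assms(1) by auto
    next
      case (Suc m)
      then obtain t1 where t1: "?Q m t1" by blast
      with contr have "\<not> bottom t1" by blast
      then obtain t2 where t2: "g i (j - int m - 1) = Some t2"
        "up_ok k t2 (g (i + 1) (j - int m - 1)) (g (i - 1) (j - int m - 1)) t1"
        using t1 by (auto elim: down)
      then have "?Q (Suc m) t2" using t1 by (simp add: up_ok_def algebra_simps)
      then show ?case by blast
    qed
    have "vstep i (j - int m - 1)" for m
    proof -
      obtain t1 where t1: "?Q m t1" using Q by blast
      with contr have "\<not> bottom t1" by blast
      with t1 obtain t2 where "g i (j - int m - 1) = Some t2"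
        "up_ok k t2 (g (i + 1) (j - int m - 1)) (g (i - 1) (j - int m - 1)) t1"
        by (auto elim: down)
      with t1 show ?thesis by (auto simp: vstep_def up_ok_def)
    qed
    with assms(2) show False by blast
  qed
  then show thesis using that by blast
qed

text \<open>A walk to the left and then down: vertical steps preserve \<open>leftmost\<close>, so
  the second walk ends in a corner.\<close>

lemma tile_imp_seed:
  assumes "g i j \<noteq> None" and "\<And>i j. \<exists>m::nat. \<not> hstep (i - int m - 1) j"
    and "\<And>i j. \<exists>m::nat. \<not> vstep i (j - int m - 1)"
  shows "\<exists>i j. seed (g i j)"
proof -
  obtain t where "g i j = Some t" using assms(1) by blast
  from trace_left[OF this assms(2)] obtain m t1 where
    "g (i - int m) j = Some t1" "leftmost t1" by metis
  from trace_down[OF this(1) assms(3)] this(2) show ?thesis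
    unfolding seed_def by metis
qed

definition row :: "nat \<Rightarrow> nat \<Rightarrow> prog list \<Rightarrow> (nat \<Rightarrow> nat) \<Rightarrow> bool" where
  "row w j K s \<longleftrightarrow> (\<forall>x. s x \<le> Suc w) \<and> (\<forall>i\<le>w. \<exists>t. g (int i) (int j) = Some t \<and>
    (leftmost t \<longleftrightarrow> i = 0) \<and> (rightmost t \<longleftrightarrow> i = w) \<and> label t = K \<and>
    (\<forall>x. x \<in> bits t \<longleftrightarrow> i < s x))"

text \<open>The cells tested by \<open>input_ok\<close> might belong to another rectangle, but not for the last seed of
  a row.\<close>

lemma row_0:
  assumes "seed (g 0 0)" and "\<And>i. i > 0 \<Longrightarrow> \<not> seed (g i 0)"
    and "input_ok (g 0 0) (g (int (n + 1)) 0) (g (int (n + 2)) 0)"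
    and "\<And>i j. \<exists>m::nat. \<not> hstep (i - int m - 1) j" and "\<exists>m::nat. \<not> hstep (int m) 0"
  shows "\<exists>w. row w 0 [p] (init n)"
proof -
  obtain t1 t2 where t1: "g (int (n + 1)) 0 = Some t1" "0 \<in> bits t1"
    and t2: "g (int (n + 2)) 0 = Some t2" "bottom t2" "\<not> leftmost t2" "0 \<notin> bits t2"
    using assms(1,3) unfolding input_ok_def by blast
  obtain m t' where m: "g (int (n + 2) - int m) 0 = Some t'" "leftmost t'" "bottom t'"
    and less_m: "\<And>m'. m' < m \<Longrightarrow> \<exists>t. g (int (n + 2) - int m') 0 = Some t \<and> \<not> leftmost t"
    using trace_left[OF t2(1) assms(4)] t2(2) by metis
  \<comment> \<open>A shorter walk would end at a seed to the right of the last one; a longer one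
    would have passed the cell 0, whose tile is leftmost.\<close>
  have "m = n + 2"
  proof (rule ccontr)
    assume "m \<noteq> n + 2"
    then consider "m < n + 2" | "n + 2 < m" by linarith
    then show False
    proof cases
      case 1
      then show False using m assms(2)[of "int (n + 2) - int m"] by (auto simp: seed_def)
    next
      case 2
      then show False using less_m[of "n + 2"] assms(1) by (auto simp: seed_def)
    qed
  qed
  have mid: "\<exists>t. g (int i) 0 = Some t \<and> \<not> leftmost t" if "0 < i" "i \<le> n + 2" for i
    using less_m[of "n + 2 - i"] that \<open>m = n + 2\<close> by (simp add: of_nat_diff)
  define good where "good i \<longleftrightarrow> (\<exists>t. g (int i) 0 = Some t \<and> bottom t \<and> (leftmost t \<longleftrightarrow> i = 0))" for i
  have good_0: "good 0" using assms(1) by (auto simp: good_def seed_def)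
  have good_Suc: "\<exists>t'. g (int (Suc i)) 0 = Some t' \<and> right_ok k t t' \<and> good (Suc i)"
    if "good i" "g (int i) 0 = Some t" "\<not> rightmost t" for i t
  proof -
    from right[OF that(2,3)] obtain t' where "g (int i + 1) 0 = Some t'" "right_ok k t t'" .
    moreover have "int i + 1 = int (Suc i)" by simp
    ultimately have "g (int (Suc i)) 0 = Some t'" "right_ok k t t'" by simp_all
    with that show ?thesis by (auto simp: good_def right_ok_def)
  qed
  have "\<exists>w t. g (int w) 0 = Some t \<and> rightmost t"
  proof (rule ccontr)
    assume contr: "\<not> ?thesis"
    have "good i" for i
    proof (induction i)
      case (Suc i)
      then obtain t where "g (int i) 0 = Some t" by (auto simp: good_def)
      with Suc contr good_Suc[of i t] show ?case by blast
    qed (rule good_0)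
    have "hstep (int i) 0" for i
    proof -
      obtain t where t: "g (int i) 0 = Some t" using \<open>good i\<close> by (auto simp: good_def)
      with contr have "\<not> rightmost t" by blast
      from right[OF t this] obtain t' where "g (int i + 1) 0 = Some t'" "right_ok k t t'" .
      with t show ?thesis by (auto simp: hstep_def right_ok_def)
    qed
    with assms(5) show False by blast
  qed
  then have ex: "\<exists>w. \<exists>t. g (int w) 0 = Some t \<and> rightmost t" by blast
  define w where "w = (LEAST w. \<exists>t. g (int w) 0 = Some t \<and> rightmost t)"
  have w: "\<exists>t. g (int w) 0 = Some t \<and> rightmost t"
    unfolding w_def using ex by (rule LeastI_ex)
  have less_w: "\<not> rightmost t" if "i < w" "g (int i) 0 = Some t" for i t
    using not_less_Least[of i "\<lambda>w. \<exists>t. g (int w) 0 = Some t \<and> rightmost t"] that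
    unfolding w_def by blast
  have good: "good i" if "i \<le> w" for i
    using that
  proof (induction i)
    case (Suc i)
    then obtain t where "g (int i) 0 = Some t" by (auto simp: good_def)
    with Suc show ?case using good_Suc less_w[of i t] by auto
  qed (rule good_0)
  \<comment> \<open>Otherwise the cell just after the right end carries a tile that is not leftmost,
    and then its left neighbour, the tile at \<open>w\<close>, could not be rightmost.\<close>
  have "n + 2 \<le> w"
  proof (rule ccontr)
    assume "\<not> n + 2 \<le> w"
    then obtain t where "g (int (Suc w)) 0 = Some t" "\<not> leftmost t" using mid[of "Suc w"] by auto
    then obtain t' where "g (int w) 0 = Some t'" "\<not> rightmost t'" by (auto elim: left)
    with w show False by auto
  qed
  have mono: "0 \<in> bits t" if "i \<le> j" "j \<le> w" "g (int i) 0 = Some t" "g (int j) 0 = Some t'" "0 \<in> bits t'"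
    for i j t t'
    using that
  proof (induction j arbitrary: t' rule: dec_induct)
    case (step j)
    obtain t1 where t1: "g (int j) 0 = Some t1" "bottom t1"
      using good[of j] step by (auto simp: good_def)
    then obtain t2 where t2: "g (int (Suc j)) 0 = Some t2" "right_ok k t1 t2"
      using good_Suc[of j t1] good[of j] less_w[of j t1] step by auto
    then have "0 \<in> bits t1" using step.prems t1 by (auto simp: right_ok_def)
    then show ?case using step t1 by auto
  qed auto
  have "row w 0 [p] (init n)"
    unfolding row_def
  proof (intro conjI allI impI)
    show "init n x \<le> Suc w" for x using \<open>n + 2 \<le> w\<close> by (simp add: init_def)
    fix i assume i: "i \<le> w"
    then obtain t where t: "g (int i) 0 = Some t" "bottom t" "leftmost t \<longleftrightarrow> i = 0"
      using good by (auto simp: good_def)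
    then have lab: "label t = [p]" "bits t \<subseteq> {0}"
      using tile_okD(5)[OF tile_ok_Some[OF t(1)]] by auto
    have "rightmost t \<longleftrightarrow> i = w"
      using w less_w[of i t] t i by (cases "i = w") auto
    moreover have "0 \<in> bits t \<longleftrightarrow> i < n + 2"
    proof (cases "i < n + 2")
      case True
      then show ?thesis using mono[of i "n + 1" t t1] t t1 \<open>n + 2 \<le> w\<close> by auto
    next
      case False
      then show ?thesis using mono[of "n + 2" i t2 t] t t2 i by auto
    qed
    ultimately show "\<exists>t. g (int i) (int 0) = Some t \<and> (leftmost t \<longleftrightarrow> i = 0) \<and>
        (rightmost t \<longleftrightarrow> i = w) \<and> label t = [p] \<and> (\<forall>x. x \<in> bits t \<longleftrightarrow> i < init n x)"
      using t lab by (auto simp: init_def)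
  qed
  then show ?thesis ..
qed

lemma row_Suc:
  assumes "row w j K s" and "K \<noteq> []"
  shows "\<exists>K' s'. row w (Suc j) K' s' \<and> cstep (K, s) (K', s')"
proof -
  have "\<forall>i. \<exists>t. i \<le> w \<longrightarrow> g (int i) (int j) = Some t \<and>
    (leftmost t \<longleftrightarrow> i = 0) \<and> (rightmost t \<longleftrightarrow> i = w) \<and> label t = K \<and> (\<forall>x. x \<in> bits t \<longleftrightarrow> i < s x)"
    using assms(1) unfolding row_def by blast
  then obtain t where t: "\<forall>i. i \<le> w \<longrightarrow> g (int i) (int j) = Some (t i) \<and>
    (leftmost (t i) \<longleftrightarrow> i = 0) \<and> (rightmost (t i) \<longleftrightarrow> i = w) \<and> label (t i) = K \<and>
    (\<forall>x. x \<in> bits (t i) \<longleftrightarrow> i < s x)"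
    by (rule choice[THEN exE])
  have "\<forall>i. \<exists>t'. i \<le> w \<longrightarrow> g (int i) (int (Suc j)) = Some t' \<and>
      up_ok k (t i) (g (int i + 1) (int j)) (g (int i - 1) (int j)) t'"
  proof (intro allI)
    fix i
    show "\<exists>t'. i \<le> w \<longrightarrow> g (int i) (int (Suc j)) = Some t' \<and>
      up_ok k (t i) (g (int i + 1) (int j)) (g (int i - 1) (int j)) t'"
    proof (cases "i \<le> w")
      case True
      then have ti: "g (int i) (int j) = Some (t i)" "label (t i) = K" using t by auto
      then have "\<not> topmost (t i)"
        using tile_okD(6)[OF tile_ok_Some[OF ti(1)]] assms(2) by auto
      from up[OF ti(1) this] obtain t' where "g (int i) (int j + 1) = Some t'"
        "up_ok k (t i) (g (int i + 1) (int j)) (g (int i - 1) (int j)) t'" .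
      moreover have "int j + 1 = int (Suc j)" by simp
      ultimately show ?thesis by metis
    qed simp
  qed
  then obtain t' where t': "\<forall>i. i \<le> w \<longrightarrow> g (int i) (int (Suc j)) = Some (t' i) \<and>
      up_ok k (t i) (g (int i + 1) (int j)) (g (int i - 1) (int j)) (t' i)"
    by (rule choice[THEN exE])
  define K' where "K' = label (t' 0)"
  \<comment> \<open>Each tile of the new row chooses its own element of \<open>lsucc K\<close>;
    \<open>right_ok\<close> makes all the choices agree.\<close>
  have K': "label (t' i) = K'" if "i \<le> w" for i
    using that
  proof (induction i)
    case (Suc i)
    then have "\<not> rightmost (t' i)" using t t' by (auto simp: up_ok_def)
    then have "right_ok k (t' i) (t' (Suc i))"
    proof -
      have "g (int i) (int (Suc j)) = Some (t' i)" "g (int (Suc i)) (int (Suc j)) = Some (t' (Suc i))"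
        using t' Suc.prems by auto
      moreover have "int i + 1 = int (Suc i)" by simp
      ultimately show ?thesis
        using right[of "int i" "int (Suc j)" "t' i"] \<open>\<not> rightmost (t' i)\<close> by (metis option.inject)
    qed
    then show ?case using Suc by (simp add: right_ok_def)
  qed (simp add: K'_def)
  obtain q L where K: "K = q # L" using assms(2) by (cases K) auto
  have "bits_ok q (i = 0) (i = w) (bits (t (i - 1))) (bits (t i)) (bits (t (Suc i))) (bits (t' i))"
    if "i \<le> w" for i
  proof -
    have "bits_ok q (i = 0) (i = w) (obits (g (int i - 1) (int j))) (bits (t i))
        (obits (g (int i + 1) (int j))) (bits (t' i))"
      using t[rule_format, OF that] t'[rule_format, OF that] K by (simp add: up_ok_def)
    moreover have "g (int i - 1) (int j) = Some (t (i - 1))" if "i \<noteq> 0"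
    proof -
      have "int i - 1 = int (i - 1)" using that by (simp add: of_nat_diff)
      moreover have "i - 1 \<le> w" using \<open>i \<le> w\<close> by simp
      ultimately show ?thesis using t by metis
    qed
    moreover have "g (int i + 1) (int j) = Some (t (Suc i))" if "i \<noteq> w"
    proof -
      have "int i + 1 = int (Suc i)" by simp
      moreover have "Suc i \<le> w" using \<open>i \<le> w\<close> that by simp
      ultimately show ?thesis using t by metis
    qed
    ultimately show ?thesis
      by (cases q; cases "i = 0"; cases "i = w") (auto simp: obits_def)
  qed
  moreover have "x \<in> bits (t i) \<longleftrightarrow> i < s x" if "i \<le> w" for i x
    using t that by blast
  moreover have "s x \<le> Suc w" for x
    using assms(1) by (simp add: row_def)
  ultimately have "\<exists>s'. s' \<in> effect q s \<and> (\<forall>x. s' x \<le> Suc w) \<and>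
      (\<forall>i\<le>w. \<forall>x. x \<in> bits (t' i) \<longleftrightarrow> i < s' x)"
    by (intro bits_ok_sound[of w "\<lambda>i. bits (t i)"])
  then obtain s' where s': "s' \<in> effect q s" "\<forall>x. s' x \<le> Suc w"
    "\<forall>i\<le>w. \<forall>x. x \<in> bits (t' i) \<longleftrightarrow> i < s' x"
    by blast
  have "row w (Suc j) K' s'"
    unfolding row_def
  proof (intro conjI allI impI)
    show "s' x \<le> Suc w" for x using s'(2) by blast
    fix i assume i: "i \<le> w"
    then show "\<exists>t. g (int i) (int (Suc j)) = Some t \<and> (leftmost t \<longleftrightarrow> i = 0) \<and>
        (rightmost t \<longleftrightarrow> i = w) \<and> label t = K' \<and> (\<forall>x. x \<in> bits t \<longleftrightarrow> i < s' x)"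
      using t[rule_format, OF i] t'[rule_format, OF i] K'[OF i] s'(3)
      by (intro exI[of _ "t' i"]) (simp add: up_ok_def)
  qed
  moreover have "K' \<in> lsucc K"
    using t[rule_format, of 0] t'[rule_format, of 0] by (simp add: K'_def up_ok_def)
  ultimately show ?thesis using s'(1) K by (auto simp: cstep_Cons)
qed

text \<open>If no run is complete, the label \<open>[]\<close> is never reached. Then no tile of the
  left column is topmost, rows are added forever, and \<open>vstep\<close> never fails.\<close>

lemma seed_imp_halts:
  assumes "seed (g 0 0)" and "\<And>i. i > 0 \<Longrightarrow> \<not> seed (g i 0)"
    and "input_ok (g 0 0) (g (int (n + 1)) 0) (g (int (n + 2)) 0)"
    and "\<And>i j. \<exists>m::nat. \<not> hstep (i - int m - 1) j" and "\<exists>m::nat. \<not> hstep (int m) 0"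
    and "\<exists>m::nat. \<not> vstep 0 (int m)"
  shows "run p (init n) \<noteq> {}"
proof
  assume "run p (init n) = {}"
  then have nohalt: "\<not> cstep\<^sup>*\<^sup>* ([p], init n) ([], s)" for s
    by (simp flip: run_iff_csteps)
  obtain w where w: "row w 0 [p] (init n)"
    using row_0[OF assms(1-5)] by blast
  have rows: "\<exists>K s. row w j K s \<and> cstep\<^sup>*\<^sup>* ([p], init n) (K, s)" for j
  proof (induction j)
    case 0
    show ?case using w by blast
  next
    case (Suc j)
    then obtain K s where Ks: "row w j K s" "cstep\<^sup>*\<^sup>* ([p], init n) (K, s)" by blast
    then have "K \<noteq> []" using nohalt by blast
    from row_Suc[OF Ks(1) this] Ks(2) show ?case
      by (meson rtranclp.rtrancl_into_rtrancl)
  qed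
  have "vstep 0 (int j)" for j
  proof -
    obtain K s where Ks: "row w j K s" "cstep\<^sup>*\<^sup>* ([p], init n) (K, s)" using rows by blast
    then obtain t where t: "g 0 (int j) = Some t" "label t = K" unfolding row_def by force
    moreover have "K \<noteq> []" using Ks(2) nohalt by blast
    ultimately have "\<not> topmost t"
      using tile_okD(6)[OF tile_ok_Some[OF t(1)]] by auto
    from up[OF t(1) this] obtain t' where "g 0 (int j + 1) = Some t'"
      "up_ok k t (g (0 + 1) (int j)) (g (0 - 1) (int j)) t'" .
    with t(1) show ?thesis by (auto simp: vstep_def up_ok_def)
  qed
  with assms(6) show False by blast
qed

end


section \<open>The target subshift\<close>

text \<open>The rules determine \<open>defect\<close> from the layers at distance \<open>P\<close>.
  It is stored so that rays need to inspect nearest neighbours only.\<close>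

datatype 'a symb = Symb (layer: 'a) (defect: bool) (rray: "nat option") (lray: "nat option")
  (uray: "nat option") (tile: "tile option")

text \<open>A ray label is the distance, modulo \<open>k\<close>, to the next target in its direction. The arguments
  tell whether the next cell is a target, and give the labels of a cell and of the next one.\<close>

definition ray_ok :: "nat \<Rightarrow> bool \<Rightarrow> nat option \<Rightarrow> nat option \<Rightarrow> bool" where
  "ray_ok k T c c' \<longleftrightarrow> (\<forall>a. c = Some a \<longrightarrow> T \<or> (\<exists>b. c' = Some b \<and> a = Suc b mod k))"

text \<open>An upward ray looks for a row that contains a defect, on either side of its column. This
  is the purpose of \<open>lray\<close>: no defect may discharge itself by a leftward ray, which
  would lead to an earlier defect.\<close>

definition uray_target :: "'a symb \<Rightarrow> bool" where
  "uray_target t \<longleftrightarrow> defect t \<or> rray t \<noteq> None \<or> lray t \<noteq> None"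

text \<open>Every defect is a seed or has a ray that leads to a later defect, in the order of the second
  and then the first coordinate.\<close>

definition local_rule :: "nat \<Rightarrow> nat \<Rightarrow> prog \<Rightarrow> (vec \<Rightarrow> 'a symb) \<Rightarrow> bool" where
  "local_rule d P p z \<longleftrightarrow>
    (defect (z (zerov d)) \<longleftrightarrow> (\<exists>i<d. layer (z (zerov d)) \<noteq> layer (z (axisv d i (int P))))) \<and>
    ray_ok (Suc P) (defect (z (plane d 1 0))) (rray (z (zerov d))) (rray (z (plane d 1 0))) \<and>
    ray_ok (Suc P) (defect (z (plane d (-1) 0))) (lray (z (zerov d))) (lray (z (plane d (-1) 0))) \<and>
    ray_ok (Suc P) (uray_target (z (plane d 0 1))) (uray (z (zerov d))) (uray (z (plane d 0 1))) \<and>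
    (defect (z (zerov d)) \<longrightarrow> rray (z (zerov d)) \<noteq> None \<or> uray (z (zerov d)) \<noteq> None \<or>
      seed (tile (z (zerov d)))) \<and>
    (seed (tile (z (zerov d))) \<longrightarrow> defect (z (zerov d))) \<and>
    tile_ok (Suc P) p (tile (z (zerov d))) (tile (z (plane d 1 0))) (tile (z (plane d (-1) 0)))
      (tile (z (plane d 0 1))) (tile (z (plane d 0 (-1))))"

definition input_rule :: "nat \<Rightarrow> nat \<Rightarrow> (vec \<Rightarrow> 'a symb) \<Rightarrow> bool" where
  "input_rule d n z \<longleftrightarrow> input_ok (tile (z (zerov d))) (tile (z (plane d (int (n + 1)) 0)))
    (tile (z (plane d (int (n + 2)) 0)))"

text \<open>Modulo \<open>Suc P\<close>, adding \<open>P\<close> is subtracting one, and the modulus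
  exceeds one because \<open>P > 0\<close>.\<close>

lemma add_mod_Suc_neq:
  fixes P x :: nat
  assumes "P > 0"
  shows "(x + P) mod Suc P \<noteq> x"
proof
  assume eq: "(x + P) mod Suc P = x"
  then have "x < Suc P" by (metis mod_less_divisor zero_less_Suc)
  then show False using eq assms by (cases x) (auto simp: mod_if)
qed

lemma phase_not_periodic:
  assumes "P > 0" and "\<And>m. a (Suc m) = Suc (a m) mod Suc P"
  shows "a (m + P) \<noteq> a m"
proof -
  have "a (Suc j + m) = (a m + Suc j) mod Suc P" for j
  proof (induction j)
    case 0
    show ?case using assms(2)[of m] by simp
  next
    case (Suc j)
    show ?case using assms(2)[of "Suc j + m"] unfolding Suc by (simp add: mod_Suc_eq)
  qed
  from this[of "P - 1"] have "a (m + P) = (a m + P) mod Suc P"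
    using assms(1) by (simp add: add.commute)
  then show ?thesis using add_mod_Suc_neq[OF assms(1)] by metis
qed

text \<open>For counters that decrease along the walk: ray labels, which are distances to a target,
  and phases followed to the left or downwards.\<close>

lemma phase_not_periodic_rev:
  assumes "P > 0" and "\<And>m. a m = Suc (a (Suc m)) mod Suc P"
  shows "a (m + P) \<noteq> a m"
proof -
  have "a m = (a (Suc j + m) + Suc j) mod Suc P" for j
  proof (induction j)
    case 0
    show ?case using assms(2)[of m] by simp
  next
    case (Suc j)
    have "a (Suc j + m) = Suc (a (Suc (Suc j) + m)) mod Suc P"
      using assms(2)[of "Suc j + m"] by simp
    then have "a m = (Suc (a (Suc (Suc j) + m)) mod Suc P + Suc j) mod Suc P"
      using Suc by simp
    also have "\<dots> = (Suc (a (Suc (Suc j) + m)) + Suc j) mod Suc P"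
      by (rule mod_add_left_eq)
    finally show ?case by simp
  qed
  from this[of "P - 1"] have "a m = (a (m + P) + P) mod Suc P"
    using assms(1) by (simp add: add.commute)
  then show ?thesis using add_mod_Suc_neq[OF assms(1)] by metis
qed

lemma defectsI:
  "v \<in> lattice d \<Longrightarrow> i < d \<Longrightarrow> x v \<noteq> x (vadd v (axisv d i (int P))) \<Longrightarrow> v \<in> defects d P x"
  by (auto simp: defects_def)

text \<open>In either direction, two different symbols at distance \<open>P\<close> on the line give
  a defect at the cell with the smaller coordinate. If this happened for all \<open>m\<close>, there
  would be infinitely many defects.\<close>

lemma finite_defects_line:
  assumes "finite (defects d P z)" and "v \<in> lattice d" and "i < d" and "s = 1 \<or> s = - 1"
  obtains m :: nat where "z (vadd v (axisv d i (s * int (m + P)))) = z (vadd v (axisv d i (s * int m)))"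
proof -
  let ?c = "\<lambda>m::nat. vadd v (axisv d i (s * int m))"
  have c_nth: "?c m ! i = v ! i + s * int m" for m
    using assms(2,3) by (simp add: vadd_nth[where d = d] axisv_nth)
  have "inj ?c"
  proof (rule injI)
    fix m m' assume "?c m = ?c m'"
    then have "v ! i + s * int m = v ! i + s * int m'" using c_nth by metis
    then show "m = m'" using assms(4) by auto
  qed
  then have inj: "inj (\<lambda>m. ?c (m + j))" for j
    using inj_compose[of ?c "\<lambda>m. m + j"] by (simp add: comp_def inj_def)
  have "\<exists>m. z (?c (m + P)) = z (?c m)"
  proof (rule ccontr)
    assume contr: "\<not> ?thesis"
    have "\<exists>j. range (\<lambda>m. ?c (m + j)) \<subseteq> defects d P z"
    proof (cases "s = 1")
      case True
      have "vadd (?c m) (axisv d i (int P)) = ?c (m + P)" for m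
        by (simp add: vadd_assoc vadd_axisv True)
      then have "z (?c m) \<noteq> z (vadd (?c m) (axisv d i (int P)))" for m
        using contr by metis
      then have "range (\<lambda>m. ?c (m + 0)) \<subseteq> defects d P z"
        using assms(2,3) by (intro image_subsetI defectsI[of _ _ i]) auto
      then show ?thesis ..
    next
      case False
      then have "s = - 1" using assms(4) by simp
      have "vadd (?c (m + P)) (axisv d i (int P)) = ?c m" for m
        by (simp add: vadd_assoc vadd_axisv \<open>s = - 1\<close>)
      then have "z (?c (m + P)) \<noteq> z (vadd (?c (m + P)) (axisv d i (int P)))" for m
        using contr by metis
      then have "range (\<lambda>m. ?c (m + P)) \<subseteq> defects d P z"
        using assms(2,3) by (intro image_subsetI defectsI[of _ _ i]) auto
      then show ?thesis ..
    qed
    then show False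
      using assms(1) inj range_inj_infinite finite_subset by metis
  qed
  then show thesis using that by blast
qed

section \<open>Configurations that obey the rules and have finitely many defects\<close>

locale rule_config =
  fixes d P :: nat and p :: prog and z :: "vec \<Rightarrow> 'a symb"
  assumes d: "2 \<le> d" and P: "P > 0"
    and rule: "\<And>v. v \<in> lattice d \<Longrightarrow> local_rule d P p (shift d v z)"
    and finite_defects: "finite (defects d P z)"
begin

definition cell :: "vec \<Rightarrow> int \<Rightarrow> int \<Rightarrow> vec" where
  "cell v i j = vadd v (plane d i j)"

lemma cell_in_lattice [simp]: "v \<in> lattice d \<Longrightarrow> cell v i j \<in> lattice d"
  using d by (simp add: cell_def)

lemma cell_0 [simp]: "v \<in> lattice d \<Longrightarrow> cell v 0 0 = v"
  using d by (simp add: cell_def plane_0)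

lemma cell_cell: "cell (cell v i j) k l = cell v (i + k) (j + l)"
  by (simp add: cell_def vadd_assoc vadd_plane)

lemma shift_plane: "v \<in> lattice d \<Longrightarrow> shift d v z (plane d i j) = z (cell v i j)"
  using d by (simp add: shift_apply cell_def vadd_commute)

lemma cell_rule:
  assumes v: "v \<in> lattice d"
  shows "defect (z v) \<longleftrightarrow> (\<exists>i<d. layer (z v) \<noteq> layer (z (vadd v (axisv d i (int P)))))"
    and "ray_ok (Suc P) (defect (z (cell v 1 0))) (rray (z v)) (rray (z (cell v 1 0)))"
    and "ray_ok (Suc P) (defect (z (cell v (-1) 0))) (lray (z v)) (lray (z (cell v (-1) 0)))"
    and "ray_ok (Suc P) (uray_target (z (cell v 0 1))) (uray (z v)) (uray (z (cell v 0 1)))"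
    and "defect (z v) \<Longrightarrow> rray (z v) \<noteq> None \<or> uray (z v) \<noteq> None \<or> seed (tile (z v))"
    and "seed (tile (z v)) \<Longrightarrow> defect (z v)"
    and "tile_ok (Suc P) p (tile (z v)) (tile (z (cell v 1 0))) (tile (z (cell v (-1) 0)))
      (tile (z (cell v 0 1))) (tile (z (cell v 0 (-1))))"
  using rule[OF v] v unfolding local_rule_def
  by (auto simp: shift_plane shift_apply vadd_commute[of "axisv _ _ _"])

text \<open>Along a ray that hits no target, the labels would be aperiodic.\<close>

lemma ray:
  assumes ok: "\<And>v. v \<in> lattice d \<Longrightarrow>
      ray_ok (Suc P) (T (z (vadd v (axisv d i s)))) (F (z v)) (F (z (vadd v (axisv d i s))))"
    and v: "v \<in> lattice d" and i: "i < d" and s: "s = 1 \<or> s = - 1" and "F (z v) \<noteq> None"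
  shows "\<exists>m::nat. T (z (vadd v (axisv d i (s * int (Suc m)))))"
proof (rule ccontr)
  assume contr: "\<not> ?thesis"
  define c where "c m = vadd v (axisv d i (s * int m))" for m :: nat
  have c: "c m \<in> lattice d" "vadd (c m) (axisv d i s) = c (Suc m)" for m
    using v by (simp_all add: c_def vadd_assoc vadd_axisv algebra_simps)
  have step: "\<exists>b. F (z (c (Suc m))) = Some b \<and> a = Suc b mod Suc P" if "F (z (c m)) = Some a" for m a
    using ok[OF c(1)[of m]] contr that unfolding c(2) ray_ok_def by (auto simp: c_def)
  have "F (z (c m)) \<noteq> None" for m
  proof (induction m)
    case 0
    show ?case using assms(5) v by (simp add: c_def axisv_0)
  next
    case (Suc m)
    then show ?case using step by blast
  qed
  then have "the (F (z (c m))) = Suc (the (F (z (c (Suc m))))) mod Suc P" for m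
    using step[of m] by fastforce
  from phase_not_periodic_rev[of P "\<lambda>m. the (F (z (c m)))", OF P this]
  have "z (c (m + P)) \<noteq> z (c m)" for m by metis
  then show False
    using finite_defects_line[OF finite_defects v i s] unfolding c_def by metis
qed

lemma rray_imp: "v \<in> lattice d \<Longrightarrow> rray (z v) \<noteq> None \<Longrightarrow> \<exists>i>0. defect (z (cell v i 0))"
  using ray[of defect 0 1 rray v] cell_rule(2) d
  by (simp add: cell_def plane_eq_axis) (metis of_nat_0_less_iff zero_less_Suc of_nat_Suc)

lemma lray_imp: "v \<in> lattice d \<Longrightarrow> lray (z v) \<noteq> None \<Longrightarrow> \<exists>i. defect (z (cell v i 0))"
  using ray[of defect 0 "-1" lray v] cell_rule(3) d
  by (simp add: cell_def plane_eq_axis) metis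

lemma uray_imp: "v \<in> lattice d \<Longrightarrow> uray (z v) \<noteq> None \<Longrightarrow> \<exists>i. \<exists>j>0. defect (z (cell v i j))"
proof -
  assume v: "v \<in> lattice d" and "uray (z v) \<noteq> None"
  then have "\<exists>m::nat. uray_target (z (vadd v (axisv d 1 (1 * int (Suc m)))))"
    using ray[of uray_target 1 1 uray v] cell_rule(4) d by (simp add: cell_def plane_eq_axis)
  then obtain m :: nat where m: "uray_target (z (cell v 0 (int (Suc m))))"
    using d by (auto simp: cell_def plane_eq_axis)
  let ?u = "cell v 0 (int (Suc m))"
  have "\<exists>i. defect (z (cell ?u i 0))"
    using m rray_imp[of ?u] lray_imp[of ?u] cell_0[of ?u] v unfolding uray_target_def
    by (metis cell_in_lattice)
  then obtain i where "defect (z (cell v i (int (Suc m))))" by (auto simp: cell_cell)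
  then show ?thesis by (metis of_nat_0_less_iff zero_less_Suc)
qed

lemma tiling_plane: "v \<in> lattice d \<Longrightarrow> tiling (Suc P) p (\<lambda>i j. tile (z (cell v i j)))"
  by unfold_locales (use cell_rule(7)[of "cell v _ _"] in \<open>simp add: cell_cell\<close>)

text \<open>\<open>hstep\<close> is indexed by the left cell of a pair, hence the offset
  \<open>- 1\<close> for walks to the left. Along an endless walk the phases differ at distance
  \<open>P\<close>, contrary to \<open>finite_defects_line\<close>.\<close>

lemma not_hstep_forever:
  assumes v: "v \<in> lattice d" and s: "s = 1 \<or> s = - 1"
    and "\<And>m::nat. tiling.hstep (Suc P) (\<lambda>i j. tile (z (cell v i j))) (s * int m + (if s = 1 then 0 else - 1)) 0"
  shows False
proof -
  define c where "c m = vadd v (axisv d 0 (s * int m))" for m :: nat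
  have c: "c m = cell v (s * int m) 0" for m
    using d by (simp add: c_def cell_def plane_eq_axis)
  define a where "a m = phase (the (tile (z (c m))))" for m
  have "a (m + P) \<noteq> a m" for m
  proof (cases "s = 1")
    case True
    have "a (Suc m) = Suc (a m) mod Suc P" for m
      using assms(3)[of m] True tiling_plane[OF v]
      by (auto simp: tiling.hstep_def a_def c add.commute)
    then show ?thesis by (rule phase_not_periodic[OF P])
  next
    case False
    then have "s = - 1" using s by simp
    have "a m = Suc (a (Suc m)) mod Suc P" for m
      using assms(3)[of m] \<open>s = - 1\<close> tiling_plane[OF v]
      by (auto simp: tiling.hstep_def a_def c algebra_simps)
    then show ?thesis by (rule phase_not_periodic_rev[OF P])
  qed
  then have "z (c (m + P)) \<noteq> z (c m)" for m unfolding a_def by metis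
  then show False
    using finite_defects_line[OF finite_defects v _ s, of 0] d unfolding c_def by (metis pos2 le_trans less_le_trans)
qed

lemma not_vstep_forever:
  assumes v: "v \<in> lattice d" and s: "s = 1 \<or> s = - 1"
    and "\<And>m::nat. tiling.vstep (Suc P) (\<lambda>i j. tile (z (cell v i j))) 0 (s * int m + (if s = 1 then 0 else - 1))"
  shows False
proof -
  define c where "c m = vadd v (axisv d 1 (s * int m))" for m :: nat
  have c: "c m = cell v 0 (s * int m)" for m
    using d by (simp add: c_def cell_def plane_eq_axis)
  define a where "a m = phase (the (tile (z (c m))))" for m
  have "a (m + P) \<noteq> a m" for m
  proof (cases "s = 1")
    case True
    have "a (Suc m) = Suc (a m) mod Suc P" for m
      using assms(3)[of m] True tiling_plane[OF v]
      by (auto simp: tiling.vstep_def a_def c add.commute)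
    then show ?thesis by (rule phase_not_periodic[OF P])
  next
    case False
    then have "s = - 1" using s by simp
    have "a m = Suc (a (Suc m)) mod Suc P" for m
      using assms(3)[of m] \<open>s = - 1\<close> tiling_plane[OF v]
      by (auto simp: tiling.vstep_def a_def c algebra_simps)
    then show ?thesis by (rule phase_not_periodic_rev[OF P])
  qed
  then have "z (c (m + P)) \<noteq> z (c m)" for m unfolding a_def by metis
  then show False
    using finite_defects_line[OF finite_defects v _ s, of 1] d unfolding c_def
    by (metis Suc_1 Suc_le_lessD One_nat_def)
qed

lemma hstep_cell:
  assumes "v \<in> lattice d"
  shows "tiling.hstep (Suc P) (\<lambda>k l. tile (z (cell (cell v i j) k l))) a b \<longleftrightarrow>
    tiling.hstep (Suc P) (\<lambda>k l. tile (z (cell v k l))) (i + a) (j + b)"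
  using assms tiling.hstep_def[OF tiling_plane[OF assms]] tiling.hstep_def[OF tiling_plane[of "cell v i j"]]
  by (simp add: cell_cell add.assoc)

lemma not_left_forever:
  assumes v: "v \<in> lattice d"
  shows "\<exists>m::nat. \<not> tiling.hstep (Suc P) (\<lambda>i j. tile (z (cell v i j))) (i - int m - 1) j"
proof (rule ccontr)
  assume *: "\<not> ?thesis"
  show False
  proof (rule not_hstep_forever[of "cell v i j" "-1"])
    fix m :: nat
    show "tiling.hstep (Suc P) (\<lambda>k l. tile (z (cell (cell v i j) k l)))
        (- 1 * int m + (if - 1 = (1::int) then 0 else - 1)) 0"
      using * unfolding hstep_cell[OF v] by (simp add: algebra_simps)
  qed (use v in simp_all)
qed

lemma vstep_cell:
  assumes "v \<in> lattice d"
  shows "tiling.vstep (Suc P) (\<lambda>k l. tile (z (cell (cell v i j) k l))) a b \<longleftrightarrow>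
    tiling.vstep (Suc P) (\<lambda>k l. tile (z (cell v k l))) (i + a) (j + b)"
  using assms tiling.vstep_def[OF tiling_plane[OF assms]] tiling.vstep_def[OF tiling_plane[of "cell v i j"]]
  by (simp add: cell_cell add.assoc)

lemma not_down_forever:
  assumes v: "v \<in> lattice d"
  shows "\<exists>m::nat. \<not> tiling.vstep (Suc P) (\<lambda>i j. tile (z (cell v i j))) i (j - int m - 1)"
proof (rule ccontr)
  assume *: "\<not> ?thesis"
  show False
  proof (rule not_vstep_forever[of "cell v i j" "-1"])
    fix m :: nat
    show "tiling.vstep (Suc P) (\<lambda>k l. tile (z (cell (cell v i j) k l)))
        0 (- 1 * int m + (if - 1 = (1::int) then 0 else - 1))"
      using * unfolding vstep_cell[OF v] by (simp add: algebra_simps)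
  qed (use v in simp_all)
qed

lemma tile_imp_defect:
  assumes v: "v \<in> lattice d" and "tile (z v) \<noteq> None"
  shows "\<exists>u\<in>lattice d. defect (z u)"
proof -
  have "\<exists>i j. seed (tile (z (cell v i j)))"
    using tiling.tile_imp_seed[OF tiling_plane[OF v], of 0 0] not_left_forever[OF v]
      not_down_forever[OF v] assms by simp
  then obtain i j where "seed (tile (z (cell v i j)))" by blast
  then show ?thesis using cell_rule(6)[of "cell v i j"] v by auto
qed

text \<open>\<open>defects\<close> compares whole symbols, whereas \<open>defect\<close> compares
  layers only. Without a violation among the layers, rays have no target and tiles no seed, so the
  decoration is blank everywhere and cannot violate \<open>P\<close> either.\<close>

lemma ex_defect:
  assumes "defects d P z \<noteq> {}"
  shows "\<exists>v\<in>lattice d. defect (z v)"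
proof (rule ccontr)
  assume "\<not> ?thesis"
  then have *: "\<not> defect (z v)" if "v \<in> lattice d" for v using that by blast
  have blank: "rray (z v) = None" "lray (z v) = None" "uray (z v) = None" "tile (z v) = None"
    if "v \<in> lattice d" for v
    using rray_imp[OF that] lray_imp[OF that] uray_imp[OF that] tile_imp_defect[OF that] * that
    by (meson cell_in_lattice)+
  obtain v i where v: "v \<in> lattice d" "i < d" "z v \<noteq> z (vadd v (axisv d i (int P)))"
    using assms by (auto simp: defects_def)
  then have u: "vadd v (axisv d i (int P)) \<in> lattice d" by simp
  have "layer (z v) = layer (z (vadd v (axisv d i (int P))))"
    using cell_rule(1)[OF v(1)] *[OF v(1)] v(2) by blast
  then show False
    using v(3) blank[OF v(1)] blank[OF u] *[OF v(1)] *[OF u] by (auto intro: symb.expand)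
qed

lemma ex_maximum:
  fixes f :: "'b \<Rightarrow> int"
  assumes "finite S" and "S \<noteq> {}"
  obtains v where "v \<in> S" and "\<And>u. u \<in> S \<Longrightarrow> f u \<le> f v"
proof -
  have "Max (f ` S) \<in> f ` S" using assms by simp
  then obtain v where "v \<in> S" "f v = Max (f ` S)" by auto
  with assms(1) show thesis by (intro that[of v]) auto
qed

lemma cell_nth: "v \<in> lattice d \<Longrightarrow> cell v i j ! 0 = v ! 0 + i" "v \<in> lattice d \<Longrightarrow> cell v i j ! 1 = v ! 1 + j"
  using d by (simp_all add: cell_def vadd_nth[where d = d] plane_nth plane_nth(2)[simplified])

lemma halts:
  assumes "defects d P z \<noteq> {}" and input: "\<And>v. v \<in> lattice d \<Longrightarrow> input_rule d n (shift d v z)"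
  shows "run p (init n) \<noteq> {}"
proof -
  let ?D = "{v \<in> lattice d. defect (z v)}" and ?S = "{v \<in> lattice d. seed (tile (z v))}"
  have "?D \<subseteq> defects d P z"
  proof
    fix v assume v: "v \<in> ?D"
    then obtain i where "i < d" "layer (z v) \<noteq> layer (z (vadd v (axisv d i (int P))))"
      using cell_rule(1)[of v] by auto
    then show "v \<in> defects d P z" using v by (auto simp: defects_def)
  qed
  then have fin_D: "finite ?D" using finite_defects finite_subset by blast
  have "?S \<subseteq> ?D" using cell_rule(6) by auto
  then have fin_S: "finite ?S" using fin_D finite_subset by blast
  have "?D \<noteq> {}" using ex_defect[OF assms(1)] by auto
  \<comment> \<open>The maxima range over all parallel planes at once. Since rays stay in one plane,
    the cell found is also the last defect of its own plane and cannot be discharged by a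
    ray.\<close>
  then obtain u where u: "u \<in> ?D" and u_max: "\<And>v. v \<in> ?D \<Longrightarrow> v ! 1 \<le> u ! 1"
    using fin_D ex_maximum[of ?D "\<lambda>v. v ! 1"] by blast
  let ?E = "{v \<in> ?D. v ! 1 = u ! 1}"
  have "finite ?E" by (rule finite_subset[OF _ fin_D]) auto
  moreover have "?E \<noteq> {}" using u by auto
  ultimately obtain v where v: "v \<in> ?E" and v_max: "\<And>w. w \<in> ?E \<Longrightarrow> w ! 0 \<le> v ! 0"
    using ex_maximum[of ?E "\<lambda>v. v ! 0"] by blast
  from v have vl: "v \<in> lattice d" and vu: "v ! 1 = u ! 1" by auto
  have "rray (z v) = None"
  proof (rule ccontr)
    assume "rray (z v) \<noteq> None"
    then obtain i where "i > 0" "defect (z (cell v i 0))" using rray_imp[OF vl] by blast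
    then have "cell v i 0 \<in> ?E" using vl vu cell_nth(2)[OF vl, of i 0] by auto
    from v_max[OF this] \<open>i > 0\<close> show False using vl by (simp add: cell_nth)
  qed
  moreover have "uray (z v) = None"
  proof (rule ccontr)
    assume "uray (z v) \<noteq> None"
    then obtain i j where "j > 0" "defect (z (cell v i j))" using uray_imp[OF vl] by blast
    then have "cell v i j \<in> ?D" using vl by auto
    from u_max[OF this] \<open>j > 0\<close> vu show False using cell_nth(2)[OF vl, of i j] by simp
  qed
  ultimately have "seed (tile (z v))" using cell_rule(5)[OF vl] v by simp
  then have "?S \<noteq> {}" using vl by auto
  \<comment> \<open>This need not be the seed just found: \<open>seed_imp_halts\<close> asks for one
    with no further seed to its right, which a maximal first coordinate ensures.\<close>
  then obtain s where s: "s \<in> lattice d" "seed (tile (z s))"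
    and s_max: "\<And>v. v \<in> ?S \<Longrightarrow> v ! 0 \<le> s ! 0"
    using fin_S ex_maximum[of ?S "\<lambda>v. v ! 0"] by blast
  show ?thesis
  proof (rule tiling.seed_imp_halts[OF tiling_plane[OF s(1)]])
    show "seed (tile (z (cell s 0 0)))" using s by simp
    show "\<not> seed (tile (z (cell s i 0)))" if "i > 0" for i
    proof
      assume "seed (tile (z (cell s i 0)))"
      then have "cell s i 0 \<in> ?S" using s(1) by simp
      from s_max[OF this] that show False using s(1) by (simp add: cell_nth)
    qed
    show "input_ok (tile (z (cell s 0 0))) (tile (z (cell s (int (n + 1)) 0)))
        (tile (z (cell s (int (n + 2)) 0)))"
      using input[OF s(1)] s(1) unfolding input_rule_def shift_plane[OF s(1)]
      by (simp add: shift_apply)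
    show "\<exists>m::nat. \<not> tiling.hstep (Suc P) (\<lambda>i j. tile (z (cell s i j))) (i - int m - 1) j" for i j
      by (rule not_left_forever[OF s(1)])
    show "\<exists>m::nat. \<not> tiling.hstep (Suc P) (\<lambda>i j. tile (z (cell s i j))) (int m) 0"
      using not_hstep_forever[OF s(1), of 1] by auto
    show "\<exists>m::nat. \<not> tiling.vstep (Suc P) (\<lambda>i j. tile (z (cell s i j))) 0 (int m)"
      using not_vstep_forever[OF s(1), of 1] by auto
  qed
qed

end

section \<open>The embedding for a halting run\<close>

definition label_opts :: "nat \<Rightarrow> nat option set" where
  "label_opts k = insert None (Some ` {..<k})"

definition tiles :: "nat \<Rightarrow> prog \<Rightarrow> tile set" where
  "tiles k p = (\<lambda>(a, L, R, B, T, K, b). Tile a L R B T K b) `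
    ({..<k} \<times> UNIV \<times> UNIV \<times> UNIV \<times> UNIV \<times> conts p [] \<times> Pow (insert 0 (regs p)))"

definition alphabet :: "nat \<Rightarrow> prog \<Rightarrow> 'a set \<Rightarrow> 'a symb set" where
  "alphabet k p A = (\<lambda>(a, D, r, l, u, t). Symb a D r l u t) `
    (A \<times> UNIV \<times> label_opts k \<times> label_opts k \<times> label_opts k \<times> insert None (Some ` tiles k p))"

lemma finite_alphabet: "finite A \<Longrightarrow> finite (alphabet k p A)"
  unfolding alphabet_def tiles_def label_opts_def
  by (intro finite_imageI finite_cartesian_product finite.insertI finite_Pow_iff[THEN iffD2])
    (auto simp: finite_conts finite_regs)

text \<open>The label of the ray with successive cells \<open>h 1\<close>, \<open>h 2\<close>, ... that looks for a target \<open>T\<close>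
  within distance \<open>W\<close>.\<close>

definition ray_label ::
  "nat \<Rightarrow> nat \<Rightarrow> nat \<Rightarrow> ((vec \<Rightarrow> 'a) \<Rightarrow> bool) \<Rightarrow> (nat \<Rightarrow> vec) \<Rightarrow> (vec \<Rightarrow> 'a) \<Rightarrow> nat option" where
  "ray_label d k W T h y = (let J = {j \<in> {1..W}. T (shift d (h j) y)} in
    if J = {} then None else Some (Min J mod k))"

lemma ray_label_None:
  "ray_label d k W T h y = None \<longleftrightarrow> (\<forall>j. 0 < j \<longrightarrow> j \<le> W \<longrightarrow> \<not> T (shift d (h j) y))"
  by (auto simp: ray_label_def Let_def Suc_le_eq)

lemma ray_label_in: "k > 0 \<Longrightarrow> ray_label d k W T h y \<in> label_opts k"
  by (auto simp: ray_label_def Let_def label_opts_def)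

lemma finitary_ray_label:
  assumes "finitary d (configs d A) T" and "\<And>j. h j \<in> lattice d"
  shows "finitary d (configs d A) (ray_label d k W T h)"
proof -
  have "finitary d (configs d A) (\<lambda>y. T (shift d (h j) y))" for j
    by (rule finitary_shift[OF assms]) (rule shift_in_configs[OF _ assms(2)])
  then have "finitary d (configs d A) (\<lambda>y. {j \<in> {1..W}. T (shift d (h j) y)})"
    by (intro finitary_Collect) auto
  then show ?thesis
    unfolding ray_label_def Let_def
    by (rule finitary_comp[where F = "\<lambda>J. if J = {} then None else Some (Min J mod k)"])
qed

text \<open>One step along the ray brings the next target nearer by one. The window of the next cell
  reaches one cell further, but this cell lies beyond that target and does not affect the
  minimum.\<close>

lemma ray_ok_ray_label:
  assumes "\<And>j. shift d (h j) (shift d (h 1) y) = shift d (h (Suc j)) y"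
  shows "ray_ok k (T (shift d (h 1) y)) (ray_label d k W T h y) (ray_label d k W T h (shift d (h 1) y))"
proof (cases "T (shift d (h 1) y)")
  case False
  let ?J = "{j \<in> {1..W}. T (shift d (h j) y)}"
  let ?J' = "{j \<in> {1..W}. T (shift d (h (Suc j)) y)}"
  have "ray_ok k False (ray_label d k W T h y) (ray_label d k W T h (shift d (h 1) y))"
  proof (cases "?J = {}")
    case True
    then show ?thesis by (simp only: ray_label_def Let_def ray_ok_def) simp
  next
    case nonempty: False
    have "finite ?J" by simp
    then have Min: "Min ?J \<in> ?J" using nonempty by (rule Min_in)
    then have "Min ?J \<noteq> 1" using False by auto
    with Min obtain m where m: "Min ?J = Suc m" "m > 0" by (cases "Min ?J") auto
    with Min have "m \<in> ?J'" by auto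
    moreover have "m \<le> j" if "j \<in> ?J'" for j
    proof (cases "Suc j \<le> W")
      case True
      then have "Suc j \<in> ?J" using that by auto
      then have "Min ?J \<le> Suc j" using \<open>finite ?J\<close> by (intro Min_le)
      with m show ?thesis by simp
    qed (use Min m that in auto)
    ultimately have "Min ?J' = m" by (intro Min_eqI) auto
    then have "ray_label d k W T h (shift d (h 1) y) = Some (m mod k)"
      using \<open>m \<in> ?J'\<close> unfolding ray_label_def assms Let_def by auto
    moreover have "ray_label d k W T h y = Some (Suc m mod k)"
      using nonempty unfolding ray_label_def Let_def m(1)[symmetric] by simp
    ultimately show ?thesis by (simp add: ray_ok_def mod_Suc_eq)
  qed
  then show ?thesis using False by simp
qed (simp add: ray_ok_def)

section \<open>Drawing a halting run around isolated defects\<close>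

locale halting_run =
  fixes d P n T :: nat and p :: prog and K :: "nat \<Rightarrow> prog list" and s :: "nat \<Rightarrow> nat \<Rightarrow> nat"
  assumes d: "2 \<le> d" and P: "P > 0"
    and init: "K 0 = [p]" "s 0 = init n" and final: "K T = []"
    and step: "\<And>j. j < T \<Longrightarrow> cstep (K j, s j) (K (Suc j), s (Suc j))"
begin

text \<open>Register 0 starts at \<open>n + 2\<close> and \<open>T\<close> steps add at most
  \<open>T\<close>, so all values stay at most \<open>w\<close> while a row has \<open>Suc w\<close>
  tiles. Moreover \<open>T \<le> w\<close>, so \<open>w\<close> bounds the rectangle in both
  directions and can also serve as the length of the rays.\<close>

definition w :: nat where
  "w = n + 2 + T"

abbreviation R :: "nat set" where
  "R \<equiv> insert 0 (regs p)"

definition run_tile :: "nat \<Rightarrow> nat \<Rightarrow> tile" where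
  "run_tile i j = Tile ((i + j) mod Suc P) (i = 0) (i = w) (j = 0) (j = T) (K j) {x \<in> R. i < s j x}"

lemma K_nonempty: "j < T \<Longrightarrow> K j \<noteq> []"
  using step[of j] by (auto simp: cstep_def)

lemma K_regs: "j \<le> T \<Longrightarrow> \<Union>(regs ` set (K j)) \<subseteq> R"
proof (induction j)
  case (Suc j)
  then show ?case using cstep_regs(1)[OF step[of j], of R] by simp
qed (auto simp: init)

lemma K_conts: "j \<le> T \<Longrightarrow> K j \<in> conts p []"
proof (induction j)
  case (Suc j)
  then have "K (Suc j) \<in> lsucc (K j)" using step[of j] by (simp add: cstep_def)
  then show ?case using Suc lsucc_conts[of "K j" p "[]"] K_nonempty[of j] by auto
qed (simp add: init in_conts)

lemma s_bound: "j \<le> T \<Longrightarrow> s j x \<le> n + 2 + j"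
proof (induction j)
  case (Suc j)
  obtain q L where qL: "K j = q # L" using K_nonempty[of j] Suc.prems by (cases "K j") auto
  then have "s (Suc j) \<in> effect q (s j)" using step[of j] Suc.prems by (simp add: cstep_Cons)
  then have "s (Suc j) x \<le> Suc (s j x)" by (cases q) (auto split: if_splits)
  with Suc show ?case by simp
qed (simp add: init init_def)

lemma s_le_w: "j \<le> T \<Longrightarrow> s j x \<le> w"
  using s_bound[of j x] by (simp add: w_def)

lemma run_tile_in: "i \<le> w \<Longrightarrow> j \<le> T \<Longrightarrow> run_tile i j \<in> tiles (Suc P) p"
  unfolding tiles_def run_tile_def using K_conts[of j]
  by (intro image_eqI[of _ _ "((i + j) mod Suc P, i = 0, i = w, j = 0, j = T, K j, {x \<in> R. i < s j x})"]) auto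

text \<open>Nothing is assumed about neighbours beyond the border, which may belong to another
  rectangle. They are handed on to \<open>bits_ok\<close>, but ignored at the ends of a row.\<close>

lemma tile_ok_run_tile:
  assumes i: "i \<le> w" and j: "j \<le> T"
    and r: "i < w \<Longrightarrow> r = Some (run_tile (Suc i) j)" and l: "i > 0 \<Longrightarrow> l = Some (run_tile (i - 1) j)"
    and u: "j < T \<Longrightarrow> u = Some (run_tile i (Suc j))" and b: "j > 0 \<Longrightarrow> b = Some (run_tile i (j - 1))"
  shows "tile_ok (Suc P) p (Some (run_tile i j)) r l u b"
proof -
  have "up_ok (Suc P) (run_tile i j) r l (run_tile i (Suc j))" if jT: "j < T"
  proof -
    obtain q L where qL: "K j = q # L" using K_nonempty[OF jT] by (cases "K j") auto
    then have eff: "s (Suc j) \<in> effect q (s j)" and succ: "K (Suc j) \<in> lsucc (K j)"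
      using step[OF jT] by (simp_all add: cstep_Cons)
    have "regs q \<subseteq> R" using K_regs[OF j] qL by auto
    have "bits_ok q (i = 0) (i = w) (obits l) {x \<in> R. i < s j x} (obits r) {x \<in> R. i < s (Suc j) x}"
      by (rule bits_ok_complete[OF eff s_le_w[OF j] i \<open>regs q \<subseteq> R\<close>])
        (use l r in \<open>simp_all add: obits_def run_tile_def\<close>)
    then show ?thesis using succ qL by (simp add: up_ok_def run_tile_def mod_Suc_eq)
  qed
  moreover have "right_ok (Suc P) (run_tile i j) (run_tile (Suc i) j)"
    by (auto simp: right_ok_def run_tile_def mod_Suc_eq)
  ultimately show ?thesis
    using i j r l u b unfolding tile_ok_def
    by (auto simp: run_tile_def init final init_def split: if_splits)
qed

text \<open>Names ending in \<open>0\<close> denote the components of the block code, read at the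
  origin. They make sense for every configuration over the alphabet, not only for those in
  \<open>Y\<close>.\<close>

definition defect0 :: "(vec \<Rightarrow> 'a) \<Rightarrow> bool" where
  "defect0 y \<longleftrightarrow> (\<exists>i\<in>{..<d}. y (zerov d) \<noteq> y (axisv d i (int P)))"

definition rray0 :: "(vec \<Rightarrow> 'a) \<Rightarrow> nat option" where
  "rray0 = ray_label d (Suc P) w defect0 (\<lambda>j. plane d (int j) 0)"

definition lray0 :: "(vec \<Rightarrow> 'a) \<Rightarrow> nat option" where
  "lray0 = ray_label d (Suc P) w defect0 (\<lambda>j. plane d (- int j) 0)"

definition target0 :: "(vec \<Rightarrow> 'a) \<Rightarrow> bool" where
  "target0 y \<longleftrightarrow> defect0 y \<or> rray0 y \<noteq> None \<or> lray0 y \<noteq> None"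

definition uray0 :: "(vec \<Rightarrow> 'a) \<Rightarrow> nat option" where
  "uray0 = ray_label d (Suc P) w target0 (\<lambda>j. plane d 0 (int j))"

definition seed0 :: "(vec \<Rightarrow> 'a) \<Rightarrow> bool" where
  "seed0 y \<longleftrightarrow> defect0 y \<and> rray0 y = None \<and> uray0 y = None"

text \<open>The pair \<open>c\<close> is the position of the origin within a rectangle. The choice
  by \<open>SOME\<close> is harmless: by \<open>seed0_separated\<close> there is at most one
  candidate.\<close>

definition tile0 :: "(vec \<Rightarrow> 'a) \<Rightarrow> tile option" where
  "tile0 y = (let I = {c \<in> {..w} \<times> {..T}. seed0 (shift d (plane d (- int (fst c)) (- int (snd c))) y)} in
    if I = {} then None else Some (case (SOME c. c \<in> I) of (i, j) \<Rightarrow> run_tile i j))"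

definition symb0 :: "(vec \<Rightarrow> 'a) \<Rightarrow> 'a symb" where
  "symb0 y = Symb (y (zerov d)) (defect0 y) (rray0 y) (lray0 y) (uray0 y) (tile0 y)"

lemma finitary_defect0: "finitary d (configs d A) defect0"
  unfolding defect0_def
  by (intro finitary_Bex finitary_comp2[where F = "\<lambda>a b. a \<noteq> b"] finitary_apply) auto

lemma finitary_rays:
  "finitary d (configs d A) rray0" "finitary d (configs d A) lray0"
  "finitary d (configs d A) uray0"
proof -
  show 1: "finitary d (configs d A) rray0" "finitary d (configs d A) lray0"
    unfolding rray0_def lray0_def using d
    by (intro finitary_ray_label finitary_defect0 plane_in_lattice; simp)+
  have "finitary d (configs d A) (\<lambda>y. rray0 y \<noteq> None \<or> lray0 y \<noteq> None)"
    by (rule finitary_comp2[OF 1, where F = "\<lambda>a b. a \<noteq> None \<or> b \<noteq> None"])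
  then have "finitary d (configs d A) target0"
    unfolding target0_def by (rule finitary_comp2[OF finitary_defect0, where F = "(\<or>)"])
  then show "finitary d (configs d A) uray0"
    unfolding uray0_def using d by (intro finitary_ray_label plane_in_lattice)
qed

lemma finitary_tile0: "finitary d (configs d A) tile0"
proof -
  have "finitary d (configs d A) (\<lambda>y. rray0 y = None \<and> uray0 y = None)"
    by (rule finitary_comp2[OF finitary_rays(1,3), where F = "\<lambda>a b. a = None \<and> b = None"])
  then have "finitary d (configs d A) seed0"
    unfolding seed0_def by (rule finitary_comp2[OF finitary_defect0, where F = "(\<and>)"])
  then have "finitary d (configs d A)
      (\<lambda>y. {c \<in> {..w} \<times> {..T}. seed0 (shift d (plane d (- int (fst c)) (- int (snd c))) y)})"
    using d by (intro finitary_Collect finitary_shift) (auto intro: shift_in_configs)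
  then show ?thesis
    unfolding tile0_def Let_def
    by (rule finitary_comp[where F = "\<lambda>I. if I = {} then None
        else Some (case (SOME c. c \<in> I) of (i, j) \<Rightarrow> run_tile i j)"])
qed

lemma finitary_symb0: "finitary d (configs d A) symb0"
proof -
  have 1: "finitary d (configs d A) (\<lambda>y. Symb (y (zerov d)) (defect0 y))"
    by (rule finitary_comp2[OF finitary_apply finitary_defect0, where F = Symb]) simp
  have 2: "finitary d (configs d A) (\<lambda>y. Symb (y (zerov d)) (defect0 y) (rray0 y))"
    by (rule finitary_comp2[OF 1 finitary_rays(1), where F = "\<lambda>f. f"])
  have 3: "finitary d (configs d A) (\<lambda>y. Symb (y (zerov d)) (defect0 y) (rray0 y) (lray0 y))"
    by (rule finitary_comp2[OF 2 finitary_rays(2), where F = "\<lambda>f. f"])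
  have 4: "finitary d (configs d A) (\<lambda>y. Symb (y (zerov d)) (defect0 y) (rray0 y) (lray0 y) (uray0 y))"
    by (rule finitary_comp2[OF 3 finitary_rays(3), where F = "\<lambda>f. f"])
  show ?thesis
    unfolding symb0_def by (rule finitary_comp2[OF 4 finitary_tile0, where F = "\<lambda>f. f"])
qed

lemma shift_planes: "shift d (plane d a b) (shift d (plane d a' b') y) = shift d (plane d (a + a') (b + b')) y"
  using d by (simp add: shift_shift vadd_plane)

text \<open>A seed is the last defect in a window, hence two seeds in the same plane are far apart.\<close>

lemma seed0_imp_not_before:
  assumes "seed0 y" and "seed0 (shift d (plane d a b) y)"
    and "b > 0 \<or> b = 0 \<and> a > 0"
  shows "\<bar>a\<bar> > int w \<or> \<bar>b\<bar> > int w"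
proof (rule ccontr)
  assume "\<not> ?thesis"
  then have w: "\<bar>a\<bar> \<le> int w" "\<bar>b\<bar> \<le> int w" by auto
  have D: "defect0 (shift d (plane d a b) y)" using assms(2) by (simp add: seed0_def)
  from assms(3) show False
  proof
    assume b: "b > 0"
    \<comment> \<open>Straight above the first seed, at height \<open>b\<close>, the second one is
      at horizontal distance at most \<open>w\<close>. So that cell is a defect or starts a
      horizontal ray, and it lies within reach of \<open>uray0\<close>.\<close>
    have "target0 (shift d (plane d 0 b) y)"
    proof (cases a "0 :: int" rule: linorder_cases)
      case equal
      with D show ?thesis by (simp add: target0_def)
    next
      case greater
      then have "rray0 (shift d (plane d 0 b) y) \<noteq> None"
        unfolding rray0_def ray_label_None using D w
        by (auto simp: shift_planes intro!: exI[of _ "nat a"])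
      then show ?thesis by (simp add: target0_def)
    next
      case less
      then have "lray0 (shift d (plane d 0 b) y) \<noteq> None"
        unfolding lray0_def ray_label_None using D w
        by (auto simp: shift_planes intro!: exI[of _ "nat (- a)"])
      then show ?thesis by (simp add: target0_def)
    qed
    then have "uray0 y \<noteq> None"
      unfolding uray0_def ray_label_None using b w by (auto intro!: exI[of _ "nat b"])
    with assms(1) show False by (simp add: seed0_def)
  next
    assume "b = 0 \<and> a > 0"
    then have "rray0 y \<noteq> None"
      unfolding rray0_def ray_label_None using D w by (auto intro!: exI[of _ "nat a"])
    with assms(1) show False by (simp add: seed0_def)
  qed
qed

text \<open>One of two distinct positions comes later; if it is the first one, shifting back
  exchanges the roles.\<close>

lemma seed0_separated:
  assumes y: "y \<in> configs d A" and "seed0 y" and "seed0 (shift d (plane d a b) y)"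
    and "\<bar>a\<bar> \<le> int w" and "\<bar>b\<bar> \<le> int w"
  shows "a = 0 \<and> b = 0"
proof (rule ccontr)
  assume "\<not> ?thesis"
  then consider "b > 0 \<or> b = 0 \<and> a > 0" | "- b > 0 \<or> - b = 0 \<and> - a > 0" by linarith
  then show False
  proof cases
    case 1
    then show False using seed0_imp_not_before[OF assms(2,3)] assms(4,5) by linarith
  next
    case 2
    have "shift d (plane d (- a) (- b)) (shift d (plane d a b) y) = y"
      using y d by (simp add: shift_planes plane_0 shift_zerov)
    then show False
      using seed0_imp_not_before[OF assms(3), of "- a" "- b"] 2 assms(2,4,5) by simp
  qed
qed

text \<open>The corners of two rectangles through the same cell differ by at most \<open>w\<close>
  horizontally and by at most \<open>T\<close>, hence at most \<open>w\<close>, vertically. Being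
  seeds, they coincide.\<close>

lemma tile0_eq:
  assumes y: "y \<in> configs d A" and "seed0 y" and "i \<le> w" and "j \<le> T"
  shows "tile0 (shift d (plane d (int i) (int j)) y) = Some (run_tile i j)"
proof -
  let ?y = "shift d (plane d (int i) (int j)) y"
  let ?I = "{c \<in> {..w} \<times> {..T}. seed0 (shift d (plane d (- int (fst c)) (- int (snd c))) ?y)}"
  have "?I = {(i, j)}"
  proof
    show "{(i, j)} \<subseteq> ?I"
      using assms d by (simp add: shift_planes plane_0 shift_zerov)
    show "?I \<subseteq> {(i, j)}"
    proof
      fix c assume c: "c \<in> ?I"
      obtain k l where kl: "c = (k, l)" by fastforce
      have "T \<le> w" by (simp add: w_def)
      with c kl have "k \<le> w" "l \<le> w" "seed0 (shift d (plane d (int i - int k) (int j - int l)) y)"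
        by (auto simp: shift_planes)
      from seed0_separated[OF y assms(2) this(3)] this(1,2) assms(3,4) \<open>T \<le> w\<close>
      have "int i - int k = 0 \<and> int j - int l = 0" by linarith
      with kl show "c \<in> {(i, j)}" by simp
    qed
  qed
  then show ?thesis unfolding tile0_def by (simp only: Let_def) simp
qed

lemma tile0_cases:
  assumes y: "y \<in> configs d A" and "tile0 y = Some t"
  obtains i j y0 where "i \<le> w" and "j \<le> T" and "t = run_tile i j" and "y0 \<in> configs d A" and "seed0 y0"
    and "y = shift d (plane d (int i) (int j)) y0"
proof -
  let ?I = "{c \<in> {..w} \<times> {..T}. seed0 (shift d (plane d (- int (fst c)) (- int (snd c))) y)}"
  have "?I \<noteq> {}" using assms(2) unfolding tile0_def by (auto simp: Let_def split: if_splits)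
  then obtain i j where ij: "i \<le> w" "j \<le> T" "seed0 (shift d (plane d (- int i) (- int j)) y)"
    by auto
  let ?y0 = "shift d (plane d (- int i) (- int j)) y"
  have y0: "?y0 \<in> configs d A" using y d by (simp add: shift_in_configs)
  have eq: "y = shift d (plane d (int i) (int j)) ?y0"
    using y d by (simp add: shift_planes plane_0 shift_zerov)
  then have "t = run_tile i j" using tile0_eq[OF y0 ij(3,1,2)] assms(2) by simp
  from that[OF ij(1,2) this y0 ij(3) eq] show thesis .
qed

lemma seed_tile0_iff:
  assumes y: "y \<in> configs d A"
  shows "seed (tile0 y) \<longleftrightarrow> seed0 y"
proof
  assume "seed (tile0 y)"
  then obtain t where t: "tile0 y = Some t" "leftmost t" "bottom t" by (auto simp: seed_def)
  from tile0_cases[OF y t(1)] obtain i j y0 where *: "t = run_tile i j" "y0 \<in> configs d A" "seed0 y0"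
    "y = shift d (plane d (int i) (int j)) y0" by metis
  with t(2,3) have "i = 0" "j = 0" by (auto simp: run_tile_def)
  with * show "seed0 y" using d by (simp add: plane_0 shift_zerov)
next
  assume "seed0 y"
  from tile0_eq[OF y this, of 0 0] have "tile0 y = Some (run_tile 0 0)"
    using y d by (simp add: plane_0 shift_zerov)
  then show "seed (tile0 y)" by (simp add: seed_def run_tile_def)
qed

lemma tile_ok_tile0:
  assumes y: "y \<in> configs d A"
  shows "tile_ok (Suc P) p (tile0 y) (tile0 (shift d (plane d 1 0) y)) (tile0 (shift d (plane d (-1) 0) y))
    (tile0 (shift d (plane d 0 1) y)) (tile0 (shift d (plane d 0 (-1)) y))"
proof (cases "tile0 y")
  case None
  then show ?thesis by (simp add: tile_ok_def)
next
  case (Some t)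
  from tile0_cases[OF y Some] obtain i j y0 where ij: "i \<le> w" "j \<le> T" and t: "t = run_tile i j"
    and y0: "y0 \<in> configs d A" "seed0 y0" and eq: "y = shift d (plane d (int i) (int j)) y0" by metis
  show ?thesis
    unfolding Some t
  proof (rule tile_ok_run_tile[OF ij])
    show "tile0 (shift d (plane d 1 0) y) = Some (run_tile (Suc i) j)" if "i < w"
      using tile0_eq[OF y0, of "Suc i" j] that ij by (simp add: eq shift_planes add.commute)
    show "tile0 (shift d (plane d (- 1) 0) y) = Some (run_tile (i - 1) j)" if "i > 0"
      using tile0_eq[OF y0, of "i - 1" j] that ij by (simp add: eq shift_planes of_nat_diff)
    show "tile0 (shift d (plane d 0 1) y) = Some (run_tile i (Suc j))" if "j < T"
      using tile0_eq[OF y0, of i "Suc j"] that ij by (simp add: eq shift_planes add.commute)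
    show "tile0 (shift d (plane d 0 (- 1)) y) = Some (run_tile i (j - 1))" if "j > 0"
      using tile0_eq[OF y0, of i "j - 1"] that ij by (simp add: eq shift_planes of_nat_diff)
  qed
qed

lemma block_map_symb0: "v \<in> lattice d \<Longrightarrow> block_map d symb0 y v = symb0 (shift d v y)"
  by (simp add: block_map_def)

lemma local_rule_symb0:
  assumes y: "y \<in> configs d A"
  shows "local_rule d P p (block_map d symb0 y)"
proof -
  have z: "block_map d symb0 y (zerov d) = symb0 y"
    using y by (simp add: block_map_symb0 shift_zerov)
  have pl: "block_map d symb0 y (plane d i j) = symb0 (shift d (plane d i j) y)" for i j
    using d by (simp add: block_map_symb0)
  have ax: "layer (block_map d symb0 y (axisv d i (int P))) = y (axisv d i (int P))" for i
    by (simp add: block_map_symb0 symb0_def shift_apply)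
  have r: "ray_ok (Suc P) (defect0 (shift d (plane d 1 0) y)) (rray0 y) (rray0 (shift d (plane d 1 0) y))"
    using ray_ok_ray_label[of d "\<lambda>j. plane d (int j) 0" y] unfolding rray0_def
    by (simp add: shift_planes add.commute)
  have l: "ray_ok (Suc P) (defect0 (shift d (plane d (-1) 0) y)) (lray0 y) (lray0 (shift d (plane d (-1) 0) y))"
  proof -
    have "shift d (plane d (- int j) 0) (shift d (plane d (- int 1) 0) y) =
        shift d (plane d (- int (Suc j)) 0) y" for j
    proof -
      have "- int j + - int 1 = - int (Suc j)" by simp
      then show ?thesis by (simp only: shift_planes add_0)
    qed
    from ray_ok_ray_label[of d "\<lambda>j. plane d (- int j) 0" y, OF this] show ?thesis
      unfolding lray0_def by simp
  qed
  have u: "ray_ok (Suc P) (target0 (shift d (plane d 0 1) y)) (uray0 y) (uray0 (shift d (plane d 0 1) y))"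
    using ray_ok_ray_label[of d "\<lambda>j. plane d 0 (int j)" y] unfolding uray0_def
    by (simp add: shift_planes add.commute)
  show ?thesis
    unfolding local_rule_def z pl ax
  proof (intro conjI)
    show "defect (symb0 y) \<longleftrightarrow> (\<exists>i<d. layer (symb0 y) \<noteq> y (axisv d i (int P)))"
      by (auto simp: symb0_def defect0_def)
    show "defect (symb0 y) \<longrightarrow> rray (symb0 y) \<noteq> None \<or> uray (symb0 y) \<noteq> None \<or> seed (tile (symb0 y))"
      using seed_tile0_iff[OF y] by (auto simp: symb0_def seed0_def)
    show "seed (tile (symb0 y)) \<longrightarrow> defect (symb0 y)"
      using seed_tile0_iff[OF y] by (auto simp: symb0_def seed0_def)
  qed (use r l u tile_ok_tile0[OF y] in \<open>simp_all add: symb0_def uray_target_def target0_def\<close>)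
qed

lemma input_rule_symb0:
  assumes y: "y \<in> configs d A"
  shows "input_rule d n (block_map d symb0 y)"
proof -
  have z: "block_map d symb0 y (zerov d) = symb0 y"
    using y by (simp add: block_map_symb0 shift_zerov)
  have pl: "block_map d symb0 y (plane d i j) = symb0 (shift d (plane d i j) y)" for i j
    using d by (simp add: block_map_symb0)
  have "input_ok (tile0 y) (tile0 (shift d (plane d (int (n + 1)) 0) y))
      (tile0 (shift d (plane d (int (n + 2)) 0) y))"
    unfolding input_ok_def
  proof
    assume "seed (tile0 y)"
    then have "seed0 y" using seed_tile0_iff[OF y] by simp
    from tile0_eq[OF y this, of _ 0] have
      *: "tile0 (shift d (plane d (int i) 0) y) = Some (run_tile i 0)" if "i \<le> w" for i
      using that by simp
    have le: "n + 1 \<le> w" "n + 2 \<le> w" by (simp_all add: w_def)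
    have "tile0 (shift d (plane d (int (n + 1)) 0) y) = Some (run_tile (n + 1) 0)"
      "tile0 (shift d (plane d (int (n + 2)) 0) y) = Some (run_tile (n + 2) 0)"
      by (rule *[OF le(1)], rule *[OF le(2)])
    then show "\<exists>t1 t2. tile0 (shift d (plane d (int (n + 1)) 0) y) = Some t1 \<and> 0 \<in> bits t1 \<and>
        tile0 (shift d (plane d (int (n + 2)) 0) y) = Some t2 \<and> bottom t2 \<and> \<not> leftmost t2 \<and> 0 \<notin> bits t2"
      by (auto simp: run_tile_def init init_def)
  qed
  then show ?thesis unfolding input_rule_def z pl by (simp add: symb0_def)
qed

lemma symb0_in_alphabet:
  assumes y: "y \<in> configs d A"
  shows "symb0 y \<in> alphabet (Suc P) p A"
proof -
  have "y (zerov d) \<in> A" using y by (auto simp: configs_def)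
  moreover have "rray0 y \<in> label_opts (Suc P)" "lray0 y \<in> label_opts (Suc P)"
    "uray0 y \<in> label_opts (Suc P)"
    by (simp_all add: rray0_def lray0_def uray0_def ray_label_in)
  moreover have "tile0 y \<in> insert None (Some ` tiles (Suc P) p)"
  proof (cases "tile0 y")
    case (Some t)
    from tile0_cases[OF y this] obtain i j where "i \<le> w" "j \<le> T" "t = run_tile i j" by metis
    with Some show ?thesis using run_tile_in by simp
  qed simp
  ultimately show ?thesis
    unfolding alphabet_def
    by (intro image_eqI[of _ _ "(y (zerov d), defect0 y, rray0 y, lray0 y, uray0 y, tile0 y)"])
      (simp_all add: symb0_def)
qed

lemma inj_on_block_map_symb0: "inj_on (block_map d symb0) (configs d A)"
proof (rule inj_onI)
  fix x y assume x: "x \<in> configs d A" and y: "y \<in> configs d A"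
    and eq: "block_map d symb0 x = block_map d symb0 y"
  show "x = y"
  proof
    fix v show "x v = y v"
    proof (cases "v \<in> lattice d")
      case True
      then have "layer (block_map d symb0 u v) = u v" for u
        by (simp add: block_map_symb0 symb0_def shift_apply)
      then show ?thesis using eq by metis
    next
      case False
      then show ?thesis using x y by (auto simp: configs_def PiE_def extensional_def)
    qed
  qed
qed

end

lemma halting_runE:
  assumes "2 \<le> d" and "P > 0" and "run p (init n) \<noteq> {}"
  obtains T K s where "halting_run d P n T p K s"
proof -
  obtain s' where "cstep\<^sup>*\<^sup>* ([p], init n) ([], s')"
    using assms(3) by (auto simp: run_iff_csteps)
  then obtain T where "(cstep ^^ T) ([p], init n) ([], s')"
    using rtranclp_imp_relpowp by metis
  then obtain f where "f 0 = ([p], init n)" "f T = ([], s')" "\<forall>i<T. cstep (f i) (f (Suc i))"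
    unfolding relpowp_fun_conv by blast
  then have "halting_run d P n T p (fst \<circ> f) (snd \<circ> f)"
    using assms(1,2) by unfold_locales auto
  then show thesis by (rule that)
qed

section \<open>The reduction\<close>

definition window :: "nat \<Rightarrow> nat \<Rightarrow> vec set" where
  "window d P = {zerov d, plane d 1 0, plane d (-1) 0, plane d 0 1, plane d 0 (-1)} \<union>
    (\<lambda>i. axisv d i (int P)) ` {..<d}"

lemma local_rule_cong:
  assumes "\<forall>u\<in>window d P. z u = z' u"
  shows "local_rule d P p z = local_rule d P p z'"
proof -
  have "z (axisv d i (int P)) = z' (axisv d i (int P))" if "i < d" for i
    using assms that by (simp add: window_def)
  moreover have "z (zerov d) = z' (zerov d)" "z (plane d 1 0) = z' (plane d 1 0)"
    "z (plane d (-1) 0) = z' (plane d (-1) 0)" "z (plane d 0 1) = z' (plane d 0 1)"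
    "z (plane d 0 (-1)) = z' (plane d 0 (-1))"
    using assms by (simp_all add: window_def)
  ultimately show ?thesis
    unfolding local_rule_def by (simp cong: conj_cong)
qed

lemma window_lattice: "2 \<le> d \<Longrightarrow> window d P \<subseteq> lattice d"
  by (auto simp: window_def)

lemma finitary_local_rule:
  fixes dec :: "'c \<Rightarrow> 'b symb"
  assumes "2 \<le> d"
  shows "finitary d S (\<lambda>x. local_rule d P p (\<lambda>v. dec (x v)))"
proof (rule finitaryI[of "window d P"])
  fix x y :: "vec \<Rightarrow> 'c" assume "\<forall>v\<in>window d P. x v = y v"
  then show "local_rule d P p (\<lambda>v. dec (x v)) = local_rule d P p (\<lambda>v. dec (y v))"
    by (intro local_rule_cong) simp
qed (use assms in \<open>simp_all add: window_lattice\<close>, simp add: window_def)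

text \<open>These patterns are written down explicitly, since mere existence as in
  \<open>finitary_patterns\<close> would not make them computable from \<open>n\<close>.\<close>

definition input_pattern :: "nat \<Rightarrow> nat \<Rightarrow> nat \<times> nat \<times> nat \<Rightarrow> (vec \<times> nat) list" where
  "input_pattern d n t = zip [zerov d, plane d (int (n + 1)) 0, plane d (int (n + 2)) 0]
    [fst t, fst (snd t), snd (snd t)]"

text \<open>On nonnegative integers \<open>int_encode\<close> is doubling.\<close>

lemma computable_int_encode: "computable f \<Longrightarrow> computable (\<lambda>n. int_encode (int (f n)))"
  using computable_add[of f f] by (simp add: int_encode_def sum_encode_def mult_2)

lemma computable_encode_cell_plane:
  assumes "computable f"
  shows "computable (\<lambda>n. encode_cell (plane d (int (f n)) 0, a))"
proof -
  have "computable (\<lambda>n. list_encode (int_encode (int (f n)) # map int_encode (0 # replicate (d - 2) 0)))"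
    unfolding list_encode.simps
    by (intro computable_Suc computable_prod_encode computable_int_encode assms computable_const)
  then show ?thesis
    unfolding encode_cell_def fst_conv snd_conv plane_def list.map(2)
    by (intro computable_prod_encode computable_const)
qed

lemma computable_input_pattern: "computable (\<lambda>n. encode_pattern (input_pattern d n t))"
  unfolding encode_pattern_def input_pattern_def zip_Cons_Cons zip_Nil list.map list_encode.simps
  by (intro computable_Suc computable_prod_encode computable_const computable_encode_cell_plane
      computable_add computable_id)

text \<open>The list \<open>ts\<close> is the same for all \<open>n\<close>: whether a triple of
  symbols is bad does not depend on the distances between the cells that carry it.\<close>

lemma input_rule_patterns:
  fixes k :: nat
  assumes "2 \<le> d"
  obtains ts where "\<And>n p. p \<in> input_pattern d n ` set ts \<Longrightarrow>
      distinct (map fst p) \<and> (\<forall>(v, a)\<in>set p. v \<in> lattice d \<and> a < k)"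
    and "\<And>n x. x \<in> configs d {..<k} \<Longrightarrow> (\<forall>p\<in>input_pattern d n ` set ts. \<not> appears d (map_of p) x) \<longleftrightarrow>
      (\<forall>u\<in>lattice d. input_rule d n (\<lambda>v. dec (shift d u x v)))"
proof -
  let ?B = "{t \<in> {..<k} \<times> {..<k} \<times> {..<k}.
    \<not> input_ok (tile (dec (fst t))) (tile (dec (fst (snd t)))) (tile (dec (snd (snd t))))}"
  have "finite ?B" by (rule finite_subset[of _ "{..<k} \<times> {..<k} \<times> {..<k}"]) auto
  then obtain ts where ts: "set ts = ?B" using finite_list by blast
  have dist: "distinct [zerov d, plane d (int (n + 1)) 0, plane d (int (n + 2)) 0]" for n
    using assms by (simp add: plane_0[symmetric]) (simp add: plane_def)
  show thesis
  proof (rule that)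
    fix n p assume "p \<in> input_pattern d n ` set ts"
    then obtain a b c where "p = input_pattern d n (a, b, c)" "a < k" "b < k" "c < k"
      unfolding ts by auto
    then show "distinct (map fst p) \<and> (\<forall>(v, a)\<in>set p. v \<in> lattice d \<and> a < k)"
      using assms dist[of n] by (simp add: input_pattern_def)
  next
    fix n and x :: "vec \<Rightarrow> nat" assume x: "x \<in> configs d {..<k}"
    let ?ok = "\<lambda>u. input_rule d n (\<lambda>v. dec (shift d u x v))"
    let ?ws = "[zerov d, plane d (int (n + 1)) 0, plane d (int (n + 2)) 0]"
    have 1: "(\<exists>t\<in>?B. map (shift d u x) ?ws = [fst t, fst (snd t), snd (snd t)]) \<longleftrightarrow> \<not> ?ok u"
      if "u \<in> lattice d" for u
    proof
      assume "\<exists>t\<in>?B. map (shift d u x) ?ws = [fst t, fst (snd t), snd (snd t)]"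
      then show "\<not> ?ok u" by (auto simp: input_rule_def)
    next
      assume *: "\<not> ?ok u"
      let ?t = "(shift d u x (zerov d), shift d u x (plane d (int (n + 1)) 0),
        shift d u x (plane d (int (n + 2)) 0))"
      have "shift d u x v < k" if "v \<in> lattice d" for v
        using shift_in_configs[OF x \<open>u \<in> lattice d\<close>] that by (auto simp: configs_def)
      then have "?t \<in> ?B" using * assms by (simp add: input_rule_def)
      then show "\<exists>t\<in>?B. map (shift d u x) ?ws = [fst t, fst (snd t), snd (snd t)]"
        by (rule bexI[rotated]) simp
    qed
    have 2: "appears d (map_of (input_pattern d n t)) x \<longleftrightarrow>
        (\<exists>u\<in>lattice d. map (shift d u x) ?ws = [fst t, fst (snd t), snd (snd t)])" for t
      unfolding input_pattern_def by (rule appears_zip[OF dist]) simp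
    have swap: "(\<exists>t\<in>B. \<exists>u\<in>L. G t u) \<longleftrightarrow> (\<exists>u\<in>L. \<exists>t\<in>B. G t u)"
      for B :: "(nat \<times> nat \<times> nat) set" and L :: "vec set" and G
      by blast
    have "(\<exists>p\<in>input_pattern d n ` set ts. appears d (map_of p) x) \<longleftrightarrow>
        (\<exists>t\<in>?B. appears d (map_of (input_pattern d n t)) x)"
      unfolding ts by blast
    also have "\<dots> \<longleftrightarrow>
        (\<exists>u\<in>lattice d. \<exists>t\<in>?B. map (shift d u x) ?ws = [fst t, fst (snd t), snd (snd t)])"
      unfolding 2 by (rule swap)
    also have "\<dots> \<longleftrightarrow> (\<exists>u\<in>lattice d. \<not> ?ok u)"
      by (rule bex_cong[OF refl 1])
    finally show "(\<forall>p\<in>input_pattern d n ` set ts. \<not> appears d (map_of p) x) \<longleftrightarrow>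
        (\<forall>u\<in>lattice d. ?ok u)"
      by blast
  qed
qed

lemma exists_presentation:
  fixes dec :: "nat \<Rightarrow> 'a symb" and k :: nat
  assumes "2 \<le> d"
  obtains Q where "computable (\<lambda>n. encode_presentation (Q n))" and "\<And>n. valid_presentation d (Q n)"
    and "\<And>n. presented_alphabet (Q n) = {..<k}"
    and "\<And>n x. x \<in> presented_sft d (Q n) \<longleftrightarrow> x \<in> configs d {..<k} \<and>
      (\<forall>u\<in>lattice d. local_rule d P p (\<lambda>v. dec (shift d u x v)) \<and>
        input_rule d n (\<lambda>v. dec (shift d u x v)))"
proof -
  obtain ps where ps: "\<And>p. p \<in> set ps \<Longrightarrow> distinct (map fst p) \<and> (\<forall>(v, a)\<in>set p. v \<in> lattice d \<and> a < k)"
    "\<And>x. x \<in> configs d {..<k} \<Longrightarrow> (\<forall>q\<in>set ps. \<not> appears d (map_of q) x) \<longleftrightarrow>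
      (\<forall>u\<in>lattice d. local_rule d P p (\<lambda>v. dec (shift d u x v)))"
    using finitary_patterns[OF finitary_local_rule[OF assms, of "configs d {..<k}" P p dec]] by blast
  obtain ts where ts: "\<And>n p. p \<in> input_pattern d n ` set ts \<Longrightarrow>
      distinct (map fst p) \<and> (\<forall>(v, a)\<in>set p. v \<in> lattice d \<and> a < k)"
    "\<And>n x. x \<in> configs d {..<k} \<Longrightarrow> (\<forall>q\<in>input_pattern d n ` set ts. \<not> appears d (map_of q) x) \<longleftrightarrow>
      (\<forall>u\<in>lattice d. input_rule d n (\<lambda>v. dec (shift d u x v)))"
    using input_rule_patterns[OF assms, of k dec] by blast
  define Q where "Q n = (k, map (input_pattern d n) ts @ ps)" for n
  have "computable (\<lambda>n. encode_presentation (Q n))"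
    unfolding encode_presentation_def Q_def fst_conv snd_conv map_append map_map comp_def
    by (intro computable_prod_encode computable_const computable_list_encode_append
        computable_input_pattern)
  moreover have "valid_presentation d (Q n)" for n
  proof -
    have "\<forall>p\<in>input_pattern d n ` set ts \<union> set ps.
        distinct (map fst p) \<and> (\<forall>(v, a)\<in>set p. v \<in> lattice d \<and> a < k)"
      using ps(1) ts(1)[of _ n] by blast
    then show ?thesis
      by (simp only: valid_presentation_def Q_def fst_conv snd_conv set_append set_map)
  qed
  moreover have "presented_alphabet (Q n) = {..<k}" for n
    by (simp add: presented_alphabet_def Q_def)
  moreover have "x \<in> presented_sft d (Q n) \<longleftrightarrow> x \<in> configs d {..<k} \<and>
      (\<forall>u\<in>lattice d. local_rule d P p (\<lambda>v. dec (shift d u x v)) \<and>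
        input_rule d n (\<lambda>v. dec (shift d u x v)))" for n x
    using ps(2)[of x] ts(2)[of x n]
    by (auto simp: presented_sft_def sft_def presented_alphabet_def Q_def ball_Un)
  ultimately show thesis by (rule that)
qed

lemma halts_imp_embeds:
  assumes "2 \<le> d" and "P > 0" and Y: "Y \<subseteq> configs d A"
    and bij: "bij_betw enc (alphabet (Suc P) p A) {..<k}"
    and dec: "\<And>a. a \<in> alphabet (Suc P) p A \<Longrightarrow> dec (enc a) = a"
    and X: "\<And>x. x \<in> X \<longleftrightarrow> x \<in> configs d {..<k} \<and>
      (\<forall>u\<in>lattice d. local_rule d P p (\<lambda>v. dec (shift d u x v)) \<and>
        input_rule d n (\<lambda>v. dec (shift d u x v)))"
    and "run p (init n) \<noteq> {}"
  shows "embeds d A Y {..<k} X"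
proof -
  obtain T K s where "halting_run d P n T p K s"
    using halting_runE[OF assms(1,2,7)] .
  then interpret halting_run d P n T p K s .
  define f where "f = block_map d (\<lambda>y. enc (symb0 y))"
  have in_k: "enc (symb0 y) \<in> {..<k}" if "y \<in> configs d A" for y
    using symb0_in_alphabet[OF that] bij_betw_imp_surj_on[OF bij] by blast
  have f_config: "f y \<in> configs d {..<k}" if "y \<in> configs d A" for y
    using in_k[OF shift_in_configs[OF that]] by (auto simp: f_def block_map_def configs_def)
  have dec_f: "dec (f y v) = block_map d symb0 y v" if "y \<in> configs d A" "v \<in> lattice d" for y v
    using dec[OF symb0_in_alphabet[OF shift_in_configs[OF that]]] that(2)
    by (simp add: f_def block_map_def)
  have f_shift: "shift d u (f y) = f (shift d u y)" if "u \<in> lattice d" for u y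
    unfolding f_def by (rule shift_block_map[OF that])
  have "f y \<in> X" if y: "y \<in> configs d A" for y
    unfolding X
  proof (intro conjI ballI)
    show "f y \<in> configs d {..<k}" using f_config y .
    fix u assume u: "u \<in> lattice d"
    let ?y = "shift d u y"
    have y': "?y \<in> configs d A" using y u by (rule shift_in_configs)
    have eq: "dec (shift d u (f y) v) = block_map d symb0 ?y v" if "v \<in> lattice d" for v
      unfolding f_shift[OF u] using dec_f[OF y' that] .
    \<comment> \<open>A congruence is needed because the two configurations agree on the lattice
      only; outside of it their default values may differ.\<close>
    have "local_rule d P p (\<lambda>v. dec (shift d u (f y) v)) = local_rule d P p (block_map d symb0 ?y)"
      by (rule local_rule_cong) (use eq window_lattice[OF d] in blast)
    then show "local_rule d P p (\<lambda>v. dec (shift d u (f y) v))"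
      using local_rule_symb0[OF y'] by simp
    show "input_rule d n (\<lambda>v. dec (shift d u (f y) v))"
      using input_rule_symb0[OF y'] d eq by (simp add: input_rule_def del: of_nat_add)
  qed
  moreover have "continuous_map (config_top d A) (config_top d {..<k}) f"
    unfolding f_def by (rule block_map_continuous) (rule finitary_comp[OF finitary_symb0], rule in_k)
  ultimately have "continuous_map (subtopology (config_top d A) Y) (subtopology (config_top d {..<k}) X) f"
    using Y by (auto simp: continuous_map_in_subtopology continuous_map_from_subtopology)
  moreover have "inj_on f Y"
  proof (rule inj_onI)
    fix x y assume xy: "x \<in> Y" "y \<in> Y" "f x = f y"
    then have "x \<in> configs d A" "y \<in> configs d A" using Y by auto
    then have "block_map d symb0 x v = block_map d symb0 y v" for v
      using dec_f[of x v] dec_f[of y v] xy(3)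
      by (cases "v \<in> lattice d") (simp_all add: block_map_def)
    then have "block_map d symb0 x = block_map d symb0 y" by blast
    then show "x = y" using inj_onD[OF inj_on_block_map_symb0] xy Y by blast
  qed
  ultimately show ?thesis
    unfolding embeds_def using f_shift by (intro exI[of _ f]) auto
qed

lemma embeds_imp_halts:
  assumes "2 \<le> d" and "P > 0" and "subshift d A Y"
    and y: "y \<in> Y" "\<not> strongly_periodic d y" "finite (defects d P y)"
    and dec: "inj_on dec {..<k}"
    and X: "\<And>x. x \<in> X \<longleftrightarrow> x \<in> configs d {..<k} \<and>
      (\<forall>u\<in>lattice d. local_rule d P p (\<lambda>v. dec (shift d u x v)) \<and>
        input_rule d n (\<lambda>v. dec (shift d u x v)))"
    and "embeds d A Y {..<k} X"
  shows "run p (init n) \<noteq> {}"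
proof -
  obtain f where f: "continuous_map (subtopology (config_top d A) Y) (subtopology (config_top d {..<k}) X) f"
    "\<forall>u\<in>lattice d. \<forall>y\<in>Y. f (shift d u y) = shift d u (f y)" "inj_on f Y"
    using assms(9) unfolding embeds_def by blast
  have sub: "finite A" "closedin (config_top d A) Y" "\<And>u x. u \<in> lattice d \<Longrightarrow> x \<in> Y \<Longrightarrow> shift d u x \<in> Y"
    using assms(3) unfolding subshift_def by auto
  note defs = embedding_defects[OF sub y \<open>P > 0\<close> f(1) _ f(3)]
  define x where "x = f y"
  have x: "x \<in> X" "x \<in> configs d {..<k}" "defects d P x \<noteq> {}" "finite (defects d P x)"
    unfolding x_def using defs f(2) by blast+
  define z where "z v = dec (x v)" for v
  have xk: "x v \<in> {..<k}" if "v \<in> lattice d" for v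
    using x(2) that by (auto simp: configs_def)
  \<comment> \<open>Decoding is injective on the symbols in use, so it neither creates nor removes
    violations.\<close>
  have "defects d P z = defects d P x"
  proof -
    have "z v \<noteq> z u \<longleftrightarrow> x v \<noteq> x u" if "v \<in> lattice d" "u \<in> lattice d" for u v
      unfolding z_def using inj_on_eq_iff[OF dec xk[OF that(1)] xk[OF that(2)]] by simp
    then show ?thesis unfolding defects_def by auto
  qed
  moreover have eq: "shift d u z v = dec (shift d u x v)" if "v \<in> lattice d" for u v
    using that by (simp add: shift_apply z_def)
  have "local_rule d P p (shift d u z)" if u: "u \<in> lattice d" for u
  proof -
    have "local_rule d P p (shift d u z) = local_rule d P p (\<lambda>v. dec (shift d u x v))"
      by (rule local_rule_cong) (use eq window_lattice[OF assms(1)] in blast)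
    then show ?thesis using x(1) u unfolding X by blast
  qed
  moreover have "input_rule d n (shift d u z)" if u: "u \<in> lattice d" for u
    using x(1) u eq assms(1) unfolding X by (simp add: input_rule_def del: of_nat_add)
  ultimately show ?thesis
    using rule_config.halts[of d P p z n] x(3,4) assms(1,2) by (auto simp: rule_config_def)
qed

theorem theorem5p1:
  fixes d :: nat and A :: "'a set" and Y :: "(vec \<Rightarrow> 'a) set"
  assumes "d \<ge> 2"
    and "subshift d A Y"
    and "\<exists>y\<in>Y. \<not> strongly_periodic d y \<and> strongly_periodic_outside_finite d A y"
  shows "sigma01_hard (embedding_problem d A Y)"
  unfolding sigma01_hard_def many_one_reducible_def
proof (intro allI impI)
  fix S assume "sigma01 S"
  then obtain p where p: "\<forall>n. n \<in> S \<longleftrightarrow> run p (init n) \<noteq> {}"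
    using sigma01_program by metis
  obtain y q where y: "y \<in> Y" "\<not> strongly_periodic d y"
    and q: "q \<in> configs d A" "strongly_periodic d q" "finite {v \<in> lattice d. y v \<noteq> q v}"
    using assms(3) unfolding strongly_periodic_outside_finite_def by blast
  \<comment> \<open>\<open>P\<close> depends on \<open>Y\<close> and the program on
    \<open>S\<close>, neither on \<open>n\<close>. The alphabet and its numbering are therefore
    constants of the reduction and need not be computed.\<close>
  obtain P where P: "P > 0" "\<And>i. i < d \<Longrightarrow> shift d (axisv d i (int P)) q = q"
    using strongly_periodic_period[OF q(2,1)] by blast
  have fin: "finite (defects d P y)" by (rule finite_defects[OF P(2) q(3)])
  have "finite A" "closedin (config_top d A) Y" using assms(2) by (auto simp: subshift_def)
  then have Y: "Y \<subseteq> configs d A" using closedin_subset topspace_config_top by metis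
  let ?B = "alphabet (Suc P) p A"
  obtain enc where "bij_betw enc ?B {0..<card ?B}"
    using ex_bij_betw_finite_nat[OF finite_alphabet[OF \<open>finite A\<close>]] by blast
  then have enc: "bij_betw enc ?B {..<card ?B}" by (simp add: lessThan_atLeast0)
  define dec where "dec = the_inv_into ?B enc"
  have dec: "dec (enc a) = a" if "a \<in> ?B" for a
    unfolding dec_def using the_inv_into_f_f[OF bij_betw_imp_inj_on[OF enc] that] .
  have "inj_on dec {..<card ?B}"
    unfolding dec_def using bij_betw_the_inv_into[OF enc] by (rule bij_betw_imp_inj_on)
  obtain Q where Q: "computable (\<lambda>n. encode_presentation (Q n))" "\<And>n. valid_presentation d (Q n)"
    "\<And>n. presented_alphabet (Q n) = {..<card ?B}"
    "\<And>n x. x \<in> presented_sft d (Q n) \<longleftrightarrow> x \<in> configs d {..<card ?B} \<and>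
      (\<forall>u\<in>lattice d. local_rule d P p (\<lambda>v. dec (shift d u x v)) \<and>
        input_rule d n (\<lambda>v. dec (shift d u x v)))"
    using exists_presentation[OF assms(1), of "card ?B" P p dec] by blast
  have "n \<in> S \<longleftrightarrow> encode_presentation (Q n) \<in> embedding_problem d A Y" for n
  proof -
    have "encode_presentation (Q n) \<in> embedding_problem d A Y \<longleftrightarrow>
        embeds d A Y {..<card ?B} (presented_sft d (Q n))"
    proof -
      have "encode_presentation (Q n) \<in> embedding_problem d A Y \<longleftrightarrow>
          embeds d A Y (presented_alphabet (Q n)) (presented_sft d (Q n))"
        unfolding embedding_problem_def using Q(2)[of n] injD[OF inj_encode_presentation] by blast
      then show ?thesis unfolding Q(3) .
    qed
    moreover have "embeds d A Y {..<card ?B} (presented_sft d (Q n)) \<longleftrightarrow> run p (init n) \<noteq> {}"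
      using halts_imp_embeds[OF assms(1) P(1) Y enc dec Q(4)]
        embeds_imp_halts[OF assms(1) P(1) assms(2) y fin \<open>inj_on dec _\<close> Q(4)] by blast
    ultimately show ?thesis using p by blast
  qed
  with Q(1) show "\<exists>f. computable f \<and> (\<forall>n. n \<in> S \<longleftrightarrow> f n \<in> embedding_problem d A Y)" by blast
qed

end
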